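(* Let $n\ge2$ and let $(\mathbb P^n\vert\Delta)$ be a smooth orbifold, the support of $\Delta$ consisting of the union of $n+2$ hyperplanes $H_0,\dots,H_{n+1}$ in general position, $\Delta=\sum_{j=0}^{n+1}(1-\frac1{m_j})H_j$, with finite integral multiplicities $2\le m_0\le m_1\le\dots\le m_{n+1}$. Then the generic point of $\mathbb P^n$ is contained in a rational normal curve $C$ of degree $n$ which meets each $H_j$ in a single point, and such a curve is virtually $\Delta$-rational (resp. virtually $\Delta$-elliptic) if $(\mathbb P^n\vert\Delta)$ is Fano (resp. has trivial canonical bundle). Moreover, put $m_j^*:=\max\{m_j,n\}$. Suppose $(\mathbb P^n\vert\Delta)$ is Fano (resp. has trivial canonical bundle). If either $n=2$, or $m_0\ge n$, or more generally, if $\sum_{j=0}^{n+1}\frac1{m_j^*}>1$ (resp. if $\sum_{j=0}^{n+1}\frac1{m_j^*}=1$), then $C$ is also $\Delta$-rational (resp. $\Delta$-elliptic).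
   Context: Everything is over $\mathbb C$. Hyperplanes in $\mathbb P^n$ are in general position if the intersection of any $n+1$ of them is empty. $(\mathbb P^n\vert\Delta)$ is Fano if $-(K_{\mathbb P^n}+\Delta)$ is ample, i.e. $\sum_{j=0}^{n+1}(1-\frac1{m_j})<n+1$, equivalently $\sum_j\frac1{m_j}>1$; it has trivial canonical bundle if $\sum_{j=0}^{n+1}(1-\frac1{m_j})=n+1$, equivalently $\sum_j\frac1{m_j}=1$. Let $(X\vert\Delta)$, $\Delta=\sum_{j\in J}(1-\frac1{m_j})D_j$, be a smooth orbifold ($X$ projective manifold, $\bigcup D_j$ with simple normal crossings). Let $C$ be a smooth connected projective curve and $g:C\to X$ a map birational onto its image, with $g(C)\not\subset\mathrm{Supp}(\Delta)$. For $a\in C$ let $J(a)=\{j\in J: g(a)\in D_j\}$ and, for $j\in J(a)$, let $t_{j,a}$ be the multiplicity of $a$ in $g^*(D_j)$ (order of contact). - Let $\Delta_g=\sum_{a\in C}(1-\frac1{m_g(a)})\{a\}$, where $m_g(a)=1$ if $g(a)\notin\mathrm{Supp}(\Delta)$, and otherwise $m_g(a)=\max_{j\in J(a)}\max\{1,\frac{m_j}{t_{j,a}}\}$. Then $g$ is $\Delta$-rational (resp. $\Delta$-elliptic) if $\deg(K_C+\Delta_g)<0$ (resp. $=0$). - Let $\Delta_g^*$ be defined in the same way, but with $m_g(a)=\max_{j\in J(a)}\frac{m_j}{t_{j,a}}$ when $g(a)\in\mathrm{Supp}(\Delta)$ (so values $<1$ are allowed). Then $g$ is virtually $\Delta$-rational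 (resp. virtually $\Delta$-elliptic) if $\deg(K_C+\Delta_g^* )<0$ (resp. $=0$). A curve $C\subset X$ is said to have one of these properties if its normalisation map has it. *)

theory Defs
  imports "HOL-Complex_Analysis.Complex_Analysis" "Jordan_Normal_Form.Matrix"
begin

text \<open>
  Vectors and matrices are those of \<open>Jordan_Normal_Form.Matrix\<close>; the clashing notation of
  \<open>HOL-Analysis\<close> is switched off.
\<close>

unbundle no vec_syntax
unbundle no inner_syntax

section \<open>Projective space and its Zariski topology\<close>

text \<open>
  A point of \<open>n\<close>-dimensional projective space is the set of all its homogeneous coordinate
  vectors, so the spaces of all dimensions live in the single type \<^typ>\<open>complex vec set\<close>.
\<close>

definition proj_pt :: "complex vec \<Rightarrow> complex vec set" where
  "proj_pt v = {c \<cdot>\<^sub>v v | c. c \<noteq> 0}"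

definition proj_space :: "nat \<Rightarrow> complex vec set set" where
  "proj_space n = {proj_pt v | v. v \<in> carrier_vec (n + 1) \<and> v \<noteq> 0\<^sub>v (n + 1)}"

definition exponents :: "nat \<Rightarrow> nat \<Rightarrow> (nat \<Rightarrow> nat) set" where
  "exponents n d = {\<alpha>. (\<forall>i>n. \<alpha> i = 0) \<and> (\<Sum>i\<le>n. \<alpha> i) = d}"

text \<open>\<open>F\<close> is a homogeneous polynomial of degree \<open>d\<close> in the coordinates \<open>0, \<dots>, n\<close>.\<close>

definition hom_form :: "nat \<Rightarrow> nat \<Rightarrow> (complex vec \<Rightarrow> complex) \<Rightarrow> bool" where
  "hom_form n d F \<longleftrightarrow>
     (\<exists>c. \<forall>v\<in>carrier_vec (n + 1). F v = (\<Sum>\<alpha>\<in>exponents n d. c \<alpha> * (\<Prod>i\<le>n. (v $ i) ^ \<alpha> i)))"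

definition hom_map :: "nat \<Rightarrow> nat \<Rightarrow> nat \<Rightarrow> (complex vec \<Rightarrow> complex vec) \<Rightarrow> bool" where
  "hom_map n k d G \<longleftrightarrow>
     (\<forall>v\<in>carrier_vec (n + 1). G v \<in> carrier_vec (k + 1)) \<and>
     (\<forall>i\<le>k. hom_form n d (\<lambda>v. G v $ i))"

definition hypersurface :: "nat \<Rightarrow> (complex vec \<Rightarrow> complex) \<Rightarrow> complex vec set set" where
  "hypersurface n F = {x \<in> proj_space n. \<forall>v\<in>x. F v = 0}"

definition zariski_closed :: "nat \<Rightarrow> complex vec set set \<Rightarrow> bool" where
  "zariski_closed n Z \<longleftrightarrow>
     (\<exists>\<F>. (\<forall>F\<in>\<F>. \<exists>d. hom_form n d F) \<and> Z = {x \<in> proj_space n. \<forall>F\<in>\<F>. x \<in> hypersurface n F})"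

definition zariski_connected :: "nat \<Rightarrow> complex vec set set \<Rightarrow> bool" where
  "zariski_connected n S \<longleftrightarrow>
     \<not> (\<exists>Z Z'. zariski_closed n Z \<and> zariski_closed n Z' \<and> Z \<noteq> {} \<and> Z' \<noteq> {} \<and>
            Z \<inter> Z' = {} \<and> Z \<union> Z' = S)"

definition holds_generically :: "nat \<Rightarrow> (complex vec set \<Rightarrow> bool) \<Rightarrow> bool" where
  "holds_generically n P \<longleftrightarrow>
     (\<exists>Z. zariski_closed n Z \<and> Z \<noteq> proj_space n \<and> (\<forall>x \<in> proj_space n - Z. P x))"


section \<open>Smooth connected projective curves\<close>

text \<open>
  A local holomorphic parametrisation of \<open>S \<subseteq> \<P>\<^sup>N\<close> at \<open>a\<close>, written in the affine chart where
  the \<open>k\<close>-th coordinate is \<open>1\<close>: an injective map \<open>\<phi>\<close> from a disc into \<open>S\<close> with \<open>\<phi> 0 = a\<close> that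
  is an immersion at \<open>0\<close>.  The last condition says that \<open>\<phi>\<close> maps neighbourhoods of \<open>0\<close> onto
  neighbourhoods of \<open>a\<close> in \<open>S\<close>, so that there is only one branch of \<open>S\<close> at \<open>a\<close>.
\<close>

definition local_param ::
    "nat \<Rightarrow> complex vec set set \<Rightarrow> complex vec set \<Rightarrow> (complex \<Rightarrow> complex vec) \<Rightarrow> real \<Rightarrow> bool" where
  "local_param N S a \<phi> r \<longleftrightarrow> r > 0 \<and> proj_pt (\<phi> 0) = a \<and>
     (\<forall>i\<le>N. (\<lambda>z. \<phi> z $ i) holomorphic_on ball 0 r) \<and>
     (\<exists>i\<le>N. deriv (\<lambda>z. \<phi> z $ i) 0 \<noteq> 0) \<and>
     inj_on \<phi> (ball 0 r) \<and>
     (\<exists>k\<le>N.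
        (\<forall>z\<in>ball 0 r. \<phi> z \<in> carrier_vec (N + 1) \<and> \<phi> z $ k = 1 \<and> proj_pt (\<phi> z) \<in> S) \<and>
        (\<forall>\<rho>. 0 < \<rho> \<and> \<rho> \<le> r \<longrightarrow> (\<exists>\<epsilon>>0. \<forall>v\<in>carrier_vec (N + 1).
            v $ k = 1 \<and> proj_pt v \<in> S \<and> (\<forall>i\<le>N. cmod (v $ i - \<phi> 0 $ i) < \<epsilon>) \<longrightarrow>
            v \<in> \<phi> ` ball 0 \<rho>)))"

definition smooth_curve :: "nat \<Rightarrow> complex vec set set \<Rightarrow> bool" where
  "smooth_curve N S \<longleftrightarrow> zariski_closed N S \<and> S \<noteq> {} \<and> zariski_connected N S \<and>
     (\<forall>a\<in>S. \<exists>\<phi> r. local_param N S a \<phi> r)"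

definition divisor_degree :: "complex vec set set \<Rightarrow> (complex vec set \<Rightarrow> real) \<Rightarrow> real" where
  "divisor_degree S D = (\<Sum>a \<in> {a \<in> S. D a \<noteq> 0}. D a)"

text \<open>
  Rational functions on \<open>S\<close>, as degree \<open>0\<close> homogeneous functions of the coordinate vectors.
  The values at zeros of the denominator (\<open>0\<close> by the convention on division) are never used.
\<close>

definition rational_function :: "nat \<Rightarrow> complex vec set set \<Rightarrow> (complex vec \<Rightarrow> complex) \<Rightarrow> bool" where
  "rational_function N S f \<longleftrightarrow>
     (\<exists>d P Q. hom_form N d P \<and> hom_form N d Q \<and> \<not> S \<subseteq> hypersurface N Q \<and> f = (\<lambda>v. P v / Q v))"

text \<open>
  \<open>K\<close> is the divisor of a nonzero rational \<open>1\<close>-form on \<open>S\<close>.  Every such form is \<open>f dh\<close> for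
  rational functions \<open>f\<close>, \<open>h\<close>; in a local parameter \<open>z\<close> it reads \<open>f (\<phi> z) * (h \<circ> \<phi>)' z dz\<close>.
\<close>

definition canonical_divisor :: "nat \<Rightarrow> complex vec set set \<Rightarrow> (complex vec set \<Rightarrow> int) \<Rightarrow> bool" where
  "canonical_divisor N S K \<longleftrightarrow>
     (\<exists>f h. rational_function N S f \<and> rational_function N S h \<and>
        (\<forall>a\<in>S. \<forall>\<phi> r. local_param N S a \<phi> r \<longrightarrow>
           (let w = (\<lambda>z. f (\<phi> z) * deriv (\<lambda>u. h (\<phi> u)) z)
            in (\<forall>\<^sub>F z in at 0. w z \<noteq> 0) \<and> K a = zorder w 0)))"


section \<open>Maps from curves to projective space\<close>

definition regular_map ::
    "nat \<Rightarrow> complex vec set set \<Rightarrow> nat \<Rightarrow> (complex vec set \<Rightarrow> complex vec set) \<Rightarrow> bool" where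
  "regular_map N S n g \<longleftrightarrow> g ` S \<subseteq> proj_space n \<and>
     (\<forall>a\<in>S. \<exists>d G Z. hom_map N n d G \<and> zariski_closed N Z \<and> a \<notin> Z \<and>
        (\<forall>x\<in>S - Z. \<forall>v\<in>x. G v \<noteq> 0\<^sub>v (n + 1) \<and> g x = proj_pt (G v)))"

text \<open>There is a rational map \<open>[G]\<close> with \<open>[G] \<circ> g = id\<close> on a nonempty open subset of \<open>S\<close>.\<close>

definition birational_onto_image ::
    "nat \<Rightarrow> complex vec set set \<Rightarrow> nat \<Rightarrow> (complex vec set \<Rightarrow> complex vec set) \<Rightarrow> bool" where
  "birational_onto_image N S n g \<longleftrightarrow>
     (\<exists>d G Z. hom_map n N d G \<and> zariski_closed N Z \<and> \<not> S \<subseteq> Z \<and>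
        (\<forall>x\<in>S - Z. \<forall>v\<in>g x. G v \<noteq> 0\<^sub>v (N + 1) \<and> proj_pt (G v) = x))"

definition normalisation ::
    "nat \<Rightarrow> complex vec set set \<Rightarrow> nat \<Rightarrow> (complex vec set \<Rightarrow> complex vec set) \<Rightarrow>
     complex vec set set \<Rightarrow> bool" where
  "normalisation N S n g C \<longleftrightarrow>
     smooth_curve N S \<and> regular_map N S n g \<and> birational_onto_image N S n g \<and> g ` S = C"

text \<open>
  The multiplicity of \<open>a\<close> in \<open>g\<^sup>*D\<close> for the divisor \<open>D = (F = 0)\<close>: \<open>\<psi>\<close> is a local holomorphic
  lift of \<open>g\<close> to homogeneous coordinates.  The order depends neither on the parametrisation
  nor on the lift.
\<close>

definition contact_order ::
    "nat \<Rightarrow> complex vec set set \<Rightarrow> nat \<Rightarrow> (complex vec set \<Rightarrow> complex vec set) \<Rightarrow>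
     (complex vec \<Rightarrow> complex) \<Rightarrow> complex vec set \<Rightarrow> int" where
  "contact_order N S n g F a =
     (THE t. \<exists>\<phi> r \<psi>. local_param N S a \<phi> r \<and>
        (\<forall>i\<le>n. (\<lambda>z. \<psi> z $ i) holomorphic_on ball 0 r) \<and>
        (\<forall>z\<in>ball 0 r. \<psi> z \<in> carrier_vec (n + 1) \<and> \<psi> z \<noteq> 0\<^sub>v (n + 1) \<and>
            g (proj_pt (\<phi> z)) = proj_pt (\<psi> z)) \<and>
        t = zorder (\<lambda>z. F (\<psi> z)) 0)"


section \<open>Orbifold divisors on projective space and orbifold curves\<close>

text \<open>
  The orbifold divisor \<open>\<Delta> = \<Sum>j\<in>J. (1 - 1 / m j) D\<^sub>j\<close> on \<open>\<P>\<^sup>n\<close> is given by \<open>J\<close>, by equations \<open>F j\<close>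
  of the hypersurfaces \<open>D\<^sub>j\<close>, and by \<open>m\<close>.  The functions below yield, for \<open>a \<in> S\<close>, the
  multiplicity \<open>m\<^sub>g(a)\<close> in its two versions.
\<close>

definition orbifold_support ::
    "nat \<Rightarrow> nat set \<Rightarrow> (nat \<Rightarrow> complex vec \<Rightarrow> complex) \<Rightarrow> complex vec set set" where
  "orbifold_support n J F = (\<Union>j\<in>J. hypersurface n (F j))"

definition orb_mult ::
    "nat \<Rightarrow> complex vec set set \<Rightarrow> nat \<Rightarrow> (complex vec set \<Rightarrow> complex vec set) \<Rightarrow>
     nat set \<Rightarrow> (nat \<Rightarrow> complex vec \<Rightarrow> complex) \<Rightarrow> (nat \<Rightarrow> nat) \<Rightarrow> complex vec set \<Rightarrow> real" where
  "orb_mult N S n g J F m a =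
     (let Ja = {j \<in> J. g a \<in> hypersurface n (F j)}
      in if Ja = {} then 1
         else Max ((\<lambda>j. max 1 (real (m j) / of_int (contact_order N S n g (F j) a))) ` Ja))"

definition virtual_orb_mult ::
    "nat \<Rightarrow> complex vec set set \<Rightarrow> nat \<Rightarrow> (complex vec set \<Rightarrow> complex vec set) \<Rightarrow>
     nat set \<Rightarrow> (nat \<Rightarrow> complex vec \<Rightarrow> complex) \<Rightarrow> (nat \<Rightarrow> nat) \<Rightarrow> complex vec set \<Rightarrow> real" where
  "virtual_orb_mult N S n g J F m a =
     (let Ja = {j \<in> J. g a \<in> hypersurface n (F j)}
      in if Ja = {} then 1
         else Max ((\<lambda>j. real (m j) / of_int (contact_order N S n g (F j) a)) ` Ja))"

text \<open>
  \<open>deg (K + \<Sum>a. (1 - 1 / \<mu> a) a) = \<delta>\<close>; any two canonical divisors have the same degree, so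
  it does not matter which one is taken.
\<close>

definition log_canonical_degree_is ::
    "nat \<Rightarrow> complex vec set set \<Rightarrow> (complex vec set \<Rightarrow> real) \<Rightarrow> real \<Rightarrow> bool" where
  "log_canonical_degree_is N S \<mu> \<delta> \<longleftrightarrow>
     (\<exists>K. canonical_divisor N S K \<and> divisor_degree S (\<lambda>a. of_int (K a) + (1 - 1 / \<mu> a)) = \<delta>)"

text \<open>
  The four properties of a curve \<open>C \<subseteq> \<P>\<^sup>n\<close> are those of its normalisation map, which is unique
  up to isomorphism.
\<close>

definition orb_rational ::
    "nat \<Rightarrow> nat set \<Rightarrow> (nat \<Rightarrow> complex vec \<Rightarrow> complex) \<Rightarrow> (nat \<Rightarrow> nat) \<Rightarrow> complex vec set set \<Rightarrow> bool"
  where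
  "orb_rational n J F m C \<longleftrightarrow> \<not> C \<subseteq> orbifold_support n J F \<and>
     (\<exists>N S g. normalisation N S n g C \<and>
        (\<exists>\<delta><0. log_canonical_degree_is N S (orb_mult N S n g J F m) \<delta>))"

definition orb_elliptic ::
    "nat \<Rightarrow> nat set \<Rightarrow> (nat \<Rightarrow> complex vec \<Rightarrow> complex) \<Rightarrow> (nat \<Rightarrow> nat) \<Rightarrow> complex vec set set \<Rightarrow> bool"
  where
  "orb_elliptic n J F m C \<longleftrightarrow> \<not> C \<subseteq> orbifold_support n J F \<and>
     (\<exists>N S g. normalisation N S n g C \<and>
        log_canonical_degree_is N S (orb_mult N S n g J F m) 0)"

definition virtually_orb_rational ::
    "nat \<Rightarrow> nat set \<Rightarrow> (nat \<Rightarrow> complex vec \<Rightarrow> complex) \<Rightarrow> (nat \<Rightarrow> nat) \<Rightarrow> complex vec set set \<Rightarrow> bool"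
  where
  "virtually_orb_rational n J F m C \<longleftrightarrow> \<not> C \<subseteq> orbifold_support n J F \<and>
     (\<exists>N S g. normalisation N S n g C \<and>
        (\<exists>\<delta><0. log_canonical_degree_is N S (virtual_orb_mult N S n g J F m) \<delta>))"

definition virtually_orb_elliptic ::
    "nat \<Rightarrow> nat set \<Rightarrow> (nat \<Rightarrow> complex vec \<Rightarrow> complex) \<Rightarrow> (nat \<Rightarrow> nat) \<Rightarrow> complex vec set set \<Rightarrow> bool"
  where
  "virtually_orb_elliptic n J F m C \<longleftrightarrow> \<not> C \<subseteq> orbifold_support n J F \<and>
     (\<exists>N S g. normalisation N S n g C \<and>
        log_canonical_degree_is N S (virtual_orb_mult N S n g J F m) 0)"


section \<open>Hyperplane arrangements and rational normal curves\<close>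

definition linear_form :: "complex vec \<Rightarrow> complex vec \<Rightarrow> complex" where
  "linear_form h v = h \<bullet> v"

definition hyperplane :: "nat \<Rightarrow> complex vec \<Rightarrow> complex vec set set" where
  "hyperplane n h = hypersurface n (linear_form h)"

definition general_position :: "nat \<Rightarrow> nat set \<Rightarrow> (nat \<Rightarrow> complex vec) \<Rightarrow> bool" where
  "general_position n J h \<longleftrightarrow>
     (\<forall>I\<subseteq>J. card I = n + 1 \<longrightarrow> (\<Inter>j\<in>I. hyperplane n (h j)) = {})"

text \<open>
  \<open>-(K + \<Delta>)\<close> has degree \<open>n + 1 - (\<Sum>j. 1 - 1 / m j)\<close>, and a \<open>\<rat>\<close>-divisor on \<open>\<P>\<^sup>n\<close> is ample
  iff its degree is positive.
\<close>

definition fano :: "nat \<Rightarrow> (nat \<Rightarrow> nat) \<Rightarrow> bool" where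
  "fano n m \<longleftrightarrow> (\<Sum>j\<le>n + 1. 1 - 1 / real (m j)) < real n + 1"

definition trivial_canonical_bundle :: "nat \<Rightarrow> (nat \<Rightarrow> nat) \<Rightarrow> bool" where
  "trivial_canonical_bundle n m \<longleftrightarrow> (\<Sum>j\<le>n + 1. 1 - 1 / real (m j)) = real n + 1"

text \<open>
  A rational normal curve of degree \<open>n\<close> in \<open>\<P>\<^sup>n\<close> is the image of the Veronese curve
  \<open>[s^n : s^(n-1) t : \<dots> : t^n]\<close> under a projective linear automorphism \<open>A\<close>.
\<close>

definition veronese :: "nat \<Rightarrow> complex \<Rightarrow> complex \<Rightarrow> complex vec" where
  "veronese n s t = vec (n + 1) (\<lambda>i. s ^ (n - i) * t ^ i)"

definition rational_normal_curve :: "nat \<Rightarrow> complex vec set set \<Rightarrow> bool" where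
  "rational_normal_curve n C \<longleftrightarrow>
     (\<exists>A \<in> carrier_mat (n + 1) (n + 1). invertible_mat A \<and>
        C = {proj_pt (A *\<^sub>v veronese n s t) | s t. (s, t) \<noteq> (0, 0)})"

end

theory Submission
  imports Defs "Jordan_Normal_Form.Determinant"
    "HOL-Computational_Algebra.Fundamental_Theorem_Algebra"
begin

text \<open>
  Parametrise a rational normal curve by \<open>g [s : t] = [G (s, t)]\<close>.  It meets a hyperplane in a
  single point iff the equation pulls back to a multiple of an \<open>n\<close>-th power \<open>(q s - p t)\<^sup>n\<close>, so the
  order of contact there is \<open>n\<close>.  By general position the \<open>n + 2\<close> contact points are distinct, and
  \<open>deg (K + \<Delta>)\<close> on the curve is \<open>- 2 + (\<Sum>j. 1 - n / m\<^sub>j) = n (1 - \<Sum>j. 1 / m\<^sub>j)\<close>, with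
  \<open>max (m\<^sub>j) n\<close> in place of \<open>m\<^sub>j\<close> for the non-virtual version.

  For existence, choose coordinates in which the hyperplanes are \<open>y\<^sub>j = 0\<close> for \<open>j \<le> n\<close> and
  \<open>\<Sum>j\<le>n. y\<^sub>j = 0\<close>.  The curve with \<open>j\<close>-th coordinate \<open>y\<^sub>j (s - b\<^sub>j t)\<^sup>n\<close> passes through \<open>y\<close> at
  \<open>[1 : 0]\<close>, and the sum of its coordinates is \<open>(\<Sum>j\<le>n. y\<^sub>j) s\<^sup>n\<close> iff \<open>\<Sum>j\<le>n. y\<^sub>j b\<^sub>j\<^sup>k = 0\<close> for
  \<open>1 \<le> k \<le> n\<close>.  If no nonempty partial sum of the \<open>y\<^sub>j\<close> vanishes, the \<open>b\<^sub>j\<close> of any nonzero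
  solution are distinct and nonzero, so the Jacobian of this system in \<open>b\<close> is nonsingular, while the
  solutions with \<open>max \<bar>b\<^sub>j\<bar> = 1\<close> form a compact set.  Hence along the complex line joining
  \<open>(1, \<dots>, 1)\<close>, where the roots of unity are a solution, to \<open>y\<close>, solvability is an open and closed
  condition off finitely many points, and it holds at \<open>y\<close>.
\<close>

no_notation fps_nth (infixl "$" 75)
no_notation fls_nth (infixl "$$" 75)

section \<open>Weighted power sums\<close>

text \<open>Projective dimension theory would solve the power sum equations at once, as they are
  \<open>n\<close> homogeneous equations in the \<open>n + 1\<close> unknowns b_j. The continuation
  argument replaces it. Homogeneity supplies both halves: rescaling a nonzero solution puts it into
  the compact set used for closedness, and fixing b_0 removes the scaling and leaves
  \<open>n\<close> equations in \<open>n\<close> unknowns, whose Jacobian is a Vandermonde matrix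
  with rescaled rows and columns. The line is complex because the plane stays connected after the
  removal of finitely many points, whereas a real segment might be cut. The degree statements
  concern every rational normal curve with single contacts, not just the constructed ones, so the
  shape of the pulled-back equations has to be derived from the contact condition, by the
  fundamental theorem of algebra. The orbifold properties ask for some normalisation, and the
  projective line serves; but canonical divisors and contact orders refer to arbitrary local
  parameters and lifts, so orders are computed for all of these.\<close>

lemma trivial_kernel_imp_inverse:
  fixes A :: "'a :: field mat"
  assumes A: "A \<in> carrier_mat n n"
    and ker: "\<And>v. v \<in> carrier_vec n \<Longrightarrow> A *\<^sub>v v = 0\<^sub>v n \<Longrightarrow> v = 0\<^sub>v n"
  obtains B where "B \<in> carrier_mat n n" "A * B = 1\<^sub>m n" "B * A = 1\<^sub>m n"
proof -
  have "det A \<noteq> 0"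
    using det_0_iff_vec_prod_zero_field[OF A] ker by blast
  from det_non_zero_imp_unit[OF A this, of "()"]
  show ?thesis using that unfolding Units_def by (auto simp: ring_mat_simps)
qed

lemma poly_eq_sum_coeffs:
  fixes p :: "'a :: comm_ring_1 poly"
  assumes "degree p \<le> n"
  shows "poly p x = (\<Sum>k\<le>n. coeff p k * x ^ k)"
  unfolding poly_altdef using assms
  by (intro sum.mono_neutral_left) (auto simp: coeff_eq_0)

text \<open>A nonzero polynomial of degree below \<open>n\<close> has fewer than \<open>n\<close>
  roots. This Vandermonde argument without determinants gives the nonsingular Jacobian, the
  nondegeneracy of the curve and the invertibility of its matrix.\<close>

lemma poly_coeffs_zero:
  fixes c :: "nat \<Rightarrow> 'a :: {comm_ring_1,ring_no_zero_divisors}"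
  assumes inj: "inj_on b {..<n}"
    and z: "\<And>i. i < n \<Longrightarrow> (\<Sum>k<n. c k * b i ^ k) = 0"
    and k: "k < n"
  shows "c k = 0"
proof -
  define p where "p = (\<Sum>k<n. monom (c k) k)"
  have cp: "coeff p j = (if j < n then c j else 0)" for j
    by (auto simp: p_def coeff_sum coeff_monom)
  have "p = 0"
  proof (rule ccontr)
    assume "p \<noteq> 0"
    have "degree p < n"
      using k by (metis \<open>p \<noteq> 0\<close> cp leading_coeff_0_iff)
    have "b ` {..<n} \<subseteq> {x. poly p x = 0}"
      using z by (auto simp: p_def poly_sum poly_monom)
    hence "card (b ` {..<n}) \<le> card {x. poly p x = 0}"
      using poly_roots_finite[OF \<open>p \<noteq> 0\<close>] by (intro card_mono) auto
    also have "\<dots> \<le> degree p" using card_poly_roots_bound[OF \<open>p \<noteq> 0\<close>] .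
    finally show False using \<open>degree p < n\<close> by (simp add: card_image inj)
  qed
  thus ?thesis using cp[of k] k by simp
qed

text \<open>By linearity the equations say that the weighted sum of the \<open>q (b j)\<close> is 0
  for every polynomial \<open>q\<close> of degree at most \<open>n\<close> without constant term. If
  \<open>b\<close> had at most \<open>n\<close> nonzero values, such a \<open>q\<close> could vanish
  at all of them but one, which would leave a partial sum of the \<open>y j\<close>. So
  \<open>n + 1\<close> nonzero values occur among \<open>n + 1\<close> indices.\<close>

lemma weighted_power_sums_distinct:
  fixes y b :: "nat \<Rightarrow> 'a :: field"
  assumes sub: "\<And>I. I \<subseteq> {..n} \<Longrightarrow> I \<noteq> {} \<Longrightarrow> (\<Sum>j\<in>I. y j) \<noteq> 0"
    and eq: "\<And>k. k \<in> {1..n} \<Longrightarrow> (\<Sum>j\<le>n. y j * b j ^ k) = 0"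
    and nz: "\<exists>j\<le>n. b j \<noteq> 0"
  shows "inj_on b {..n}" and "\<And>j. j \<le> n \<Longrightarrow> b j \<noteq> 0"
proof -
  define V where "V = b ` {..n} - {0}"
  have fV: "finite V" by (simp add: V_def)
  obtain \<beta> where \<beta>: "\<beta> \<in> V" using nz by (auto simp: V_def)
  have "card V > n"
  proof (rule ccontr)
    assume "\<not> card V > n"
    \<comment> \<open>Of degree \<open>card V\<close>: it vanishes at 0 and at every nonzero value
      of \<open>b\<close> except \<open>\<beta>\<close>.\<close>
    define q where "q = [:0, 1:] * (\<Prod>\<gamma>\<in>V - {\<beta>}. [:- \<gamma>, 1:])"
    have "degree q \<le> 1 + (\<Sum>\<gamma>\<in>V - {\<beta>}. degree [:- \<gamma>, 1:])"
      unfolding q_def using fV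
      by (intro order.trans[OF degree_mult_le] add_mono order.trans[OF degree_prod_sum_le]) auto
    also have "\<dots> = card V" using \<beta> fV by (simp add: card_Diff_singleton) (metis Suc_pred card_gt_0_iff empty_iff)
    finally have deg: "degree q \<le> n" using \<open>\<not> card V > n\<close> by simp
    have q0: "coeff q 0 = 0" by (simp add: q_def coeff_mult)
    have "(\<Sum>j\<le>n. y j * poly q (b j)) = (\<Sum>j\<le>n. \<Sum>k\<le>n. coeff q k * (y j * b j ^ k))"
      by (simp add: poly_eq_sum_coeffs[OF deg] sum_distrib_left mult_ac)
    also have "\<dots> = (\<Sum>k\<le>n. coeff q k * (\<Sum>j\<le>n. y j * b j ^ k))"
      by (subst sum.swap) (simp add: sum_distrib_left)
    also have "\<dots> = 0"
    proof (intro sum.neutral ballI)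
      fix k assume "k \<in> {..n}"
      thus "coeff q k * (\<Sum>j\<le>n. y j * b j ^ k) = 0"
        using q0 eq[of k] by (cases "k = 0") auto
    qed
    finally have s0: "(\<Sum>j\<le>n. y j * poly q (b j)) = 0" .
    have "(\<Sum>j\<le>n. y j * poly q (b j)) = (\<Sum>j\<in>{j. j \<le> n \<and> b j = \<beta>}. y j * poly q \<beta>)"
    proof (rule sum.mono_neutral_cong_right)
      show "\<forall>i\<in>{..n} - {j. j \<le> n \<and> b j = \<beta>}. y i * poly q (b i) = 0"
      proof
        fix i assume i: "i \<in> {..n} - {j. j \<le> n \<and> b j = \<beta>}"
        have "b i = 0 \<or> b i \<in> V - {\<beta>}" using i by (auto simp: V_def)
        hence "poly q (b i) = 0" using fV by (auto simp: q_def poly_prod)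
        thus "y i * poly q (b i) = 0" by simp
      qed
    qed auto
    also have "\<dots> = (\<Sum>j\<in>{j. j \<le> n \<and> b j = \<beta>}. y j) * poly q \<beta>"
      by (simp add: sum_distrib_right)
    finally have "(\<Sum>j\<in>{j. j \<le> n \<and> b j = \<beta>}. y j) * poly q \<beta> = 0" using s0 by simp
    moreover have "poly q \<beta> \<noteq> 0" using \<beta> fV by (auto simp: q_def poly_prod V_def)
    moreover have "(\<Sum>j\<in>{j. j \<le> n \<and> b j = \<beta>}. y j) \<noteq> 0"
      using \<beta> by (intro sub) (auto simp: V_def)
    ultimately show False by simp
  qed
  moreover have "card (b ` {..n}) \<le> n + 1" using card_image_le[of "{..n}" b] by simp
  moreover have "card V \<le> card (b ` {..n})" by (auto simp: V_def intro!: card_mono)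
  ultimately have ci: "card (b ` {..n}) = n + 1" "card V = n + 1" by simp_all
  show "inj_on b {..n}" using ci(1) by (intro eq_card_imp_inj_on) auto
  have "V = b ` {..n}" using ci by (intro card_subset_eq) (auto simp: V_def)
  thus "b j \<noteq> 0" if "j \<le> n" for j using that by (force simp: V_def)
qed

section \<open>Continuation of solutions: stability, compactness and connectedness\<close>

lemma compact_PiE_UNIV:
  fixes B :: "nat \<Rightarrow> complex set"
  assumes "\<And>i. compact (B i)"
  shows "compact (Pi\<^sub>E UNIV B)"
proof -
  \<comment> \<open>Tychonoff. The product runs over all of \<open>nat\<close> because the function
    type carries that topology; later the coordinates beyond \<open>n\<close> are confined to
    \<open>{0}\<close>.\<close>
  have "compactin (product_topology (\<lambda>i. euclidean) UNIV) (Pi\<^sub>E UNIV B)"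
    unfolding compactin_PiE using assms by simp
  thus ?thesis by (simp add: euclidean_product_topology)
qed

text \<open>
  Stability of a nondegenerate zero, with \<open>u 0\<close> kept fixed: the system is an identity matrix to
  first order at \<open>b\<close>, and the map \<open>T\<close> of the proof is a contraction of a small cube in the
  \<open>\<ell>\<^sup>1\<close>-distance.  As \<open>nat \<Rightarrow> complex\<close> has no norm, its fixed point is found by minimising the
  distance from \<open>u\<close> to \<open>T u\<close>.
\<close>
lemma newton_perturbation:
  fixes L L' :: "nat \<Rightarrow> complex \<Rightarrow> complex" and y b :: "nat \<Rightarrow> complex"
  assumes der: "\<And>j x. j \<in> {1..n} \<Longrightarrow> (L j has_field_derivative L' j x) (at x)"
    and cont: "\<And>j x. j \<in> {1..n} \<Longrightarrow> isCont (L' j) x"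
    and delta: "\<And>i j. i \<in> {1..n} \<Longrightarrow> j \<in> {1..n} \<Longrightarrow> L' j (b i) = (if i = j then 1 else 0)"
    and eq: "\<And>j. j \<in> {1..n} \<Longrightarrow> (\<Sum>i\<le>n. y i * L j (b i)) = 0"
    and nz: "\<And>j. j \<le> n \<Longrightarrow> y j \<noteq> 0"
  shows "\<exists>e>0. \<forall>y'. (\<forall>i\<le>n. cmod (y' i - y i) < e) \<longrightarrow>
           (\<exists>u. u 0 = b 0 \<and> (\<forall>j\<in>{1..n}. (\<Sum>i\<le>n. y' i * L j (u i)) = 0))"
proof -
  \<comment> \<open>One bound for all sizes that enter the estimates; the summand 1 ensures
    \<open>C \<ge> 1\<close>.\<close>
  define C where "C = 1 + (\<Sum>i\<le>n. cmod (y i)) + (\<Sum>i\<le>n. 1 / cmod (y i)) +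
    (\<Sum>i\<le>n. \<Sum>j\<in>{1..n}. cmod (L j (b i)))"
  have nn: "0 \<le> (\<Sum>i\<le>n. cmod (y i))" "0 \<le> (\<Sum>i\<le>n. 1 / cmod (y i))"
     "0 \<le> (\<Sum>i\<le>n. \<Sum>j\<in>{1..n}. cmod (L j (b i)))"
    by (auto intro!: sum_nonneg)
  have C1: "C \<ge> 1" using nn unfolding C_def by linarith
  have Cy: "cmod (y i) \<le> C" if "i \<le> n" for i
  proof -
    have "cmod (y i) \<le> (\<Sum>i\<le>n. cmod (y i))" using that by (intro member_le_sum) auto
    thus ?thesis using nn unfolding C_def by linarith
  qed
  have Ciy: "1 / cmod (y i) \<le> C" if "i \<le> n" for i
  proof -
    have "1 / cmod (y i) \<le> (\<Sum>i\<le>n. 1 / cmod (y i))" using that by (intro member_le_sum) auto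
    thus ?thesis using nn unfolding C_def by linarith
  qed
  have CL: "cmod (L j (b i)) \<le> C" if "i \<le> n" "j \<in> {1..n}" for i j
  proof -
    have "cmod (L j (b i)) \<le> (\<Sum>j\<in>{1..n}. cmod (L j (b i)))" using that by (intro member_le_sum) auto
    also have "\<dots> \<le> (\<Sum>i\<le>n. \<Sum>j\<in>{1..n}. cmod (L j (b i)))"
      using that(1) by (intro member_le_sum[of i "{..n}" "\<lambda>i. \<Sum>j\<in>{1..n}. cmod (L j (b i))"]) (auto intro!: sum_nonneg)
    finally show ?thesis using nn unfolding C_def by linarith
  qed
  define N where "N = real n + 1"
  have N1: "N \<ge> 1" by (simp add: N_def)
  \<comment> \<open>Chosen so that \<open>(2 * C) * C * \<eta> = 1/(4*N)\<close>, the factor of each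
    error term in \<open>main\<close>.\<close>
  define \<eta> where "\<eta> = 1 / (8 * C\<^sup>2 * N)"
  have \<eta>0: "\<eta> > 0" using C1 N1 by (simp add: \<eta>_def)
  have "\<exists>r>0. \<forall>i\<in>{1..n}. \<forall>j\<in>{1..n}. \<forall>s. dist s (b i) \<le> r \<longrightarrow> cmod (L' j s - L' j (b i)) \<le> \<eta>"
  proof -
    have "\<forall>i j. \<exists>d>0. i \<in> {1..n} \<longrightarrow> j \<in> {1..n} \<longrightarrow> (\<forall>s. dist s (b i) \<le> d \<longrightarrow> cmod (L' j s - L' j (b i)) \<le> \<eta>)"
    proof (intro allI)
      fix i j
      show "\<exists>d>0. i \<in> {1..n} \<longrightarrow> j \<in> {1..n} \<longrightarrow> (\<forall>s. dist s (b i) \<le> d \<longrightarrow> cmod (L' j s - L' j (b i)) \<le> \<eta>)"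
      proof (cases "j \<in> {1..n}")
        case True
        from cont[OF True, of "b i"] \<eta>0 obtain d where "d > 0" and
          d: "\<And>s. dist s (b i) < d \<Longrightarrow> dist (L' j s) (L' j (b i)) < \<eta>"
          unfolding continuous_at_eps_delta by blast
        show ?thesis by (rule exI[of _ "d/2"]) (use \<open>d > 0\<close> d in \<open>fastforce simp: dist_norm intro: less_imp_le\<close>)
      qed (auto intro: exI[of _ 1])
    qed
    then obtain d where d: "\<And>i j. d i j > (0::real)"
      "\<And>i j s. i \<in> {1..n} \<Longrightarrow> j \<in> {1..n} \<Longrightarrow> dist s (b i) \<le> d i j \<Longrightarrow> cmod (L' j s - L' j (b i)) \<le> \<eta>"
      by metis
    define r where "r = Min (insert 1 ((\<lambda>(i,j). d i j) ` ({1..n} \<times> {1..n})))"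
    have "r > 0" unfolding r_def by (subst Min_gr_iff) (auto simp: d(1))
    moreover have "r \<le> d i j" if "i \<in> {1..n}" "j \<in> {1..n}" for i j
      unfolding r_def using that by (intro Min_le) auto
    ultimately show ?thesis using d(2) by (meson order.trans)
  qed
  then obtain r where r0: "r > 0" and
    r: "\<And>i j s. i \<in> {1..n} \<Longrightarrow> j \<in> {1..n} \<Longrightarrow> dist s (b i) \<le> r \<Longrightarrow> cmod (L' j s - L' j (b i)) \<le> \<eta>"
    by blast
  \<comment> \<open>Mean value inequality for the deviation of \<open>L j\<close> from its linear
    part at \<open>b i\<close>, which by \<open>delta\<close> is the identity for
    \<open>i = j\<close> and zero otherwise.\<close>
  have lip: "cmod ((L j s - (if i = j then s else 0)) - (L j t - (if i = j then t else 0))) \<le> \<eta> * cmod (s - t)"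
    if ij: "i \<in> {1..n}" "j \<in> {1..n}" and "s \<in> cball (b i) r" "t \<in> cball (b i) r" for i j s t
  proof (rule field_differentiable_bound[where S = "cball (b i) r" and f' = "\<lambda>x. L' j x - (if i = j then 1 else 0)"])
    show "((\<lambda>s. L j s - (if i = j then s else 0)) has_field_derivative L' j z - (if i = j then 1 else 0)) (at z within cball (b i) r)" for z
      using der[OF ij(2), of z] by (auto intro!: derivative_eq_intros intro: DERIV_subset)
    show "norm (L' j z - (if i = j then 1 else 0)) \<le> \<eta>" if "z \<in> cball (b i) r" for z
      using r[OF ij, of z] that delta[OF ij] by (auto simp: dist_commute)
  qed (use that in auto)
  \<comment> \<open>The three bounds serve in turn for \<open>cmod (y' i) \<le> 2 * C\<close>, for
    the factor 1/4 of the own coordinate in \<open>main\<close>, and for the displacement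
    \<open>r / 2\<close> of the centre.\<close>
  define e where "e = min C (min (1 / (4 * C)) (r / (2 * N * C\<^sup>2)))"
  have e0: "e > 0" using C1 N1 r0 by (simp add: e_def)
  have e1: "e \<le> C" "e * C \<le> 1/4" "N * C\<^sup>2 * e \<le> r / 2"
  proof -
    show "e \<le> C" by (simp add: e_def)
    have "e \<le> 1 / (4 * C)" by (simp add: e_def)
    thus "e * C \<le> 1/4" using C1 by (simp add: field_simps)
    have "e \<le> r / (2 * N * C\<^sup>2)" by (simp add: e_def)
    thus "N * C\<^sup>2 * e \<le> r / 2" using C1 N1 by (simp add: field_simps)
  qed
  show ?thesis
  proof (intro exI[of _ e] conjI allI impI)
    show "e > 0" by fact
    fix y' assume y': "\<forall>i\<le>n. cmod (y' i - y i) < e"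
    \<comment> \<open>A simplified Newton step: the Jacobian of the unperturbed system at
      \<open>b\<close> is diagonal with entries \<open>y j\<close>. Coordinate 0 is frozen, and
      those beyond \<open>n\<close> are set to 0 to stay in the compact set
      \<open>K\<close>.\<close>
    define T where "T = (\<lambda>u j. if j \<in> {1..n} then u j - (\<Sum>i\<le>n. y' i * L j (u i)) / y j else if j = 0 then b 0 else 0)"
    define B where "B = (\<lambda>i. if i = 0 then {b 0} else if i \<le> n then cball (b i) r else {0})"
    define K where "K = Pi\<^sub>E UNIV B"
    have cK: "compact K" unfolding K_def by (intro compact_PiE_UNIV) (auto simp: B_def)
    have Kb: "u i \<in> cball (b i) r" if "u \<in> K" "i \<in> {1..n}" for u i
      using that by (auto simp: K_def B_def PiE_iff split: if_splits dest!: spec[of _ i])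
    have K0: "u 0 = b 0" if "u \<in> K" for u
      using that by (auto simp: K_def B_def PiE_iff dest!: spec[of _ 0])
    have y'C: "cmod (y' i) \<le> 2 * C" if "i \<le> n" for i
    proof -
      have "cmod (y' i) \<le> cmod (y' i - y i) + cmod (y i)" by (metis diff_add_cancel norm_triangle_ineq)
      thus ?thesis using y' that Cy[OF that] e1(1) by fastforce
    qed
    \<comment> \<open>Summed over \<open>j\<close>, this makes \<open>T\<close> a contraction with
      factor at most 1/2, since \<open>n \<le> N\<close>.\<close>
    have main: "cmod (T u j - T v j) \<le> 1/4 * cmod (u j - v j) + 1/(4*N) * (\<Sum>i\<in>{1..n}. cmod (u i - v i))"
      if uv: "u \<in> K" "v \<in> K" and j: "j \<in> {1..n}" for u v j
    proof -
      define E where "E = (\<lambda>i. (L j (u i) - (if i = j then u i else 0)) - (L j (v i) - (if i = j then v i else 0)))"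
      have yj: "y j \<noteq> 0" using nz j by auto
      have "(\<Sum>i\<le>n. y' i * L j (u i)) - (\<Sum>i\<le>n. y' i * L j (v i)) = (\<Sum>i\<le>n. y' i * (L j (u i) - L j (v i)))"
        by (simp add: sum_subtractf right_diff_distrib)
      also have "\<dots> = (\<Sum>i\<in>{1..n}. y' i * (L j (u i) - L j (v i)))"
        using K0[OF uv(1)] K0[OF uv(2)] by (intro sum.mono_neutral_right) (auto simp: Suc_le_eq)
      also have "\<dots> = (\<Sum>i\<in>{1..n}. (if i = j then y' i * (u i - v i) else 0) + y' i * E i)"
        by (intro sum.cong) (auto simp: E_def algebra_simps)
      also have "\<dots> = y' j * (u j - v j) + (\<Sum>i\<in>{1..n}. y' i * E i)"
        using j by (simp add: sum.distrib)
      finally have *: "(\<Sum>i\<le>n. y' i * L j (u i)) - (\<Sum>i\<le>n. y' i * L j (v i)) =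
        y' j * (u j - v j) + (\<Sum>i\<in>{1..n}. y' i * E i)" .
      have "T u j - T v j = (u j - v j) - ((\<Sum>i\<le>n. y' i * L j (u i)) - (\<Sum>i\<le>n. y' i * L j (v i))) / y j"
        using j by (simp add: T_def diff_divide_distrib)
      also have "\<dots> = (y j - y' j) / y j * (u j - v j) - (\<Sum>i\<in>{1..n}. y' i / y j * E i)"
        unfolding * using yj by (simp add: add_divide_distrib sum_divide_distrib diff_divide_distrib left_diff_distrib)
      finally have "cmod (T u j - T v j) \<le> cmod ((y j - y' j) / y j * (u j - v j)) + cmod (\<Sum>i\<in>{1..n}. y' i / y j * E i)"
        by (simp only: norm_triangle_ineq4)
      moreover have "cmod ((y j - y' j) / y j * (u j - v j)) \<le> 1/4 * cmod (u j - v j)"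
      proof -
        have "cmod ((y j - y' j) / y j) = cmod (y' j - y j) * (1 / cmod (y j))"
          by (simp add: norm_divide norm_minus_commute)
        also have "\<dots> \<le> e * C" using y' j Ciy[of j] e0 by (intro mult_mono) (auto intro: less_imp_le)
        finally show ?thesis unfolding norm_mult using e1(2) by (intro mult_right_mono) auto
      qed
      moreover have "cmod (\<Sum>i\<in>{1..n}. y' i / y j * E i) \<le> 1/(4*N) * (\<Sum>i\<in>{1..n}. cmod (u i - v i))"
        unfolding sum_distrib_left
      proof (rule sum_norm_le)
        fix i assume i: "i \<in> {1..n}"
        have "cmod (y' i / y j * E i) = cmod (y' i) * (1 / cmod (y j)) * cmod (E i)"
          by (simp add: norm_mult norm_divide)
        also have "\<dots> \<le> (2 * C) * C * (\<eta> * cmod (u i - v i))"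
          using y'C[of i] Ciy[of j] C1 i j lip[OF i j Kb[OF uv(1) i] Kb[OF uv(2) i]]
          by (intro mult_mono) (auto simp: E_def)
        also have "\<dots> = 1/(4*N) * cmod (u i - v i)"
          using C1 N1 by (simp add: \<eta>_def field_simps power2_eq_square)
        finally show "cmod (y' i / y j * E i) \<le> 1/(4*N) * cmod (u i - v i)" .
      qed
      ultimately show ?thesis by linarith
    qed
    define b0 where "b0 = (\<lambda>i. if i \<le> n then b i else 0)"
    have b0K: "b0 \<in> K" using r0 by (auto simp: K_def B_def b0_def)
    have Tb0: "cmod (T b0 j - b j) \<le> r / 2" if j: "j \<in> {1..n}" for j
    proof -
      have "(\<Sum>i\<le>n. y' i * L j (b0 i)) = (\<Sum>i\<le>n. (y' i - y i) * L j (b i))"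
        using eq[OF j] by (simp add: b0_def left_diff_distrib sum_subtractf)
      hence "cmod (T b0 j - b j) = cmod (\<Sum>i\<le>n. (y' i - y i) * L j (b i)) * (1 / cmod (y j))"
        using j by (simp add: T_def b0_def norm_divide)
      also have "\<dots> \<le> (\<Sum>i\<le>n. e * C) * C"
      proof (intro mult_mono sum_norm_le)
        fix i assume "i \<in> {..n}"
        thus "cmod ((y' i - y i) * L j (b i)) \<le> e * C"
          unfolding norm_mult using y' CL[of i j] j e0 by (intro mult_mono) (auto intro: less_imp_le)
      qed (use Ciy j C1 e0 in \<open>auto intro!: sum_nonneg\<close>)
      also have "\<dots> = N * C\<^sup>2 * e" by (simp add: N_def power2_eq_square)
      finally show ?thesis using e1(3) by simp
    qed
    \<comment> \<open>The budget is \<open>r/4\<close> from the own coordinate, \<open>r/4\<close>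
      from the sum over all coordinates and \<open>r/2\<close> from the displacement of
      \<open>b0\<close>.\<close>
    have TK: "T u \<in> K" if u: "u \<in> K" for u
    proof -
      have "T u j \<in> cball (b j) r" if j: "j \<in> {1..n}" for j
      proof -
        have le: "cmod (u i - b0 i) \<le> r" if "i \<in> {1..n}" for i
          using Kb[OF u that] that by (simp add: b0_def dist_norm norm_minus_commute)
        have "(\<Sum>i\<in>{1..n}. cmod (u i - b0 i)) \<le> (\<Sum>i\<in>{1..n}. r)" using le by (intro sum_mono)
        also have "\<dots> \<le> N * r" using r0 by (simp add: N_def)
        finally have "1/(4*N) * (\<Sum>i\<in>{1..n}. cmod (u i - b0 i)) \<le> 1/(4*N) * (N * r)"
          using N1 by (intro mult_left_mono) auto
        also have "\<dots> = r/4" using N1 by simp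
        finally have "cmod (T u j - T b0 j) \<le> 1/4 * r + r/4"
          using main[OF u b0K j] le[OF j] by linarith
        moreover have "cmod (T u j - b j) \<le> cmod (T u j - T b0 j) + cmod (T b0 j - b j)"
          by (metis diff_add_cancel add_diff_eq norm_triangle_ineq)
        ultimately have "cmod (T u j - b j) \<le> r" using Tb0[OF j] by linarith
        thus ?thesis by (simp add: dist_norm norm_minus_commute)
      qed
      thus ?thesis by (auto simp: K_def B_def T_def Suc_le_eq)
    qed
    define f where "f = (\<lambda>u. \<Sum>j\<in>{1..n}. cmod (T u j - u j))"
    have contL: "continuous_on UNIV (L j)" if "j \<in> {1..n}" for j
      by (intro continuous_at_imp_continuous_on ballI DERIV_isCont[OF der[OF that]])
    have contc: "continuous_on K (\<lambda>u. u i)" for i :: nat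
      using continuous_on_subset[OF continuous_on_product_coordinates[where i = i] subset_UNIV] .
    have contLu: "continuous_on K (\<lambda>u. L j (u i))" if "j \<in> {1..n}" for i j
      using continuous_on_compose[of K "\<lambda>u. u i" "L j"] contc[of i]
        continuous_on_subset[OF contL[OF that], of "(\<lambda>u. u i) ` K"] by (simp add: o_def)
    have "continuous_on K (\<lambda>u. T u j)" if j: "j \<in> {1..n}" for j
    proof -
      have "continuous_on K (\<lambda>u. (\<Sum>i\<le>n. y' i * L j (u i)) * (1 / y j))"
        by (intro continuous_on_mult_right continuous_on_sum continuous_on_mult_left contLu[OF j])
      from continuous_on_diff[OF contc[of j] this] show ?thesis using j by (simp add: T_def)
    qed
    note contT = this
    have "continuous_on K f"
      unfolding f_def by (rule continuous_on_sum, rule continuous_on_norm, rule continuous_on_diff, erule contT, rule contc)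
    then obtain u where u: "u \<in> K" "\<And>v. v \<in> K \<Longrightarrow> f u \<le> f v"
      using continuous_attains_inf[OF cK, of f] b0K by blast
    \<comment> \<open>\<open>f (T u)\<close> is at most half of \<open>f u\<close>, so the minimum
      of \<open>f\<close> on \<open>K\<close> must be 0.\<close>
    have "f (T u) \<le> (\<Sum>j\<in>{1..n}. 1/4 * cmod (T u j - u j) + 1/(4*N) * f u)"
      unfolding f_def using main[OF TK[OF u(1)] u(1)] by (intro sum_mono)
    also have "\<dots> = 1/4 * f u + real n / (4*N) * f u"
      by (simp add: sum.distrib f_def sum_distrib_left)
    also have "\<dots> \<le> 1/4 * f u + 1/4 * f u"
      using N1 by (intro add_mono mult_right_mono) (auto simp: N_def f_def field_simps intro!: sum_nonneg)
    finally have "f u \<le> 1/2 * f u" using u(2)[OF TK[OF u(1)]] by linarith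
    moreover have "f u \<ge> 0" by (auto simp: f_def intro!: sum_nonneg)
    ultimately have "f u = 0" by linarith
    hence fp: "T u j = u j" if "j \<in> {1..n}" for j
      using that by (auto simp: f_def sum_nonneg_eq_0_iff)
    show "\<exists>u. u 0 = b 0 \<and> (\<forall>j\<in>{1..n}. (\<Sum>i\<le>n. y' i * L j (u i)) = 0)"
    proof (intro exI[of _ u] conjI ballI)
      fix j assume j: "j \<in> {1..n}"
      from fp[OF j] j have "(\<Sum>i\<le>n. y' i * L j (u i)) / y j = 0" by (simp add: T_def)
      thus "(\<Sum>i\<le>n. y' i * L j (u i)) = 0" using nz[of j] j by simp
    qed (rule K0[OF u(1)])
  qed
qed

text \<open>After division of row \<open>i\<close> by \<open>y i\<close>, the Jacobian in
  \<open>b 1, ..., b n\<close> is the matrix \<open>M\<close> below, a Vandermonde matrix at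
  distinct points with column \<open>k\<close> multiplied by \<open>k + 1\<close>. The conclusion
  keeps \<open>u 0 = b 0\<close> so that the perturbed solution cannot be zero.\<close>

lemma weighted_power_sums_stable:
  fixes y b :: "nat \<Rightarrow> complex"
  assumes inj: "inj_on b {..n}" and b0: "\<And>j. j \<le> n \<Longrightarrow> b j \<noteq> 0"
    and eq: "\<And>k. k \<in> {1..n} \<Longrightarrow> (\<Sum>j\<le>n. y j * b j ^ k) = 0"
    and nz: "\<And>j. j \<le> n \<Longrightarrow> y j \<noteq> 0"
  shows "\<exists>e>0. \<forall>y'. (\<forall>i\<le>n. cmod (y' i - y i) < e) \<longrightarrow>
           (\<exists>u. u 0 = b 0 \<and> (\<forall>k\<in>{1..n}. (\<Sum>j\<le>n. y' j * u j ^ k) = 0))"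
proof -
  define M where "M = mat n n (\<lambda>(i,k). of_nat (Suc k) * b (Suc i) ^ k)"
  have M: "M \<in> carrier_mat n n" by (simp add: M_def)
  have "v = 0\<^sub>v n" if v: "v \<in> carrier_vec n" "M *\<^sub>v v = 0\<^sub>v n" for v
  proof -
    \<comment> \<open>These are the coefficients of a polynomial of degree below \<open>n\<close>
      that vanishes at \<open>b 1, ..., b n\<close>.\<close>
    have "of_nat (Suc k) * v $ k = 0" if "k < n" for k
    proof (rule poly_coeffs_zero[where b = "\<lambda>i. b (Suc i)" and n = n])
      show "inj_on (\<lambda>i. b (Suc i)) {..<n}"
      proof (rule inj_onI)
        fix i j assume "i \<in> {..<n}" "j \<in> {..<n}" "b (Suc i) = b (Suc j)"
        thus "i = j" using inj_onD[OF inj, of "Suc i" "Suc j"] by simp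
      qed
      fix i assume i: "i < n"
      have "(M *\<^sub>v v) $ i = 0" using v i by simp
      thus "(\<Sum>k<n. of_nat (Suc k) * v $ k * b (Suc i) ^ k) = 0"
        using i v(1) by (simp add: M_def scalar_prod_def lessThan_atLeast0 mult_ac del: of_nat_Suc)
    qed fact
    thus ?thesis using v(1) by (intro eq_vecI) (auto simp del: of_nat_Suc)
  qed
  then obtain B where B: "B \<in> carrier_mat n n" "M * B = 1\<^sub>m n" "B * M = 1\<^sub>m n"
    using trivial_kernel_imp_inverse[OF M] by blast
  have MB: "(\<Sum>k<n. of_nat (Suc k) * b (Suc i) ^ k * B $$ (k,j)) = (if i = j then 1 else 0)"
    if "i < n" "j < n" for i j
  proof -
    have "(M * B) $$ (i,j) = (\<Sum>k<n. of_nat (Suc k) * b (Suc i) ^ k * B $$ (k,j))"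
      using that B(1) by (simp add: M_def scalar_prod_def lessThan_atLeast0 del: of_nat_Suc)
    thus ?thesis using that B(2) by simp
  qed
  have BM: "(\<Sum>j<n. B $$ (k,j) * M $$ (j,l)) = (if k = l then 1 else 0)"
    if "k < n" "l < n" for k l
  proof -
    have "(B * M) $$ (k,l) = (\<Sum>j<n. B $$ (k,j) * M $$ (j,l))"
      using that B(1) M by (simp add: scalar_prod_def lessThan_atLeast0)
    thus ?thesis using that B(3) by simp
  qed
  \<comment> \<open>Combinations of x, ..., x^n by the columns of the inverse of \<open>M\<close>,
    so that the derivative of \<open>L j\<close> at \<open>b i\<close> is 1 for \<open>i = j\<close>
    and 0 otherwise. The shift \<open>j - 1\<close> matches matrix indices starting at 0.\<close>
  define L where "L = (\<lambda>j x. \<Sum>k<n. B $$ (k, j - 1) * x ^ Suc k)"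
  define L' where "L' = (\<lambda>j x. \<Sum>k<n. of_nat (Suc k) * x ^ k * B $$ (k, j - 1))"
  have Lsum: "(\<Sum>i\<le>n. z i * L j (u i)) = (\<Sum>k<n. B $$ (k, j - 1) * (\<Sum>i\<le>n. z i * u i ^ Suc k))"
    for z u :: "nat \<Rightarrow> complex" and j
    unfolding L_def sum_distrib_left by (subst sum.swap) (simp add: mult_ac)
  have "\<exists>e>0. \<forall>y'. (\<forall>i\<le>n. cmod (y' i - y i) < e) \<longrightarrow>
           (\<exists>u. u 0 = b 0 \<and> (\<forall>j\<in>{1..n}. (\<Sum>i\<le>n. y' i * L j (u i)) = 0))"
  proof (rule newton_perturbation[where L' = L'])
    show "(L j has_field_derivative L' j x) (at x)" for j x
      unfolding L_def L'_def
      by (auto intro!: derivative_eq_intros sum.cong simp del: power_Suc of_nat_Suc)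
    show "isCont (L' j) x" for j x
      unfolding L'_def by (intro continuous_intros)
    show "L' j (b i) = (if i = j then 1 else 0)" if ij: "i \<in> {1..n}" "j \<in> {1..n}" for i j
    proof -
      obtain i' where "i = Suc i'" "i' < n" using ij(1) by (cases i) auto
      moreover obtain j' where "j = Suc j'" "j' < n" using ij(2) by (cases j) auto
      ultimately show ?thesis using MB[of i' j'] by (simp add: L'_def del: of_nat_Suc)
    qed
    show "(\<Sum>i\<le>n. y i * L j (b i)) = 0" for j
    proof -
      have "(\<Sum>i\<le>n. y i * b i ^ Suc k) = 0" if "k < n" for k using that eq[of "Suc k"] by simp
      thus ?thesis unfolding Lsum by simp
    qed
  qed (use nz in auto)
  then obtain e where e: "e > 0" and ex: "\<And>y'. (\<forall>i\<le>n. cmod (y' i - y i) < e) \<Longrightarrow>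
           (\<exists>u. u 0 = b 0 \<and> (\<forall>j\<in>{1..n}. (\<Sum>i\<le>n. y' i * L j (u i)) = 0))" by blast
  show ?thesis
  proof (intro exI[of _ e] conjI allI impI)
    fix y' assume "\<forall>i\<le>n. cmod (y' i - y i) < e"
    from ex[OF this] obtain u where u: "u 0 = b 0"
      "\<And>j. j \<in> {1..n} \<Longrightarrow> (\<Sum>i\<le>n. y' i * L j (u i)) = 0" by blast
    have "(\<Sum>j\<le>n. y' j * u j ^ k) = 0" if k: "k \<in> {1..n}" for k
    proof -
      obtain l where l: "k = Suc l" "l < n" using k by (cases k) auto
      define P where "P = (\<lambda>k. \<Sum>i\<le>n. y' i * u i ^ Suc k)"
      have P0: "(\<Sum>k<n. B $$ (k, j) * P k) = 0" if "j < n" for j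
        using u(2)[of "Suc j"] that unfolding Lsum P_def by simp
      \<comment> \<open>Insert \<open>B * M = 1\<close> to pass from the combinations back to the
        single power sums.\<close>
      have "P l = (\<Sum>k<n. if k = l then P k else 0)" using l by simp
      also have "\<dots> = (\<Sum>k<n. P k * (\<Sum>j<n. B $$ (k,j) * M $$ (j,l)))"
        using BM l by (intro sum.cong) auto
      also have "\<dots> = (\<Sum>j<n. M $$ (j,l) * (\<Sum>k<n. B $$ (k, j) * P k))"
        unfolding sum_distrib_left by (subst sum.swap) (simp add: mult_ac)
      also have "\<dots> = 0" using P0 by simp
      finally show ?thesis by (simp add: P_def l)
    qed
    thus "\<exists>u. u 0 = b 0 \<and> (\<forall>k\<in>{1..n}. (\<Sum>j\<le>n. y' j * u j ^ k) = 0)" using u(1) by blast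
  qed fact
qed

lemma exists_weighted_power_sum_zeros:
  fixes x :: "nat \<Rightarrow> complex"
  assumes sub: "\<And>I. I \<subseteq> {..n} \<Longrightarrow> I \<noteq> {} \<Longrightarrow> (\<Sum>j\<in>I. x j) \<noteq> 0"
  obtains b where "inj_on b {..n}" "\<And>j. j \<le> n \<Longrightarrow> b j \<noteq> 0"
    "\<And>k. k \<in> {1..n} \<Longrightarrow> (\<Sum>j\<le>n. x j * b j ^ k) = 0"
proof -
  \<comment> \<open>The complex line from \<open>(1, ..., 1)\<close> at \<open>\<tau> = 0\<close> to
    \<open>x\<close> at \<open>\<tau> = 1\<close>.\<close>
  define Y where "Y = (\<lambda>\<tau> j. 1 + \<tau> * (x j - 1))"
  have sumY: "(\<Sum>j\<in>I. Y \<tau> j) = of_nat (card I) + \<tau> * (\<Sum>j\<in>I. x j - 1)" for \<tau> and I :: "nat set"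
    by (simp add: Y_def sum.distrib sum_distrib_left)
  define T where "T = {\<tau>. \<forall>I. I \<subseteq> {..n} \<longrightarrow> I \<noteq> {} \<longrightarrow> (\<Sum>j\<in>I. Y \<tau> j) \<noteq> 0}"
  have conT: "connected T"
  proof -
    \<comment> \<open>Each partial sum is affine in \<open>\<tau>\<close> and equals
      \<open>card I\<close>, which is nonzero, at 0; so it vanishes for at most one
      \<open>\<tau>\<close>.\<close>
    have "- T \<subseteq> (\<lambda>I. - of_nat (card I) / (\<Sum>j\<in>I. x j - 1)) ` Pow {..n}"
    proof
      fix \<tau> assume "\<tau> \<in> - T"
      then obtain I where I: "I \<subseteq> {..n}" "I \<noteq> {}" "of_nat (card I) + \<tau> * (\<Sum>j\<in>I. x j - 1) = 0"
        by (auto simp: T_def sumY)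
      have "card I \<noteq> 0" using I finite_subset[of I "{..n}"] by auto
      hence "(\<Sum>j\<in>I. x j - 1) \<noteq> 0" using I(3) by auto
      hence "\<tau> = - of_nat (card I) / (\<Sum>j\<in>I. x j - 1)"
        using I(3) by (metis add.commute eq_neg_iff_add_eq_0 nonzero_eq_divide_eq)
      thus "\<tau> \<in> (\<lambda>I. - of_nat (card I) / (\<Sum>j\<in>I. x j - 1)) ` Pow {..n}" using I(1) by blast
    qed
    hence "finite (- T)" by (rule finite_subset) auto
    hence "path_connected (- (- T))"
      by (intro path_connected_complement_countable countable_finite) auto
    thus ?thesis using path_connected_imp_connected by simp
  qed
  define B where "B = (\<lambda>i. if i \<le> n then cball 0 1 else {0::complex})"
  \<comment> \<open>The unit sphere of the maximum norm, on which a sequence of solutions cannot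
    collapse to the zero solution.\<close>
  define K where "K = Pi\<^sub>E UNIV B \<inter> {b. \<exists>j\<le>n. cmod (b j) = 1}"
  have "closed {b. \<exists>j\<le>n. cmod (b j) = 1}"
  proof -
    have "{b. \<exists>j\<le>n. cmod (b j) = 1} = (\<Union>j\<in>{..n}. {b. cmod (b j) = 1})" by auto
    moreover have "closed {b. cmod (b j) = 1}" for j :: nat
      by (intro closed_Collect_eq continuous_intros continuous_on_product_coordinates)
    ultimately show ?thesis by auto
  qed
  hence cK: "compact K" unfolding K_def
    by (intro compact_Int_closed compact_PiE_UNIV) (auto simp: B_def)
  define W where "W = {\<tau>. \<exists>b\<in>K. \<forall>k\<in>{1..n}. (\<Sum>j\<le>n. Y \<tau> j * b j ^ k) = 0}"
  have "closed W"
    unfolding closed_sequential_limits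
  proof (intro allI impI, elim conjE)
    fix t \<tau> assume t: "\<forall>m. t m \<in> W" "t \<longlonglongrightarrow> \<tau>"
    have "\<forall>m. \<exists>b. b \<in> K \<and> (\<forall>k\<in>{1..n}. (\<Sum>j\<le>n. Y (t m) j * b j ^ k) = 0)"
      using t(1) unfolding W_def by blast
    from choice[OF this] obtain b where b: "\<And>m. b m \<in> K"
      "\<And>m k. k \<in> {1..n} \<Longrightarrow> (\<Sum>j\<le>n. Y (t m) j * b m j ^ k) = 0"
      by blast
    obtain l r where l: "l \<in> K" "strict_mono (r :: nat \<Rightarrow> nat)" "(b \<circ> r) \<longlonglongrightarrow> l"
      using seq_compactE[OF compact_imp_seq_compact[OF cK], of b] b(1) by blast
    have tr: "(\<lambda>m. t (r m)) \<longlonglongrightarrow> \<tau>" using LIMSEQ_subseq_LIMSEQ[OF t(2) l(2)] by (simp add: o_def)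
    have lj: "(\<lambda>m. b (r m) j) \<longlonglongrightarrow> l j" for j
    proof -
      have "isCont (\<lambda>b :: nat \<Rightarrow> complex. b j) l"
        using continuous_on_product_coordinates[where 'b = complex and i = j]
        by (simp only: continuous_on_eq_continuous_at[OF open_UNIV] UNIV_I Ball_def simp_thms)
      from isCont_tendsto_compose[OF this l(3)] show ?thesis by (simp add: o_def)
    qed
    have "(\<Sum>j\<le>n. Y \<tau> j * l j ^ k) = 0" if "k \<in> {1..n}" for k
    proof (rule LIMSEQ_unique)
      show "(\<lambda>m. \<Sum>j\<le>n. Y (t (r m)) j * b (r m) j ^ k) \<longlonglongrightarrow> (\<Sum>j\<le>n. Y \<tau> j * l j ^ k)"
        unfolding Y_def by (intro tendsto_sum tendsto_mult tendsto_add tendsto_const tendsto_power tr lj)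
      show "(\<lambda>m. \<Sum>j\<le>n. Y (t (r m)) j * b (r m) j ^ k) \<longlonglongrightarrow> 0" using b(2)[OF that] by simp
    qed
    thus "\<tau> \<in> W" unfolding W_def using l(1) by blast
  qed
  \<comment> \<open>The \<open>k\<close>-th equation is homogeneous of degree \<open>k\<close>, so
    any nonzero solution can be scaled to maximum modulus 1.\<close>
  have WK: "\<tau> \<in> W" if u: "\<forall>k\<in>{1..n}. (\<Sum>j\<le>n. Y \<tau> j * u j ^ k) = 0" "i \<le> n" "u i \<noteq> 0" for \<tau> u i
  proof -
    define m where "m = Max ((\<lambda>j. cmod (u j)) ` {..n})"
    have mle: "cmod (u j) \<le> m" if "j \<le> n" for j unfolding m_def using that by (intro Max_ge) auto
    have m0: "m > 0" using mle[OF u(2)] u(3) by (smt (verit) zero_less_norm_iff)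
    have "m \<in> (\<lambda>j. cmod (u j)) ` {..n}" unfolding m_def by (intro Max_in) auto
    then obtain j0 where j0: "j0 \<le> n" "cmod (u j0) = m" by auto
    define b where "b = (\<lambda>j. if j \<le> n then u j / of_real m else 0)"
    have "b \<in> K" using m0 mle j0 by (auto simp: K_def B_def b_def norm_divide intro!: exI[of _ j0])
    moreover have "(\<Sum>j\<le>n. Y \<tau> j * b j ^ k) = 0" if "k \<in> {1..n}" for k
    proof -
      have "(\<Sum>j\<le>n. Y \<tau> j * b j ^ k) = (\<Sum>j\<le>n. Y \<tau> j * u j ^ k) / of_real m ^ k"
        by (simp add: b_def sum_divide_distrib power_divide)
      thus ?thesis using u(1) that by simp
    qed
    ultimately show ?thesis unfolding W_def by blast
  qed
  have solW: "\<exists>b. inj_on b {..n} \<and> (\<forall>j\<le>n. b j \<noteq> 0) \<and> (\<forall>k\<in>{1..n}. (\<Sum>j\<le>n. Y \<tau> j * b j ^ k) = 0)"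
    if \<tau>: "\<tau> \<in> T" "\<tau> \<in> W" for \<tau>
  proof -
    from \<tau>(2) obtain b where b: "b \<in> K" "\<And>k. k\<in>{1..n} \<Longrightarrow> (\<Sum>j\<le>n. Y \<tau> j * b j ^ k) = 0"
      unfolding W_def by blast
    have "\<exists>j\<le>n. b j \<noteq> 0" using b(1) by (force simp: K_def)
    from weighted_power_sums_distinct[where y = "Y \<tau>", OF _ b(2) this] \<tau>(1) b(2)
    show ?thesis unfolding T_def by blast
  qed
  \<comment> \<open>Stability yields, for nearby parameters, a solution with the same nonzero
    coordinate 0; scaling it puts these parameters into \<open>W\<close>.\<close>
  have "openin (top_of_set T) (T \<inter> W)"
  proof -
    have "\<exists>d>0. \<forall>\<tau>'. dist \<tau>' \<tau> < d \<longrightarrow> \<tau>' \<in> W" if \<tau>: "\<tau> \<in> T" "\<tau> \<in> W" for \<tau>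
    proof -
      from solW[OF \<tau>] obtain b where b: "inj_on b {..n}" "\<And>j. j \<le> n \<Longrightarrow> b j \<noteq> 0"
        "\<And>k. k\<in>{1..n} \<Longrightarrow> (\<Sum>j\<le>n. Y \<tau> j * b j ^ k) = 0" by blast
      have "Y \<tau> j \<noteq> 0" if "j \<le> n" for j
        using \<tau>(1) that unfolding T_def by (auto dest!: spec[of _ "{j}"])
      from weighted_power_sums_stable[where y = "Y \<tau>", OF b this] obtain e where e: "e > 0"
        and ex: "\<And>y'. (\<forall>i\<le>n. cmod (y' i - Y \<tau> i) < e) \<Longrightarrow>
           (\<exists>u. u 0 = b 0 \<and> (\<forall>k\<in>{1..n}. (\<Sum>j\<le>n. y' j * u j ^ k) = 0))" by blast
      \<comment> \<open>A bound for the speed of \<open>Y \<tau> i\<close> in \<open>\<tau>\<close>,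
        for all \<open>i\<close> at once; the 1 makes it positive.\<close>
      define c where "c = 1 + (\<Sum>j\<le>n. cmod (x j - 1))"
      have c0: "c > 0" unfolding c_def by (smt (verit) norm_ge_zero sum_nonneg)
      show ?thesis
      proof (intro exI[of _ "e / c"] conjI allI impI)
        show "e / c > 0" using e c0 by simp
        fix \<tau>' assume d: "dist \<tau>' \<tau> < e / c"
        have "cmod (Y \<tau>' i - Y \<tau> i) < e" if "i \<le> n" for i
        proof -
          have "cmod (x i - 1) \<le> (\<Sum>j\<le>n. cmod (x j - 1))" using that by (intro member_le_sum) auto
          hence ci: "cmod (x i - 1) \<le> c" by (simp add: c_def)
          have "cmod (Y \<tau>' i - Y \<tau> i) = cmod (\<tau>' - \<tau>) * cmod (x i - 1)"
            by (simp add: Y_def norm_mult[symmetric] algebra_simps)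
          also have "\<dots> \<le> cmod (\<tau>' - \<tau>) * c" using ci by (intro mult_left_mono) auto
          also have "\<dots> < e" using d c0 by (simp add: dist_norm pos_less_divide_eq)
          finally show ?thesis .
        qed
        then obtain u where "u 0 = b 0" "\<forall>k\<in>{1..n}. (\<Sum>j\<le>n. Y \<tau>' j * u j ^ k) = 0"
          using ex[of "Y \<tau>'"] by blast
        thus "\<tau>' \<in> W" using WK[of \<tau>' u 0] b(2)[of 0] by simp
      qed
    qed
    thus ?thesis unfolding openin_euclidean_subtopology_iff by (auto simp: Int_iff) blast
  qed
  moreover have "closedin (top_of_set T) (T \<inter> W)"
    using \<open>closed W\<close> by (rule closedin_closed_Int)
  ultimately have "T \<inter> W = {} \<or> T \<inter> W = T"
    using conT unfolding connected_clopen by blast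
  moreover have "0 \<in> T"
  proof -
    have "card I \<noteq> 0" if "I \<subseteq> {..n}" "I \<noteq> {}" for I
      using that finite_subset[of I "{..n}"] by auto
    thus ?thesis by (simp add: T_def sumY)
  qed
  moreover have "0 \<in> W"
  proof (rule WK[where i = 0])
    \<comment> \<open>The \<open>(n + 1)\<close>-th roots of unity. For
      \<open>1 \<le> k \<le> n\<close> their \<open>k\<close>-th powers form a geometric progression
      with ratio different from 1 and sum 0.\<close>
    define u where "u = (\<lambda>j. exp (2 * of_real pi * \<i> * of_nat j / of_nat (n + 1)))"
    show "u 0 \<noteq> 0" by (simp add: u_def)
    show "\<forall>k\<in>{1..n}. (\<Sum>j\<le>n. Y 0 j * u j ^ k) = 0"
    proof
      fix k assume k: "k \<in> {1..n}"
      have upow: "u j ^ k = u k ^ j" for j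
        by (simp add: u_def exp_of_nat_mult[symmetric] algebra_simps)
      have "\<not> (n + 1) dvd k" using k by (auto dest: dvd_imp_le)
      hence "u k \<noteq> 1" unfolding u_def using complex_root_unity_eq_1[of "n+1" k] by (simp add: mult_ac)
      moreover have "u k ^ (n + 1) = 1"
        unfolding u_def using complex_root_unity[of "n+1" k] by (simp add: mult_ac)
      ultimately show "(\<Sum>j\<le>n. Y 0 j * u j ^ k) = 0"
        by (simp add: Y_def upow sum_gp0)
    qed
  qed simp
  moreover have "1 \<in> T" using sub by (simp add: T_def Y_def)
  ultimately have "1 \<in> T" "1 \<in> W" by blast+
  from solW[OF this] show ?thesis using that by (auto simp: Y_def)
qed

section \<open>Homogeneous forms on projective space\<close>

lemma proj_pt_self: "v \<in> proj_pt v"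
  unfolding proj_pt_def by (rule CollectI, rule exI[of _ 1]) simp

lemma proj_pt_smult: "c \<noteq> 0 \<Longrightarrow> proj_pt (c \<cdot>\<^sub>v v) = proj_pt v"
  unfolding proj_pt_def
proof (intro equalityI subsetI)
  fix w assume c: "c \<noteq> 0" and "w \<in> {k \<cdot>\<^sub>v (c \<cdot>\<^sub>v v) |k. k \<noteq> 0}"
  then obtain k where "k \<noteq> 0" "w = (k * c) \<cdot>\<^sub>v v" by (auto simp: smult_smult_assoc)
  thus "w \<in> {k \<cdot>\<^sub>v v |k. k \<noteq> 0}" using c by auto
next
  fix w assume c: "c \<noteq> 0" and "w \<in> {k \<cdot>\<^sub>v v |k. k \<noteq> 0}"
  then obtain k where "k \<noteq> 0" "w = k \<cdot>\<^sub>v v" by auto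
  hence "w = (k / c) \<cdot>\<^sub>v (c \<cdot>\<^sub>v v)" "k / c \<noteq> 0" using c by (auto simp: smult_smult_assoc)
  thus "w \<in> {k \<cdot>\<^sub>v (c \<cdot>\<^sub>v v) |k. k \<noteq> 0}" by blast
qed

lemma proj_pt_eqD: "proj_pt v = proj_pt w \<Longrightarrow> \<exists>c. c \<noteq> 0 \<and> v = c \<cdot>\<^sub>v w"
  using proj_pt_self[of v] by (auto simp: proj_pt_def)

lemma proj_pt_in_proj_space:
  "v \<in> carrier_vec (n + 1) \<Longrightarrow> v \<noteq> 0\<^sub>v (n + 1) \<Longrightarrow> proj_pt v \<in> proj_space n"
  by (auto simp: proj_space_def)

lemma proj_spaceE:
  assumes "x \<in> proj_space n"
  obtains v where "v \<in> carrier_vec (n + 1)" "v \<noteq> 0\<^sub>v (n + 1)" "x = proj_pt v"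
  using assms by (auto simp: proj_space_def)

lemma smult_vec_nonzero:
  fixes v :: "complex vec"
  assumes "c \<noteq> 0" "v \<in> carrier_vec n" "v \<noteq> 0\<^sub>v n"
  shows "c \<cdot>\<^sub>v v \<noteq> 0\<^sub>v n"
proof
  assume "c \<cdot>\<^sub>v v = 0\<^sub>v n"
  hence "(1 / c) \<cdot>\<^sub>v (c \<cdot>\<^sub>v v) = (1 / c) \<cdot>\<^sub>v 0\<^sub>v n" by simp
  moreover have "(1 / c) \<cdot>\<^sub>v 0\<^sub>v n = 0\<^sub>v n" by (intro eq_vecI) auto
  ultimately show False using assms by (simp add: smult_smult_assoc)
qed

lemma linear_form_smult:
  "h \<in> carrier_vec n \<Longrightarrow> v \<in> carrier_vec n \<Longrightarrow> linear_form h (c \<cdot>\<^sub>v v) = c * linear_form h v"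
  by (simp add: linear_form_def)

lemma linear_form_sum:
  "h \<in> carrier_vec (n + 1) \<Longrightarrow> v \<in> carrier_vec (n + 1) \<Longrightarrow> linear_form h v = (\<Sum>i\<le>n. h $ i * v $ i)"
  by (auto simp: linear_form_def scalar_prod_def lessThan_Suc_atMost[symmetric] lessThan_atLeast0 intro!: sum.cong)

lemma proj_pt_mem_hyperplane_iff:
  assumes h: "h \<in> carrier_vec (n + 1)" and v: "v \<in> carrier_vec (n + 1)" "v \<noteq> 0\<^sub>v (n + 1)"
  shows "proj_pt v \<in> hyperplane n h \<longleftrightarrow> linear_form h v = 0"
proof
  assume "proj_pt v \<in> hyperplane n h"
  thus "linear_form h v = 0" using proj_pt_self by (auto simp: hyperplane_def hypersurface_def)
next
  assume "linear_form h v = 0"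
  hence "linear_form h w = 0" if "w \<in> proj_pt v" for w
    using that linear_form_smult[OF h v(1)] by (auto simp: proj_pt_def)
  thus "proj_pt v \<in> hyperplane n h"
    using proj_pt_in_proj_space[OF v] by (auto simp: hyperplane_def hypersurface_def)
qed

lemma finite_exponents: "finite (exponents n d)"
proof (rule finite_subset)
  show "exponents n d \<subseteq> {\<alpha>. \<forall>i. (i \<in> {..n} \<longrightarrow> \<alpha> i \<in> {..d}) \<and> (i \<notin> {..n} \<longrightarrow> \<alpha> i = 0)}"
  proof
    fix \<alpha> assume a: "\<alpha> \<in> exponents n d"
    have "\<alpha> i \<le> d" if "i \<le> n" for i
    proof -
      have "\<alpha> i \<le> (\<Sum>i\<le>n. \<alpha> i)" using that by (intro member_le_sum) auto
      thus ?thesis using a by (simp add: exponents_def)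
    qed
    thus "\<alpha> \<in> {\<alpha>. \<forall>i. (i \<in> {..n} \<longrightarrow> \<alpha> i \<in> {..d}) \<and> (i \<notin> {..n} \<longrightarrow> \<alpha> i = 0)}"
      using a by (auto simp: exponents_def)
  qed
qed (rule finite_set_of_finite_funs, auto)

lemma hom_form_cong:
  "(\<And>v. v \<in> carrier_vec (n + 1) \<Longrightarrow> F v = G v) \<Longrightarrow> hom_form n d F \<longleftrightarrow> hom_form n d G"
  unfolding hom_form_def by simp

lemma hom_form_mult:
  assumes "hom_form n d F" "hom_form n e G"
  shows "hom_form n (d + e) (\<lambda>v. F v * G v)"
proof -
  obtain c where c: "\<And>v. v \<in> carrier_vec (n + 1) \<Longrightarrow>
      F v = (\<Sum>\<alpha>\<in>exponents n d. c \<alpha> * (\<Prod>i\<le>n. (v $ i) ^ \<alpha> i))"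
    using assms(1) unfolding hom_form_def by blast
  obtain b where b: "\<And>v. v \<in> carrier_vec (n + 1) \<Longrightarrow>
      G v = (\<Sum>\<alpha>\<in>exponents n e. b \<alpha> * (\<Prod>i\<le>n. (v $ i) ^ \<alpha> i))"
    using assms(2) unfolding hom_form_def by blast
  define E where "E = exponents n d \<times> exponents n e"
  define p where "p = (\<lambda>(\<alpha>::nat\<Rightarrow>nat, \<beta>::nat\<Rightarrow>nat) i. \<alpha> i + \<beta> i)"
  \<comment> \<open>The coefficient of a monomial in the product collects all pairs of exponents
    adding up to it.\<close>
  define a where "a = (\<lambda>\<gamma>. \<Sum>x\<in>{x \<in> E. p x = \<gamma>}. c (fst x) * b (snd x))"
  show ?thesis unfolding hom_form_def
  proof (intro exI[of _ a] ballI)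
    fix v :: "complex vec" assume v: "v \<in> carrier_vec (n + 1)"
    let ?m = "\<lambda>\<alpha>. \<Prod>i\<le>n. (v $ i) ^ \<alpha> i"
    have "F v * G v = (\<Sum>x\<in>E. c (fst x) * b (snd x) * ?m (p x))"
      unfolding c[OF v] b[OF v] sum_product E_def sum.cartesian_product
      by (intro sum.cong) (auto simp: p_def power_add prod.distrib mult_ac)
    also have "\<dots> = (\<Sum>\<gamma>\<in>exponents n (d + e). \<Sum>x\<in>{x \<in> E. p x = \<gamma>}. c (fst x) * b (snd x) * ?m (p x))"
    proof (rule sum.group[symmetric])
      show "finite E" "finite (exponents n (d + e))"
        by (simp_all add: E_def finite_exponents)
      show "p ` E \<subseteq> exponents n (d + e)"
        by (auto simp: E_def p_def exponents_def sum.distrib)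
    qed
    also have "\<dots> = (\<Sum>\<gamma>\<in>exponents n (d + e). a \<gamma> * ?m \<gamma>)"
      unfolding a_def sum_distrib_right by (intro sum.cong refl) auto
    finally show "F v * G v = (\<Sum>\<gamma>\<in>exponents n (d + e). a \<gamma> * ?m \<gamma>)" .
  qed
qed

lemma hom_form_add:
  assumes "hom_form n d F" "hom_form n d G"
  shows "hom_form n d (\<lambda>v. F v + G v)"
proof -
  obtain c where c: "\<And>v. v \<in> carrier_vec (n + 1) \<Longrightarrow>
      F v = (\<Sum>\<alpha>\<in>exponents n d. c \<alpha> * (\<Prod>i\<le>n. (v $ i) ^ \<alpha> i))"
    using assms(1) unfolding hom_form_def by blast
  obtain b where b: "\<And>v. v \<in> carrier_vec (n + 1) \<Longrightarrow>
      G v = (\<Sum>\<alpha>\<in>exponents n d. b \<alpha> * (\<Prod>i\<le>n. (v $ i) ^ \<alpha> i))"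
    using assms(2) unfolding hom_form_def by blast
  show ?thesis unfolding hom_form_def
    by (intro exI[of _ "\<lambda>\<alpha>. c \<alpha> + b \<alpha>"] ballI) (simp only: c b distrib_right sum.distrib)
qed

lemma hom_form_zero: "hom_form n d (\<lambda>v. 0)"
  unfolding hom_form_def by (intro exI[of _ "\<lambda>_. 0"]) simp

lemma hom_form_const: "hom_form n 0 (\<lambda>v. k)"
proof -
  have "exponents n 0 = {\<lambda>_. 0 :: nat}"
  proof (intro equalityI subsetI)
    fix \<alpha> assume "\<alpha> \<in> exponents n 0"
    hence "\<alpha> i = 0" for i by (cases "i \<le> n") (auto simp: exponents_def)
    thus "\<alpha> \<in> {\<lambda>_. 0}" by auto
  qed (auto simp: exponents_def)
  thus ?thesis unfolding hom_form_def by (intro exI[of _ "\<lambda>_. k"]) simp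
qed

lemma hom_form_coord:
  assumes "i \<le> n"
  shows "hom_form n 1 (\<lambda>v. v $ i)"
  unfolding hom_form_def
proof (intro exI ballI)
  fix v :: "complex vec"
  let ?e = "\<lambda>j. if j = i then 1 else (0::nat)"
  let ?m = "\<lambda>\<alpha>. \<Prod>j\<le>n. (v $ j) ^ \<alpha> j"
  have "?e \<in> exponents n 1" using assms by (auto simp: exponents_def)
  moreover have "?m ?e = (\<Prod>j\<le>n. if j = i then v $ j else 1)" by (intro prod.cong) auto
  hence "?m ?e = v $ i" using assms by simp
  ultimately show "v $ i = (\<Sum>\<alpha>\<in>exponents n 1. (if \<alpha> = ?e then 1 else 0) * ?m \<alpha>)"
    by (simp add: if_distrib[of "\<lambda>x. x * _"] finite_exponents cong: if_cong)
qed

lemma hom_form_cmult: "hom_form n d F \<Longrightarrow> hom_form n d (\<lambda>v. k * F v)"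
  using hom_form_mult[OF hom_form_const[of n k], of d F] by simp

lemma hom_form_sum:
  assumes "\<And>i. i \<in> I \<Longrightarrow> hom_form n d (F i)"
  shows "hom_form n d (\<lambda>v. \<Sum>i\<in>I. F i v)"
  using assms
proof (induction I rule: infinite_finite_induct)
  case (insert i I)
  have "hom_form n d (\<lambda>v. F i v + (\<Sum>i\<in>I. F i v))"
    using insert by (intro hom_form_add) auto
  thus ?case using insert.hyps by simp
qed (simp_all add: hom_form_zero)

lemma hom_form_prod:
  assumes "finite I" "\<And>i. i \<in> I \<Longrightarrow> hom_form n (d i) (F i)"
  shows "hom_form n (\<Sum>i\<in>I. d i) (\<lambda>v. \<Prod>i\<in>I. F i v)"
  using assms
proof (induction I rule: finite_induct)
  case (insert i I)
  have "hom_form n (d i + (\<Sum>i\<in>I. d i)) (\<lambda>v. F i v * (\<Prod>i\<in>I. F i v))"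
    using insert by (intro hom_form_mult) auto
  thus ?case using insert.hyps by simp
qed (simp add: hom_form_const)

lemma hom_form_power: "hom_form n d F \<Longrightarrow> hom_form n (k * d) (\<lambda>v. F v ^ k)"
  using hom_form_prod[of "{..<k}" n "\<lambda>_. d" "\<lambda>_. F"] by simp

lemma hom_form_linear:
  assumes "h \<in> carrier_vec (n + 1)"
  shows "hom_form n 1 (linear_form h)"
proof -
  have "hom_form n 1 (\<lambda>v. \<Sum>i\<le>n. h $ i * v $ i)"
    by (intro hom_form_sum hom_form_cmult hom_form_coord) auto
  thus ?thesis
    by (subst hom_form_cong[of n _ "\<lambda>v. \<Sum>i\<le>n. h $ i * v $ i"]) (rule linear_form_sum[OF assms])
qed

lemma hom_form_smult:
  assumes "hom_form n d F" "v \<in> carrier_vec (n + 1)"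
  shows "F (k \<cdot>\<^sub>v v) = k ^ d * F v"
proof -
  obtain c where c: "\<And>v. v \<in> carrier_vec (n + 1) \<Longrightarrow>
      F v = (\<Sum>\<alpha>\<in>exponents n d. c \<alpha> * (\<Prod>i\<le>n. (v $ i) ^ \<alpha> i))"
    using assms(1) unfolding hom_form_def by blast
  have "(\<Prod>i\<le>n. ((k \<cdot>\<^sub>v v) $ i) ^ \<alpha> i) = k ^ d * (\<Prod>i\<le>n. (v $ i) ^ \<alpha> i)" if "\<alpha> \<in> exponents n d" for \<alpha>
  proof -
    have "(\<Prod>i\<le>n. ((k \<cdot>\<^sub>v v) $ i) ^ \<alpha> i) = (\<Prod>i\<le>n. k ^ \<alpha> i * (v $ i) ^ \<alpha> i)"
      using assms(2) by (intro prod.cong) (auto simp: power_mult_distrib)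
    also have "\<dots> = k ^ (\<Sum>i\<le>n. \<alpha> i) * (\<Prod>i\<le>n. (v $ i) ^ \<alpha> i)"
      by (simp add: prod.distrib power_sum)
    finally show ?thesis using that by (simp add: exponents_def)
  qed
  hence "(\<Sum>\<alpha>\<in>exponents n d. c \<alpha> * (\<Prod>i\<le>n. ((k \<cdot>\<^sub>v v) $ i) ^ \<alpha> i)) =
      (\<Sum>\<alpha>\<in>exponents n d. k ^ d * (c \<alpha> * (\<Prod>i\<le>n. (v $ i) ^ \<alpha> i)))"
    by (intro sum.cong refl) (simp only: mult.left_commute)
  moreover have "k \<cdot>\<^sub>v v \<in> carrier_vec (n + 1)" using assms(2) by simp
  ultimately show ?thesis by (simp only: c assms(2) sum_distrib_left)
qed

lemma hypersurface_mem_iff: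
  assumes "hom_form n d F" "v \<in> carrier_vec (n + 1)" "v \<noteq> 0\<^sub>v (n + 1)"
  shows "proj_pt v \<in> hypersurface n F \<longleftrightarrow> F v = 0"
proof
  assume "proj_pt v \<in> hypersurface n F"
  thus "F v = 0" using proj_pt_self by (auto simp: hypersurface_def)
next
  assume "F v = 0"
  hence "F w = 0" if "w \<in> proj_pt v" for w
    using that hom_form_smult[OF assms(1,2)] by (auto simp: proj_pt_def)
  thus "proj_pt v \<in> hypersurface n F"
    using proj_pt_in_proj_space[OF assms(2,3)] by (auto simp: hypersurface_def)
qed

lemma zariski_closed_hypersurface:
  "hom_form n d F \<Longrightarrow> zariski_closed n (hypersurface n F)"
  unfolding zariski_closed_def by (intro exI[of _ "{F}"]) (auto simp: hypersurface_def)

lemma zariski_closed_empty: "zariski_closed n {}"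
proof -
  have "hypersurface n (\<lambda>v. 1) = {}"
    using proj_pt_self by (fastforce simp: hypersurface_def elim: proj_spaceE)
  thus ?thesis using zariski_closed_hypersurface[OF hom_form_const, of n 1] by simp
qed

lemma zariski_closed_proj_space: "zariski_closed n (proj_space n)"
  unfolding zariski_closed_def by (intro exI[of _ "{}"]) auto

section \<open>The projective line\<close>

definition vec2 :: "complex \<Rightarrow> complex \<Rightarrow> complex vec" where
  "vec2 s t = vec 2 (\<lambda>i. if i = 0 then s else t)"

lemma vec2_carrier: "vec2 s t \<in> carrier_vec (1 + 1)"
  by (simp add: vec2_def numeral_2_eq_2)

lemma vec2_carrier_simps [simp]: "vec2 s t \<in> carrier_vec 2" "vec2 s t \<in> carrier_vec (Suc (Suc 0))"
  by (simp_all add: vec2_def)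

lemma vec2_index [simp]: "vec2 s t $ 0 = s" "vec2 s t $ 1 = t" "vec2 s t $ Suc 0 = t"
  by (simp_all add: vec2_def)

lemma vec2_eq_iff [simp]: "vec2 s t = vec2 s' t' \<longleftrightarrow> s = s' \<and> t = t'"
  by (metis vec2_index(1,2))

lemma vec2_eta: "v \<in> carrier_vec (1 + 1) \<Longrightarrow> v = vec2 (v $ 0) (v $ 1)"
  by (rule eq_vecI) (auto simp: vec2_def less_2_cases_iff)

lemma zero_vec_eq_vec2: "0\<^sub>v (1 + 1) = vec2 0 0"
  by (rule eq_vecI) (auto simp: vec2_def)

lemma vec2_nonzero: "(s, t) \<noteq> (0, 0) \<Longrightarrow> vec2 s t \<noteq> 0\<^sub>v (1 + 1)"
  unfolding zero_vec_eq_vec2 by simp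

lemma smult_vec2: "c \<cdot>\<^sub>v vec2 s t = vec2 (c * s) (c * t)"
  by (rule eq_vecI) (auto simp: vec2_def)

lemma proj_space_1E:
  assumes "x \<in> proj_space 1"
  obtains s t where "(s, t) \<noteq> (0, 0)" "x = proj_pt (vec2 s t)"
proof -
  from assms obtain v where v: "v \<in> carrier_vec (1 + 1)" "v \<noteq> 0\<^sub>v (1 + 1)" "x = proj_pt v"
    by (rule proj_spaceE)
  from vec2_eta[OF v(1)] have "v = vec2 (v $ 0) (v $ 1)" .
  moreover from this have "(v $ 0, v $ 1) \<noteq> (0, 0)" using v(2) by (metis prod.inject zero_vec_eq_vec2)
  ultimately show ?thesis using that v(3) by metis
qed

lemma proj_pt_vec2_in: "(s, t) \<noteq> (0, 0) \<Longrightarrow> proj_pt (vec2 s t) \<in> proj_space 1"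
  by (rule proj_pt_in_proj_space[OF vec2_carrier vec2_nonzero])

lemma proj_pt_vec2_eq_iff:
  assumes "(s, t) \<noteq> (0, 0)" "(s', t') \<noteq> (0, 0)"
  shows "proj_pt (vec2 s t) = proj_pt (vec2 s' t') \<longleftrightarrow> s * t' = t * s'"
proof
  assume "proj_pt (vec2 s t) = proj_pt (vec2 s' t')"
  from proj_pt_eqD[OF this] show "s * t' = t * s'" by (auto simp: smult_vec2)
next
  assume e: "s * t' = t * s'"
  show "proj_pt (vec2 s t) = proj_pt (vec2 s' t')"
  proof (cases "s' = 0")
    case True
    hence "t' \<noteq> 0" "s = 0" using assms(2) e by auto
    hence "vec2 s t = (t / t') \<cdot>\<^sub>v vec2 s' t'" "t / t' \<noteq> 0" using True assms(1) by (auto simp: smult_vec2)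
    thus ?thesis using proj_pt_smult by metis
  next
    case False
    hence "s \<noteq> 0" using e assms(1) by auto
    hence "vec2 s t = (s / s') \<cdot>\<^sub>v vec2 s' t'" "s / s' \<noteq> 0" using False e by (auto simp: smult_vec2 field_simps)
    thus ?thesis using proj_pt_smult by metis
  qed
qed

lemma infinite_proj_space_1: "infinite (proj_space 1)"
proof -
  have "inj (\<lambda>t. proj_pt (vec2 1 t))" by (auto simp: inj_on_def proj_pt_vec2_eq_iff)
  hence "infinite (range (\<lambda>t. proj_pt (vec2 1 t)))"
    using finite_imageD infinite_UNIV_char_0 by blast
  moreover have "range (\<lambda>t. proj_pt (vec2 1 t)) \<subseteq> proj_space 1"
    using proj_pt_vec2_in[of 1] by (auto simp del: One_nat_def)
  ultimately show ?thesis using finite_subset by blast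
qed

text \<open>Dehomogenisation in both affine charts; the second sees the point [0 : 1], which the
  first misses.\<close>

lemma hom_form_1_poly:
  assumes "hom_form 1 d F"
  obtains p q where "\<And>t. F (vec2 1 t) = poly p t" "\<And>s. F (vec2 s 1) = poly q s"
proof -
  obtain c where c: "\<And>v. v \<in> carrier_vec (1 + 1) \<Longrightarrow>
      F v = (\<Sum>\<alpha>\<in>exponents 1 d. c \<alpha> * (\<Prod>i\<le>1. (v $ i) ^ \<alpha> i))"
    using assms unfolding hom_form_def by blast
  show ?thesis
  proof (rule that)
    show "F (vec2 1 t) = poly (\<Sum>\<alpha>\<in>exponents 1 d. monom (c \<alpha>) (\<alpha> 1)) t" for t
      by (simp add: c[OF vec2_carrier] poly_sum poly_monom)
    show "F (vec2 s 1) = poly (\<Sum>\<alpha>\<in>exponents 1 d. monom (c \<alpha>) (\<alpha> 0)) s" for s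
      by (simp add: c[OF vec2_carrier] poly_sum poly_monom)
  qed
qed

lemma finite_hypersurface_1:
  assumes F: "hom_form 1 d F" and ne: "hypersurface 1 F \<noteq> proj_space 1"
  shows "finite (hypersurface 1 F)"
proof -
  obtain p q where pq: "\<And>t. F (vec2 1 t) = poly p t" "\<And>s. F (vec2 s 1) = poly q s"
    using hom_form_1_poly[OF F] by blast
  have mem: "proj_pt (vec2 s t) \<in> hypersurface 1 F \<longleftrightarrow> F (vec2 s t) = 0" if "(s, t) \<noteq> (0, 0)" for s t
    using that by (intro hypersurface_mem_iff[OF F vec2_carrier vec2_nonzero])
  \<comment> \<open>If \<open>p = 0\<close>, homogeneity kills \<open>F\<close> wherever
    \<open>s \<noteq> 0\<close>; then \<open>q\<close> vanishes off 0, hence identically, and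
    \<open>F\<close> vanishes at [0 : 1] as well.\<close>
  have "p \<noteq> 0"
  proof
    assume "p = 0"
    hence F1: "F (vec2 1 t) = 0" for t by (simp add: pq)
    have Fs: "F (vec2 s t) = 0" if "s \<noteq> 0" for s t
      using hom_form_smult[OF F vec2_carrier, of s 1 "t / s"] F1 that by (simp add: smult_vec2)
    have "q = 0"
    proof (rule ccontr)
      assume "q \<noteq> 0"
      hence "finite {s. poly q s = 0}" by (rule poly_roots_finite)
      moreover have "- {0} \<subseteq> {s. poly q s = 0}" using Fs[of _ 1] by (auto simp: pq)
      ultimately have "finite (- {0 :: complex})" using finite_subset by blast
      thus False using infinite_UNIV_char_0[where 'a = complex] by (simp add: Compl_eq_Diff_UNIV)
    qed
    hence F0: "F (vec2 0 1) = 0" using pq(2)[of 0] by simp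
    have "F (vec2 s t) = 0" for s t
      using hom_form_smult[OF F vec2_carrier, of t 0 1] F0 Fs[of s t] by (cases "s = 0") (auto simp: smult_vec2)
    hence "proj_space 1 \<subseteq> hypersurface 1 F" using mem by (metis proj_space_1E subsetI)
    thus False using ne by (auto simp: hypersurface_def)
  qed
  have "hypersurface 1 F \<subseteq> insert (proj_pt (vec2 0 1)) ((\<lambda>t. proj_pt (vec2 1 t)) ` {t. poly p t = 0})"
  proof
    fix x assume x: "x \<in> hypersurface 1 F"
    hence "x \<in> proj_space 1" by (simp add: hypersurface_def)
    then obtain s t where st: "(s, t) \<noteq> (0, 0)" "x = proj_pt (vec2 s t)" by (rule proj_space_1E)
    show "x \<in> insert (proj_pt (vec2 0 1)) ((\<lambda>t. proj_pt (vec2 1 t)) ` {t. poly p t = 0})"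
    proof (cases "s = 0")
      case True
      hence "x = proj_pt (vec2 0 1)" using st by (auto simp: proj_pt_vec2_eq_iff)
      thus ?thesis by simp
    next
      case False
      hence e: "x = proj_pt (vec2 1 (t / s))" using st by (auto simp: proj_pt_vec2_eq_iff)
      hence "F (vec2 1 (t / s)) = 0" using x mem[of 1 "t / s"] by simp
      thus ?thesis using e pq by auto
    qed
  qed
  thus ?thesis using poly_roots_finite[OF \<open>p \<noteq> 0\<close>] finite_subset by blast
qed

lemma finite_zariski_closed_1:
  assumes "zariski_closed 1 Z" "Z \<noteq> proj_space 1"
  shows "finite Z"
proof -
  obtain \<F> where f: "\<forall>F\<in>\<F>. \<exists>d. hom_form 1 d F" "Z = {x \<in> proj_space 1. \<forall>F\<in>\<F>. x \<in> hypersurface 1 F}"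
    using assms(1) unfolding zariski_closed_def by blast
  then obtain F where F: "F \<in> \<F>" "hypersurface 1 F \<noteq> proj_space 1" using assms(2) by blast
  then obtain d where "hom_form 1 d F" using f by blast
  from finite_hypersurface_1[OF this F(2)] show ?thesis
    by (rule finite_subset[rotated]) (use f F in blast)
qed

text \<open>Proper closed subsets are finite, whereas the line is infinite.\<close>

lemma zariski_connected_1: "zariski_connected 1 (proj_space 1)"
  unfolding zariski_connected_def
proof (intro notI, elim exE conjE)
  fix Z Z' assume Z: "zariski_closed 1 Z" "zariski_closed 1 Z'" "Z \<noteq> {}" "Z' \<noteq> {}" "Z \<inter> Z' = {}" "Z \<union> Z' = proj_space 1"
  have "Z \<noteq> proj_space 1" "Z' \<noteq> proj_space 1" using Z(3-6) by blast+
  hence "finite (Z \<union> Z')" using Z(1,2) finite_zariski_closed_1 by simp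
  thus False using Z(6) infinite_proj_space_1 by simp
qed

lemma local_param_exists_1:
  assumes "a \<in> proj_space 1"
  shows "\<exists>\<phi> r. local_param 1 (proj_space 1) a \<phi> r"
proof -
  obtain s t where st: "(s, t) \<noteq> (0, 0)" "a = proj_pt (vec2 s t)" using assms by (rule proj_space_1E)
  have der: "deriv (\<lambda>z. c + z) 0 = (1 :: complex)" for c
    by (rule DERIV_imp_deriv) (auto intro!: derivative_eq_intros)
  show ?thesis
  proof (cases "s = 0")
    case False
    define \<phi> where "\<phi> = (\<lambda>z. vec2 1 (t / s + z))"
    have "local_param 1 (proj_space 1) a \<phi> 1"
      unfolding local_param_def
    proof (intro conjI allI impI)
      show "proj_pt (\<phi> 0) = a" using False st by (auto simp: \<phi>_def proj_pt_vec2_eq_iff)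
      show "(\<lambda>z. \<phi> z $ i) holomorphic_on ball 0 1" if "i \<le> 1" for i
        using that by (cases i) (auto simp: \<phi>_def intro!: holomorphic_intros)
      show "\<exists>i\<le>1. deriv (\<lambda>z. \<phi> z $ i) 0 \<noteq> 0"
        by (rule exI[of _ 1]) (simp add: \<phi>_def der)
      show "inj_on \<phi> (ball 0 1)" by (auto simp: inj_on_def \<phi>_def)
      show "\<exists>k\<le>1. (\<forall>z\<in>ball 0 1. \<phi> z \<in> carrier_vec (1 + 1) \<and> \<phi> z $ k = 1 \<and> proj_pt (\<phi> z) \<in> proj_space 1) \<and>
        (\<forall>\<rho>. 0 < \<rho> \<and> \<rho> \<le> 1 \<longrightarrow> (\<exists>\<epsilon>>0. \<forall>v\<in>carrier_vec (1 + 1).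
            v $ k = 1 \<and> proj_pt v \<in> proj_space 1 \<and> (\<forall>i\<le>1. cmod (v $ i - \<phi> 0 $ i) < \<epsilon>) \<longrightarrow>
            v \<in> \<phi> ` ball 0 \<rho>))"
      proof (rule exI[of _ 0], intro conjI allI impI ballI)
        fix \<rho> :: real assume r: "0 < \<rho> \<and> \<rho> \<le> 1"
        show "\<exists>\<epsilon>>0. \<forall>v\<in>carrier_vec (1 + 1).
            v $ 0 = 1 \<and> proj_pt v \<in> proj_space 1 \<and> (\<forall>i\<le>1. cmod (v $ i - \<phi> 0 $ i) < \<epsilon>) \<longrightarrow>
            v \<in> \<phi> ` ball 0 \<rho>"
        proof (intro exI[of _ \<rho>] conjI ballI impI)
          fix v :: "complex vec" assume v: "v \<in> carrier_vec (1 + 1)"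
          assume "v $ 0 = 1 \<and> proj_pt v \<in> proj_space 1 \<and> (\<forall>i\<le>1. cmod (v $ i - \<phi> 0 $ i) < \<rho>)"
          hence v0: "v $ 0 = 1" "cmod (v $ 1 - t / s) < \<rho>" by (auto simp: \<phi>_def)
          have "v = \<phi> (v $ 1 - t / s)" using vec2_eta[OF v] v0(1) by (simp add: \<phi>_def)
          moreover have "v $ 1 - t / s \<in> ball 0 \<rho>" using v0(2) by simp
          ultimately show "v \<in> \<phi> ` ball 0 \<rho>" by (rule image_eqI)
        qed (use r in auto)
      qed (auto simp: \<phi>_def simp del: One_nat_def intro!: proj_pt_vec2_in vec2_carrier)
    qed auto
    thus ?thesis by blast
  next
    case True
    define \<phi> where "\<phi> = (\<lambda>z. vec2 z 1)"
    have "local_param 1 (proj_space 1) a \<phi> 1"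
      unfolding local_param_def
    proof (intro conjI allI impI)
      show "proj_pt (\<phi> 0) = a" using True st by (auto simp: \<phi>_def proj_pt_vec2_eq_iff)
      show "(\<lambda>z. \<phi> z $ i) holomorphic_on ball 0 1" if "i \<le> 1" for i
        using that by (cases i) (auto simp: \<phi>_def intro!: holomorphic_intros)
      show "\<exists>i\<le>1. deriv (\<lambda>z. \<phi> z $ i) 0 \<noteq> 0"
        by (rule exI[of _ 0]) (simp add: \<phi>_def)
      show "inj_on \<phi> (ball 0 1)" by (auto simp: inj_on_def \<phi>_def)
      show "\<exists>k\<le>1. (\<forall>z\<in>ball 0 1. \<phi> z \<in> carrier_vec (1 + 1) \<and> \<phi> z $ k = 1 \<and> proj_pt (\<phi> z) \<in> proj_space 1) \<and>
        (\<forall>\<rho>. 0 < \<rho> \<and> \<rho> \<le> 1 \<longrightarrow> (\<exists>\<epsilon>>0. \<forall>v\<in>carrier_vec (1 + 1).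
            v $ k = 1 \<and> proj_pt v \<in> proj_space 1 \<and> (\<forall>i\<le>1. cmod (v $ i - \<phi> 0 $ i) < \<epsilon>) \<longrightarrow>
            v \<in> \<phi> ` ball 0 \<rho>))"
      proof (rule exI[of _ 1], intro conjI allI impI ballI)
        fix \<rho> :: real assume r: "0 < \<rho> \<and> \<rho> \<le> 1"
        show "\<exists>\<epsilon>>0. \<forall>v\<in>carrier_vec (1 + 1).
            v $ 1 = 1 \<and> proj_pt v \<in> proj_space 1 \<and> (\<forall>i\<le>1. cmod (v $ i - \<phi> 0 $ i) < \<epsilon>) \<longrightarrow>
            v \<in> \<phi> ` ball 0 \<rho>"
        proof (intro exI[of _ \<rho>] conjI ballI impI)
          fix v :: "complex vec" assume v: "v \<in> carrier_vec (1 + 1)"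
          assume "v $ 1 = 1 \<and> proj_pt v \<in> proj_space 1 \<and> (\<forall>i\<le>1. cmod (v $ i - \<phi> 0 $ i) < \<rho>)"
          hence v0: "v $ 1 = 1" "cmod (v $ 0) < \<rho>" by (auto simp: \<phi>_def)
          have "v = \<phi> (v $ 0)" using vec2_eta[OF v] v0(1) by (simp add: \<phi>_def)
          moreover have "v $ 0 \<in> ball 0 \<rho>" using v0(2) by simp
          ultimately show "v \<in> \<phi> ` ball 0 \<rho>" by (rule image_eqI)
        qed (use r in auto)
      qed (auto simp: \<phi>_def simp del: One_nat_def intro!: proj_pt_vec2_in vec2_carrier)
    qed auto
    thus ?thesis by blast
  qed
qed

lemma smooth_curve_1: "smooth_curve 1 (proj_space 1)"
  unfolding smooth_curve_def
  using zariski_closed_proj_space zariski_connected_1 local_param_exists_1 infinite_proj_space_1 by auto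

section \<open>Local parameters, orders of vanishing and degrees on the line\<close>

text \<open>The chart coordinate is constantly 1 and has derivative 0, so the immersion condition
  falls on the other one. This reduces an arbitrary parameter to one scalar function with nonzero
  derivative, which is needed because canonical divisors and contact orders refer to all
  parameters.\<close>

lemma local_param_1_cases:
  assumes "local_param 1 (proj_space 1) a \<phi> r"
  obtains (fst) \<psi> where "\<psi> holomorphic_on ball 0 r" "deriv \<psi> 0 \<noteq> 0" "\<And>z. z \<in> ball 0 r \<Longrightarrow> \<phi> z = vec2 1 (\<psi> z)"
    | (snd) \<psi> where "\<psi> holomorphic_on ball 0 r" "deriv \<psi> 0 \<noteq> 0" "\<And>z. z \<in> ball 0 r \<Longrightarrow> \<phi> z = vec2 (\<psi> z) 1"
proof -
  have r: "r > 0" and hol: "\<And>i. i \<le> 1 \<Longrightarrow> (\<lambda>z. \<phi> z $ i) holomorphic_on ball 0 r"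
    and der: "\<exists>i\<le>1. deriv (\<lambda>z. \<phi> z $ i) 0 \<noteq> 0"
    using assms by (auto simp: local_param_def)
  obtain k where k: "k \<le> 1" "\<And>z. z \<in> ball 0 r \<Longrightarrow> \<phi> z \<in> carrier_vec (1 + 1)"
    "\<And>z. z \<in> ball 0 r \<Longrightarrow> \<phi> z $ k = 1"
    using assms unfolding local_param_def by blast
  have "deriv (\<lambda>z. \<phi> z $ k) 0 = deriv (\<lambda>z. 1) 0"
  proof (rule deriv_cong_ev)
    have "\<forall>\<^sub>F z in nhds 0. z \<in> ball 0 r" using r by (intro eventually_nhds_in_open) auto
    thus "\<forall>\<^sub>F z in nhds 0. \<phi> z $ k = 1" by eventually_elim (rule k(3))
  qed simp
  hence dk: "deriv (\<lambda>z. \<phi> z $ k) 0 = 0" by simp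
  have kk: "k = 0 \<or> k = 1" using k(1) by auto
  have d1: "deriv (\<lambda>z. \<phi> z $ (1 - k)) 0 \<noteq> 0"
  proof -
    obtain i where "i \<le> 1" "deriv (\<lambda>z. \<phi> z $ i) 0 \<noteq> 0" using der by blast
    moreover from this dk have "i \<noteq> k" by metis
    ultimately have "i = 1 - k" using k(1) by linarith
    thus ?thesis using \<open>deriv (\<lambda>z. \<phi> z $ i) 0 \<noteq> 0\<close> by simp
  qed
  show ?thesis
  proof (cases "k = 0")
    case True
    show ?thesis
      by (rule fst[OF hol[of 1]]) (use d1 True k vec2_eta[OF k(2)] in auto)
  next
    case False
    hence "k = 1" using kk by simp
    show ?thesis
      by (rule snd[OF hol[of 0]]) (use d1 \<open>k = 1\<close> k vec2_eta[OF k(2)] in auto)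
  qed
qed

text \<open>The difference quotient at 0 has a removable singularity with value
  \<open>deriv f 0\<close>; shrinking the disc keeps it nonzero.\<close>

lemma simple_zero_factor:
  assumes "f holomorphic_on ball 0 r" "r > 0" "f 0 = 0" "deriv f 0 \<noteq> 0"
  obtains g \<rho> where "0 < \<rho>" "\<rho> \<le> r" "g holomorphic_on ball 0 \<rho>"
    "\<And>z. z \<in> ball 0 \<rho> \<Longrightarrow> g z \<noteq> 0" "\<And>z. z \<in> ball 0 \<rho> \<Longrightarrow> f z = z * g z"
proof -
  define g where "g = (\<lambda>z. if z = 0 then deriv f 0 else (f z - f 0) / (z - 0))"
  have g: "g holomorphic_on ball 0 r"
    unfolding g_def using assms(1,2) by (intro pole_lemma) auto
  have "continuous_on (ball 0 r) g" using g by (rule holomorphic_on_imp_continuous_on)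
  hence "isCont g 0" using assms(2) by (simp add: continuous_on_eq_continuous_at)
  moreover have "g 0 \<noteq> 0" using assms by (simp add: g_def)
  ultimately obtain e where e: "e > 0" "\<And>y. dist 0 y < e \<Longrightarrow> g y \<noteq> 0"
    using continuous_at_avoid[of 0 g 0] by blast
  show ?thesis
  proof (rule that[of "min e r" g])
    show "g holomorphic_on ball 0 (min e r)" using g by (rule holomorphic_on_subset) auto
    show "f z = z * g z" for z using assms(3) by (simp add: g_def)
  qed (use e assms(2) in auto)
qed

lemma nonvanishing_ball:
  fixes g :: "complex \<Rightarrow> complex"
  assumes "g holomorphic_on ball 0 r" "r > 0" "g 0 \<noteq> 0"
  obtains \<rho> where "0 < \<rho>" "\<rho> \<le> r" "\<And>z. z \<in> ball 0 \<rho> \<Longrightarrow> g z \<noteq> 0"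
proof -
  have "continuous_on (ball 0 r) g" using assms(1) by (rule holomorphic_on_imp_continuous_on)
  hence "isCont g 0" using assms(2) by (simp add: continuous_on_eq_continuous_at)
  then obtain e where "e > 0" "\<And>y. dist 0 y < e \<Longrightarrow> g y \<noteq> 0"
    using continuous_at_avoid[of 0 g 0] assms(3) by blast
  thus ?thesis using that[of "min e r"] assms(2) by auto
qed

lemma zorder_ballI:
  assumes "r > 0" "g holomorphic_on ball 0 r" "\<And>z. z \<in> ball 0 r \<Longrightarrow> g z \<noteq> 0"
    and w: "\<And>z. z \<in> ball 0 r \<Longrightarrow> z \<noteq> 0 \<Longrightarrow> w z = g z * z powi n"
  shows "\<forall>\<^sub>F z in at 0. w z \<noteq> 0" and "zorder w 0 = n"
proof -
  have "\<forall>\<^sub>F z in at 0. z \<in> ball 0 r - {0}" using assms(1) by (intro eventually_at_in_open) auto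
  thus "\<forall>\<^sub>F z in at 0. w z \<noteq> 0"
    by eventually_elim (use w assms(3) in auto)
  show "zorder w 0 = n"
    by (rule zorder_eqI[where S = "ball 0 r" and g = g]) (use assms in auto)
qed

lemma deriv_cong_ball:
  assumes "z \<in> ball 0 r" "\<And>z. z \<in> ball 0 r \<Longrightarrow> f z = g z"
  shows "deriv f z = deriv g (z :: complex)"
proof (rule deriv_cong_ev)
  have "\<forall>\<^sub>F z in nhds z. z \<in> ball 0 r" using assms(1) by (intro eventually_nhds_in_open) auto
  thus "\<forall>\<^sub>F z in nhds z. f z = g z" by eventually_elim (rule assms(2))
qed simp

text \<open>The divisor of \<open>d (v\<^sub>1 / v\<^sub>0)\<close>.\<close>
lemma canonical_divisor_1:
  "canonical_divisor 1 (proj_space 1) (\<lambda>a. if a = proj_pt (vec2 0 1) then - 2 else 0)"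
proof -
  \<comment> \<open>Written as a quotient because rational functions are quotients of forms of equal
    degree, here of degree 0.\<close>
  define f :: "complex vec \<Rightarrow> complex" where "f = (\<lambda>v. 1 / 1)"
  define h :: "complex vec \<Rightarrow> complex" where "h = (\<lambda>v. v $ 1 / v $ 0)"
  define w where "w = (\<lambda>\<phi> z. f (\<phi> z) * deriv (\<lambda>u. h (\<phi> u)) z)"
  have "hypersurface 1 (\<lambda>v. 1) = {}"
    using proj_pt_self by (fastforce simp: hypersurface_def elim: proj_spaceE)
  hence rf: "rational_function 1 (proj_space 1) f"
    unfolding rational_function_def f_def using infinite_proj_space_1
    by (intro exI[of _ "0::nat"] exI[of _ "\<lambda>_. 1"] conjI hom_form_const) auto
  have "proj_pt (vec2 1 0) \<notin> hypersurface 1 (\<lambda>v. v $ 0)"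
    using proj_pt_self[of "vec2 1 0"] by (force simp: hypersurface_def)
  moreover have "proj_pt (vec2 1 0) \<in> proj_space 1" by (rule proj_pt_vec2_in) simp
  ultimately have "\<not> proj_space 1 \<subseteq> hypersurface 1 (\<lambda>v. v $ 0)" by blast
  hence rh: "rational_function 1 (proj_space 1) h"
    unfolding rational_function_def h_def
    by (intro exI[of _ "1::nat"] exI[of _ "\<lambda>v. v $ 1"] exI[of _ "\<lambda>v. v $ 0"] conjI hom_form_coord) auto
  have main: "(\<forall>\<^sub>F z in at 0. w \<phi> z \<noteq> 0) \<and> (if a = proj_pt (vec2 0 1) then - 2 else 0) = zorder (w \<phi>) 0"
    if lp: "local_param 1 (proj_space 1) a \<phi> r" for a \<phi> r
  proof -
    have r: "r > 0" and a: "a = proj_pt (\<phi> 0)" using lp by (auto simp: local_param_def)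
    from lp show ?thesis
    proof (cases rule: local_param_1_cases)
      case (fst \<psi>)
      have dhol: "deriv \<psi> holomorphic_on ball 0 r" using fst(1) by (intro holomorphic_deriv) auto
      obtain \<rho> where \<rho>: "0 < \<rho>" "\<rho> \<le> r" "\<And>z. z \<in> ball 0 \<rho> \<Longrightarrow> deriv \<psi> z \<noteq> 0"
        using nonvanishing_ball[OF dhol r fst(2)] by blast
      have wz: "w \<phi> z = deriv \<psi> z * z powi 0" if "z \<in> ball 0 \<rho>" for z
      proof -
        have "deriv (\<lambda>u. h (\<phi> u)) z = deriv \<psi> z"
          by (rule deriv_cong_ball[of _ r]) (use that \<rho>(2) fst(3) in \<open>auto simp: h_def\<close>)
        thus ?thesis by (simp add: w_def f_def)
      qed
      have "deriv \<psi> holomorphic_on ball 0 \<rho>"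
        using dhol by (rule holomorphic_on_subset) (use \<rho>(2) in auto)
      note z = zorder_ballI[OF \<rho>(1) this \<rho>(3) wz]
      have "a \<noteq> proj_pt (vec2 0 1)"
        using r fst(3)[of 0] by (simp add: a proj_pt_vec2_eq_iff)
      thus ?thesis using z by simp
    next
      case (snd \<psi>)
      have dhol: "deriv \<psi> holomorphic_on ball 0 r" using snd(1) by (intro holomorphic_deriv) auto
      \<comment> \<open>The derivative of \<open>1 / \<psi>\<close>: at [0 : 1], where
        \<open>\<psi>\<close> has a simple zero, it has a double pole.\<close>
      have wz: "w \<phi> z = - deriv \<psi> z / (\<psi> z)\<^sup>2" if z: "z \<in> ball 0 r" "\<psi> z \<noteq> 0" for z
      proof -
        have "(\<psi> has_field_derivative deriv \<psi> z) (at z)"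
          using snd(1) z(1) by (intro holomorphic_derivI[of _ "ball 0 r"]) auto
        hence "((\<lambda>u. 1 / \<psi> u) has_field_derivative - deriv \<psi> z / (\<psi> z)\<^sup>2) (at z)"
          using z(2) by (auto intro!: derivative_eq_intros simp: power2_eq_square)
        hence "deriv (\<lambda>u. 1 / \<psi> u) z = - deriv \<psi> z / (\<psi> z)\<^sup>2" by (rule DERIV_imp_deriv)
        moreover have "deriv (\<lambda>u. h (\<phi> u)) z = deriv (\<lambda>u. 1 / \<psi> u) z"
          by (rule deriv_cong_ball[of _ r]) (use z(1) snd(3) in \<open>auto simp: h_def\<close>)
        ultimately show ?thesis by (simp add: w_def f_def)
      qed
      obtain \<rho> where \<rho>: "0 < \<rho>" "\<rho> \<le> r" "\<And>z. z \<in> ball 0 \<rho> \<Longrightarrow> deriv \<psi> z \<noteq> 0"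
        using nonvanishing_ball[OF dhol r snd(2)] by blast
      have a': "a = proj_pt (vec2 0 1) \<longleftrightarrow> \<psi> 0 = 0"
        using r snd(3)[of 0] by (simp add: a proj_pt_vec2_eq_iff)
      show ?thesis
      proof (cases "\<psi> 0 = 0")
        case False
        obtain \<rho>' where \<rho>': "0 < \<rho>'" "\<rho>' \<le> r" "\<And>z. z \<in> ball 0 \<rho>' \<Longrightarrow> \<psi> z \<noteq> 0"
          using nonvanishing_ball[OF snd(1) r False] by blast
        define R where "R = min \<rho> \<rho>'"
        have hol: "(\<lambda>z. - deriv \<psi> z / (\<psi> z)\<^sup>2) holomorphic_on ball 0 R"
          using \<rho>(2) \<rho>'(3)
          by (auto simp: R_def intro!: holomorphic_intros holomorphic_on_subset[OF dhol] holomorphic_on_subset[OF snd(1)])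
        have "R > 0" using \<rho> \<rho>' by (simp add: R_def)
        have nz: "- deriv \<psi> z / (\<psi> z)\<^sup>2 \<noteq> 0" if "z \<in> ball 0 R" for z
          using that \<rho>(3)[of z] \<rho>'(3)[of z] by (simp add: R_def)
        have wz': "w \<phi> z = - deriv \<psi> z / (\<psi> z)\<^sup>2 * z powi 0" if "z \<in> ball 0 R" for z
          using that wz[of z] \<rho>(2) \<rho>'(3)[of z] by (simp add: R_def)
        note z = zorder_ballI[OF \<open>R > 0\<close> hol nz wz']
        thus ?thesis using a' False by simp
      next
        case True
        obtain \<chi> \<rho>' where \<rho>': "0 < \<rho>'" "\<rho>' \<le> r" "\<chi> holomorphic_on ball 0 \<rho>'"
          "\<And>z. z \<in> ball 0 \<rho>' \<Longrightarrow> \<chi> z \<noteq> 0" "\<And>z. z \<in> ball 0 \<rho>' \<Longrightarrow> \<psi> z = z * \<chi> z"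
          by (rule simple_zero_factor[OF snd(1) r True snd(2)]) (rule that, assumption+)
        define R where "R = min \<rho> \<rho>'"
        have hol: "(\<lambda>z. - deriv \<psi> z / (\<chi> z)\<^sup>2) holomorphic_on ball 0 R"
          using \<rho>(2) \<rho>'(4)
          by (auto simp: R_def intro!: holomorphic_intros holomorphic_on_subset[OF dhol] holomorphic_on_subset[OF \<rho>'(3)])
        have R0: "R > 0" using \<rho> \<rho>' by (simp add: R_def)
        have nz: "- deriv \<psi> z / (\<chi> z)\<^sup>2 \<noteq> 0" if "z \<in> ball 0 R" for z
          using that \<rho>(3)[of z] \<rho>'(4)[of z] by (simp add: R_def)
        have wz': "w \<phi> z = - deriv \<psi> z / (\<chi> z)\<^sup>2 * z powi (- 2)" if "z \<in> ball 0 R" "z \<noteq> 0" for z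
        proof -
          have "\<psi> z \<noteq> 0" "z \<in> ball 0 r" using that \<rho>' by (auto simp: R_def)
          thus ?thesis using wz[of z] \<rho>'(5)[of z] that
            by (simp add: R_def power_int_minus power_mult_distrib field_simps)
        qed
        note z = zorder_ballI[OF R0 hol nz wz']
        thus ?thesis using a' True by simp
      qed
    qed
  qed
  show ?thesis
    unfolding canonical_divisor_def Let_def
    using rf rh main by (intro exI[of _ f] exI[of _ h]) (auto simp: w_def)
qed

text \<open>The canonical divisor contributes -2, and each of the \<open>k + 1\<close> marked points
  contributes \<open>1 - 1 / M j\<close>.\<close>

lemma log_canonical_degree_1:
  assumes inj: "inj_on a {..k}" and sub: "a ` {..k} \<subseteq> proj_space 1"
    and \<mu>: "\<And>j. j \<le> k \<Longrightarrow> \<mu> (a j) = M j" "\<And>x. x \<in> proj_space 1 - a ` {..k} \<Longrightarrow> \<mu> x = 1"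
  shows "log_canonical_degree_is 1 (proj_space 1) \<mu> (real k - 1 - (\<Sum>j\<le>k. 1 / M j))"
proof -
  define K where "K = (\<lambda>a. if a = proj_pt (vec2 0 1) then - 2 else (0 :: int))"
  define pinf where "pinf = proj_pt (vec2 0 1)"
  have inP: "pinf \<in> proj_space 1" unfolding pinf_def by (rule proj_pt_vec2_in) simp
  define D where "D = (\<lambda>x. of_int (K x) + (1 - 1 / \<mu> x))"
  \<comment> \<open>The point [0 : 1] may or may not be marked, so both divisors are summed over a
    common finite set before they are separated.\<close>
  have "divisor_degree (proj_space 1) D = (\<Sum>x\<in>insert pinf (a ` {..k}). D x)"
    unfolding divisor_degree_def using inP sub \<mu>(2)
    by (intro sum.mono_neutral_left) (auto simp: D_def K_def pinf_def)
  also have "\<dots> = (\<Sum>x\<in>insert pinf (a ` {..k}). of_int (K x)) + (\<Sum>x\<in>insert pinf (a ` {..k}). 1 - 1 / \<mu> x)"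
    by (simp only: D_def sum.distrib)
  also have "(\<Sum>x\<in>insert pinf (a ` {..k}). of_int (K x)) = (\<Sum>x\<in>{pinf}. of_int (K x) :: real)"
    by (rule sum.mono_neutral_right) (auto simp: K_def pinf_def)
  also have "\<dots> = - 2" by (simp add: K_def pinf_def)
  also have "(\<Sum>x\<in>insert pinf (a ` {..k}). 1 - 1 / \<mu> x) = (\<Sum>x\<in>a ` {..k}. 1 - 1 / \<mu> x)"
    using inP \<mu>(2) by (intro sum.mono_neutral_right) auto
  also have "\<dots> = (\<Sum>j\<le>k. 1 - 1 / M j)"
    unfolding sum.reindex[OF inj] using \<mu>(1) by (intro sum.cong) auto
  also have "- 2 + \<dots> = real k - 1 - (\<Sum>j\<le>k. 1 / M j)" by (simp add: sum_subtractf)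
  finally show ?thesis
    unfolding log_canonical_degree_is_def D_def K_def
    by (intro exI conjI) (rule canonical_divisor_1)
qed

lemma hom_form_holomorphic:
  assumes "hom_form N d F" "\<And>i. i \<le> N \<Longrightarrow> (\<lambda>z. \<phi> z $ i) holomorphic_on S"
    and "\<And>z. z \<in> S \<Longrightarrow> \<phi> z \<in> carrier_vec (N + 1)"
  shows "(\<lambda>z. F (\<phi> z)) holomorphic_on S"
proof -
  obtain c where c: "\<And>v. v \<in> carrier_vec (N + 1) \<Longrightarrow>
      F v = (\<Sum>\<alpha>\<in>exponents N d. c \<alpha> * (\<Prod>i\<le>N. (v $ i) ^ \<alpha> i))"
    using assms(1) unfolding hom_form_def by blast
  have "(\<lambda>z. \<Sum>\<alpha>\<in>exponents N d. c \<alpha> * (\<Prod>i\<le>N. (\<phi> z $ i) ^ \<alpha> i)) holomorphic_on S"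
    using assms(2) by (intro holomorphic_on_sum holomorphic_on_mult holomorphic_on_const
      holomorphic_on_prod holomorphic_on_power) auto
  thus ?thesis
    by (rule holomorphic_transform) (use c assms(3) in simp)
qed

text \<open>
  Any two lifts of \<open>g\<close> differ by a nonvanishing holomorphic factor, so the order is read off \<open>G\<close>.
\<close>
lemma contact_order_1:
  assumes G: "hom_map 1 n d G" and Gnz: "\<And>s t. (s, t) \<noteq> (0, 0) \<Longrightarrow> G (vec2 s t) \<noteq> 0\<^sub>v (n + 1)"
    and g: "\<And>s t. (s, t) \<noteq> (0, 0) \<Longrightarrow> g (proj_pt (vec2 s t)) = proj_pt (G (vec2 s t))"
    and F: "\<And>c w. w \<in> carrier_vec (n + 1) \<Longrightarrow> F (c \<cdot>\<^sub>v w) = c * F w"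
    and FG: "\<And>s t. F (G (vec2 s t)) = \<kappa> * (q * s - p * t) ^ m" and \<kappa>: "\<kappa> \<noteq> 0"
    and pq: "(p, q) \<noteq> (0, 0)"
  shows "contact_order 1 (proj_space 1) n g F (proj_pt (vec2 p q)) = int m"
proof -
  let ?a = "proj_pt (vec2 p q)"
  define P where "P = (\<lambda>\<phi> r \<psi>. local_param 1 (proj_space 1) ?a \<phi> r \<and>
        (\<forall>i\<le>n. (\<lambda>z. \<psi> z $ i) holomorphic_on ball 0 r) \<and>
        (\<forall>z\<in>ball 0 r. \<psi> z \<in> carrier_vec (n + 1) \<and> \<psi> z \<noteq> 0\<^sub>v (n + 1) \<and>
            g (proj_pt (\<phi> z)) = proj_pt (\<psi> z)))"
  have Gc: "G v \<in> carrier_vec (n + 1)" if "v \<in> carrier_vec (1 + 1)" for v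
    using G that by (simp add: hom_map_def)
  have lp: "\<phi> z \<in> carrier_vec (1 + 1)" "\<exists>s t. (s, t) \<noteq> (0, 0) \<and> \<phi> z = vec2 s t"
    "(\<lambda>z. G (\<phi> z) $ i) holomorphic_on ball 0 r"
    if "local_param 1 (proj_space 1) ?a \<phi> r" "z \<in> ball 0 r" "i \<le> n" for \<phi> r z i
  proof -
    have c: "\<phi> z \<in> carrier_vec (1 + 1)" if "z \<in> ball 0 r" for z
      using \<open>local_param 1 (proj_space 1) ?a \<phi> r\<close> that unfolding local_param_def by blast
    show "\<phi> z \<in> carrier_vec (1 + 1)" by (rule c) fact
    from that(1) show "\<exists>s t. (s, t) \<noteq> (0, 0) \<and> \<phi> z = vec2 s t"
    proof (cases rule: local_param_1_cases)
      case (fst \<psi>)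
      show ?thesis by (intro exI[of _ 1] exI[of _ "\<psi> z"]) (simp add: fst(3)[OF that(2)])
    next
      case (snd \<psi>)
      show ?thesis by (intro exI[of _ 1] exI[of _ "\<psi> z"]) (simp add: snd(3)[OF that(2)])
    qed
    have "hom_form 1 d (\<lambda>v. G v $ i)" using G that(3) by (simp add: hom_map_def)
    thus "(\<lambda>z. G (\<phi> z) $ i) holomorphic_on ball 0 r"
      by (rule hom_form_holomorphic) (use that(1) c in \<open>auto simp: local_param_def\<close>)
  qed
  \<comment> \<open>The definite description in \<open>contact_order\<close> needs the same order
    for every parameter and every lift.\<close>
  have uniq: "zorder (\<lambda>z. F (\<psi> z)) 0 = int m" if P: "P \<phi> r \<psi>" for \<phi> r \<psi>
  proof -
    have l: "local_param 1 (proj_space 1) ?a \<phi> r" using P by (simp add: P_def)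
    have r: "r > 0" and a: "proj_pt (\<phi> 0) = ?a" using l by (auto simp: local_param_def)
    have lift: "\<psi> z \<in> carrier_vec (n + 1)" "\<psi> z \<noteq> 0\<^sub>v (n + 1)" "g (proj_pt (\<phi> z)) = proj_pt (\<psi> z)"
      if "z \<in> ball 0 r" for z using P that by (auto simp: P_def)
    have \<psi>hol: "(\<lambda>z. \<psi> z $ i) holomorphic_on ball 0 r" if "i \<le> n" for i using P that by (auto simp: P_def)
    have 0: "(0::complex) \<in> ball 0 r" using r by simp
    have "G (\<phi> 0) \<noteq> 0\<^sub>v (n + 1)" using lp(2)[OF l 0, of 0] Gnz by auto
    moreover have "G (\<phi> 0) = 0\<^sub>v (n + 1)" if "\<not> (\<exists>i\<le>n. G (\<phi> 0) $ i \<noteq> 0)"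
      using Gc[OF lp(1)[OF l 0, of 0]] that by (intro eq_vecI) (auto simp: less_Suc_eq_le)
    ultimately have "\<exists>i\<le>n. G (\<phi> 0) $ i \<noteq> 0" by blast
    then obtain i where i: "i \<le> n" "G (\<phi> 0) $ i \<noteq> 0" by blast
    define u where "u = (\<lambda>z. G (\<phi> z) $ i)"
    have uhol: "u holomorphic_on ball 0 r" unfolding u_def by (rule lp(3)[OF l 0 i(1)])
    obtain \<rho> where \<rho>: "0 < \<rho>" "\<rho> \<le> r" "\<And>z. z \<in> ball 0 \<rho> \<Longrightarrow> u z \<noteq> 0"
      using nonvanishing_ball[OF uhol r] i(2) unfolding u_def by blast
    \<comment> \<open>Dividing by a coordinate of \<open>G\<close> that does not vanish at the point
      shows that the proportionality factor of the two lifts is holomorphic.\<close>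
    define c where "c = (\<lambda>z. \<psi> z $ i / u z)"
    have c: "c z \<noteq> 0 \<and> \<psi> z = c z \<cdot>\<^sub>v G (\<phi> z)" if z: "z \<in> ball 0 \<rho>" for z
    proof -
      have z': "z \<in> ball 0 r" using z \<rho>(2) by auto
      obtain s t where st: "(s, t) \<noteq> (0, 0)" "\<phi> z = vec2 s t" using lp(2)[OF l z' i(1)] by blast
      have "proj_pt (\<psi> z) = proj_pt (G (\<phi> z))" using lift(3)[OF z'] g[OF st(1)] st(2) by simp
      from proj_pt_eqD[OF this] obtain k where k: "k \<noteq> 0" "\<psi> z = k \<cdot>\<^sub>v G (\<phi> z)" by blast
      have "\<psi> z $ i = k * u z" using k(2) i(1) Gc[OF lp(1)[OF l z' i(1)]] by (simp add: u_def)
      hence "c z = k" using \<rho>(3)[OF z] by (simp add: c_def)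
      thus ?thesis using k by simp
    qed
    have chol: "c holomorphic_on ball 0 \<rho>"
      unfolding c_def using \<rho> by (intro holomorphic_on_divide holomorphic_on_subset[OF \<psi>hol[OF i(1)]]
        holomorphic_on_subset[OF uhol]) auto
    \<comment> \<open>In a local parameter \<open>q * s - p * t\<close> has a simple zero: its
      derivative is \<open>- p\<close> or \<open>q\<close> times that of the scalar function, and
      this coefficient is nonzero because the point lies in the chart in question.\<close>
    obtain k where k: "k holomorphic_on ball 0 r" "k 0 = 0" "deriv k 0 \<noteq> 0"
      "\<And>z. z \<in> ball 0 r \<Longrightarrow> F (G (\<phi> z)) = \<kappa> * k z ^ m"
      using l
    proof (cases rule: local_param_1_cases)
      case (fst \<psi>')
      have "proj_pt (vec2 1 (\<psi>' 0)) = ?a" using a fst(3)[OF 0] by simp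
      hence e: "q = \<psi>' 0 * p" using pq by (subst (asm) proj_pt_vec2_eq_iff) auto
      have "((\<lambda>z. q * 1 - p * \<psi>' z) has_field_derivative 0 - p * deriv \<psi>' 0) (at 0)"
        using holomorphic_derivI[OF fst(1) _ 0] by (auto intro!: derivative_eq_intros)
      hence "deriv (\<lambda>z. q * 1 - p * \<psi>' z) 0 = 0 - p * deriv \<psi>' 0" by (rule DERIV_imp_deriv)
      thus ?thesis using fst e pq
        by (intro that[of "\<lambda>z. q * 1 - p * \<psi>' z"] holomorphic_intros) (auto simp: FG)
    next
      case (snd \<psi>')
      have "proj_pt (vec2 (\<psi>' 0) 1) = ?a" using a snd(3)[OF 0] by simp
      hence e: "\<psi>' 0 * q = p" using pq by (subst (asm) proj_pt_vec2_eq_iff) auto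
      have "((\<lambda>z. q * \<psi>' z - p * 1) has_field_derivative q * deriv \<psi>' 0 - 0) (at 0)"
        using holomorphic_derivI[OF snd(1) _ 0] by (auto intro!: derivative_eq_intros)
      hence "deriv (\<lambda>z. q * \<psi>' z - p * 1) 0 = q * deriv \<psi>' 0 - 0" by (rule DERIV_imp_deriv)
      thus ?thesis using snd e pq
        by (intro that[of "\<lambda>z. q * \<psi>' z - p * 1"] holomorphic_intros) (auto simp: FG)
    qed
    obtain \<chi> \<rho>' where \<rho>': "0 < \<rho>'" "\<rho>' \<le> r" "\<chi> holomorphic_on ball 0 \<rho>'"
      "\<And>z. z \<in> ball 0 \<rho>' \<Longrightarrow> \<chi> z \<noteq> 0" "\<And>z. z \<in> ball 0 \<rho>' \<Longrightarrow> k z = z * \<chi> z"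
      by (rule simple_zero_factor[OF k(1) r k(2,3)]) (rule that, assumption+)
    define R where "R = min \<rho> \<rho>'"
    show ?thesis
    proof (rule zorder_ballI(2)[where r = R and g = "\<lambda>z. c z * \<kappa> * \<chi> z ^ m"])
      show "R > 0" using \<rho> \<rho>' by (simp add: R_def)
      show "(\<lambda>z. c z * \<kappa> * \<chi> z ^ m) holomorphic_on ball 0 R"
        by (intro holomorphic_intros holomorphic_on_subset[OF chol] holomorphic_on_subset[OF \<rho>'(3)])
          (auto simp: R_def)
      show "c z * \<kappa> * \<chi> z ^ m \<noteq> 0" if "z \<in> ball 0 R" for z
        using c[of z] \<rho>'(4)[of z] \<kappa> that by (simp add: R_def)
      show "F (\<psi> z) = c z * \<kappa> * \<chi> z ^ m * z powi int m" if "z \<in> ball 0 R" "z \<noteq> 0" for z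
      proof -
        have z: "z \<in> ball 0 \<rho>" "z \<in> ball 0 \<rho>'" "z \<in> ball 0 r" using that \<rho> by (auto simp: R_def)
        have "F (\<psi> z) = F (c z \<cdot>\<^sub>v G (\<phi> z))" using c[OF z(1)] by metis
        also have "\<dots> = c z * F (G (\<phi> z))" by (rule F[OF Gc[OF lp(1)[OF l z(3) i(1)]]])
        also have "\<dots> = c z * \<kappa> * \<chi> z ^ m * z ^ m"
          by (simp add: k(4)[OF z(3)] \<rho>'(5)[OF z(2)] power_mult_distrib)
        finally show ?thesis by simp
      qed
    qed
  qed
  obtain \<phi> r where l: "local_param 1 (proj_space 1) ?a \<phi> r"
    using local_param_exists_1[OF proj_pt_vec2_in[OF pq]] by blast
  \<comment> \<open>\<open>G\<close> composed with a local parameter is a lift, so the description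
    is not empty.\<close>
  have "P \<phi> r (\<lambda>z. G (\<phi> z))"
    unfolding P_def
  proof (intro conjI ballI allI impI l)
    have r: "(0::complex) \<in> ball 0 r" using l by (auto simp: local_param_def)
    show "(\<lambda>z. G (\<phi> z) $ i) holomorphic_on ball 0 r" if "i \<le> n" for i by (rule lp(3)[OF l r that])
    fix z :: complex assume z: "z \<in> ball 0 r"
    show "G (\<phi> z) \<in> carrier_vec (n + 1)" by (rule Gc[OF lp(1)[OF l z le0]])
    show "G (\<phi> z) \<noteq> 0\<^sub>v (n + 1)" "g (proj_pt (\<phi> z)) = proj_pt (G (\<phi> z))"
      using lp(2)[OF l z le0] Gnz g by auto
  qed
  hence "(THE t. \<exists>\<phi> r \<psi>. P \<phi> r \<psi> \<and> t = zorder (\<lambda>z. F (\<psi> z)) 0) = int m"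
    using uniq by (intro the_equality) (metis, metis)
  thus ?thesis unfolding contact_order_def P_def by (simp add: conj_assoc)
qed

section \<open>Rational normal curves\<close>

lemma veronese_carrier [simp]: "veronese n s t \<in> carrier_vec (n + 1)"
  "veronese n s t \<in> carrier_vec (Suc n)"
  by (simp_all add: veronese_def)

lemma veronese_index: "i \<le> n \<Longrightarrow> veronese n s t $ i = s ^ (n - i) * t ^ i"
  by (simp add: veronese_def)

lemma veronese_scale: "veronese n (c * s) (c * t) = c ^ n \<cdot>\<^sub>v veronese n s t"
proof (rule eq_vecI)
  fix i assume "i < dim_vec (c ^ n \<cdot>\<^sub>v veronese n s t)"
  hence i: "i \<le> n" by (simp add: veronese_def)
  hence "c ^ n = c ^ (n - i) * c ^ i" by (simp flip: power_add)
  thus "veronese n (c * s) (c * t) $ i = (c ^ n \<cdot>\<^sub>v veronese n s t) $ i"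
    using i by (simp add: veronese_def power_mult_distrib)
qed (simp add: veronese_def)

lemma veronese_nonzero:
  assumes "(s, t) \<noteq> (0, 0)"
  shows "veronese n s t \<noteq> 0\<^sub>v (n + 1)"
proof
  assume "veronese n s t = 0\<^sub>v (n + 1)"
  hence e: "s ^ (n - i) * t ^ i = 0" if "i \<le> n" for i
    using that veronese_index[of i n s t] by simp
  from e[of 0] e[of n] assms show False by simp
qed

text \<open>The coordinates 0 and 1, which are s^n and s^(n-1) t, determine the ratio of
  \<open>s\<close> and \<open>t\<close> unless \<open>s' = 0\<close>, in which case \<open>s\<close>
  vanishes too.\<close>

lemma veronese_proportional:
  assumes n: "n \<ge> 1" and eq: "veronese n s t = c \<cdot>\<^sub>v veronese n s' t'" and c: "c \<noteq> 0"
  shows "s * t' = t * s'"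
proof -
  have e: "s ^ (n - i) * t ^ i = c * (s' ^ (n - i) * t' ^ i)" if "i \<le> n" for i
  proof -
    have "veronese n s t $ i = (c \<cdot>\<^sub>v veronese n s' t') $ i" using eq by simp
    thus ?thesis using that by (simp add: veronese_def)
  qed
  from n obtain k where k: "n = Suc k" by (cases n) auto
  have e0: "s ^ n = c * s' ^ n" using e[of 0] by simp
  have e1: "s ^ k * t = c * (s' ^ k * t')" using e[of 1] k by simp
  show ?thesis
  proof (cases "s' = 0")
    case True
    hence "s ^ n = 0" using e0 n by simp
    thus ?thesis using True by simp
  next
    case False
    hence "s \<noteq> 0" using e0 c n by (auto simp: power_0_left)
    have "s ^ n * (s' ^ k * t') * c = c * s' ^ n * (s ^ k * t)"
      using e0 e1 by simp
    hence "(c * s ^ k * s' ^ k) * (s * t') = (c * s ^ k * s' ^ k) * (t * s')"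
      by (simp add: k mult_ac)
    thus ?thesis using c False \<open>s \<noteq> 0\<close> by simp
  qed
qed

text \<open>If the root is not [0 : 1], the form keeps degree \<open>n\<close> in the chart and
  splits completely over its only root. If it is [0 : 1], the dehomogenised polynomial has no root
  at all and is constant by the fundamental theorem of algebra.\<close>

lemma binary_form_single_root:
  fixes u :: "nat \<Rightarrow> complex"
  assumes n: "n \<ge> 1" and pq: "(p, q) \<noteq> (0, 0)"
    and root: "(\<Sum>i\<le>n. u i * (p ^ (n - i) * q ^ i)) = 0"
    and only: "\<And>s t. (s, t) \<noteq> (0, 0) \<Longrightarrow> (\<Sum>i\<le>n. u i * (s ^ (n - i) * t ^ i)) = 0 \<Longrightarrow> s * q = t * p"
  obtains \<kappa> where "\<kappa> \<noteq> 0" "\<And>s t. (\<Sum>i\<le>n. u i * (s ^ (n - i) * t ^ i)) = \<kappa> * (q * s - p * t) ^ n"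
proof -
  define P where "P = (\<Sum>i\<le>n. monom (u i) i)"
  have cP: "coeff P i = (if i \<le> n then u i else 0)" for i
    by (auto simp: P_def coeff_sum coeff_monom)
  have dP: "degree P \<le> n" by (rule degree_le) (simp add: cP)
  have polyP: "poly P t = (\<Sum>i\<le>n. u i * (1 ^ (n - i) * t ^ i))" for t
    by (simp add: P_def poly_sum poly_monom)
  have hom: "(\<Sum>i\<le>n. u i * (s ^ (n - i) * t ^ i)) = s ^ n * poly P (t / s)" if "s \<noteq> 0" for s t
  proof -
    have "s ^ (n - i) * t ^ i = s ^ n * (t / s) ^ i" if "i \<le> n" for i
      using \<open>s \<noteq> 0\<close> that by (simp add: power_divide power_diff)
    thus ?thesis by (simp add: polyP sum_distrib_left mult_ac)
  qed
  have at0: "(\<Sum>i\<le>n. u i * (0 ^ (n - i) * t ^ i)) = u n * t ^ n" for t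
  proof -
    have "(\<Sum>i\<le>n. u i * (0 ^ (n - i) * t ^ i)) = (\<Sum>i\<in>{n}. u i * (0 ^ (n - i) * t ^ i))"
      by (rule sum.mono_neutral_right) auto
    thus ?thesis by simp
  qed
  show ?thesis
  proof (cases "p = 0")
    case False
    \<comment> \<open>[0 : 1] is not a root, so dehomogenising loses no degree.\<close>
    have un: "u n \<noteq> 0" using only[of 0 1] at0[of 1] False by auto
    have deg: "degree P = n" using dP le_degree[of P n] un by (simp add: cP)
    have P0: "P \<noteq> 0" using un cP[of n] by auto
    have roots: "{z. poly P z = 0} = {q / p}"
    proof (intro equalityI subsetI)
      fix z assume "z \<in> {z. poly P z = 0}"
      hence "1 * q = z * p" by (intro only) (auto simp: polyP)
      thus "z \<in> {q / p}" using False by (simp add: field_simps)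
    next
      fix z assume "z \<in> {q / p}"
      thus "z \<in> {z. poly P z = 0}" using root hom[OF False, of q] False by simp
    qed
    have dec: "Polynomial.smult (u n) ([:- (q / p), 1:] ^ order (q / p) P) = P"
      using complex_poly_decompose[of P] by (simp add: roots deg cP)
    have "order (q / p) P = n"
      using arg_cong[OF dec, of degree] un by (simp add: deg degree_power_eq)
    hence Pz: "poly P z = u n * (z - q / p) ^ n" for z
      using arg_cong[OF dec, of "\<lambda>r. poly r z"] by (simp add: poly_power)
    have final: "(\<Sum>i\<le>n. u i * (s ^ (n - i) * t ^ i)) = u n * (- 1 / p) ^ n * (q * s - p * t) ^ n" for s t
    proof -
      have "(- 1 / p) * (q * s - p * t) = t - s * (q / p)" using False by (simp add: field_simps)
      hence r: "u n * (- 1 / p) ^ n * (q * s - p * t) ^ n = u n * (t - s * (q / p)) ^ n"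
        by (simp add: power_mult_distrib[symmetric] mult.assoc)
      show ?thesis
      proof (cases "s = 0")
        case True thus ?thesis unfolding r using at0[of t] by simp
      next
        case False
        have "s ^ n * (t / s - q / p) ^ n = (s * (t / s - q / p)) ^ n" by (simp add: power_mult_distrib)
        also have "s * (t / s - q / p) = t - s * (q / p)" using False by (simp add: right_diff_distrib)
        finally show ?thesis unfolding r hom[OF False] Pz by simp
      qed
    qed
    show ?thesis by (rule that[OF _ final]) (use un False in auto)
  next
    case True
    hence q: "q \<noteq> 0" using pq by auto
    have "poly P t \<noteq> 0" for t
    proof
      assume "poly P t = 0"
      hence "1 * q = t * p" by (intro only) (auto simp: polyP)
      thus False using True q by simp
    qed
    hence "constant (poly P)" using fundamental_theorem_of_algebra by blast
    hence "degree P = 0" by (simp add: constant_degree)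
    hence ui: "u i = 0" if "i \<noteq> 0" "i \<le> n" for i
      using cP[of i] coeff_eq_0[of P i] that by simp
    have final: "(\<Sum>i\<le>n. u i * (s ^ (n - i) * t ^ i)) = u 0 / q ^ n * (q * s - p * t) ^ n" for s t
    proof -
      have "(\<Sum>i\<le>n. u i * (s ^ (n - i) * t ^ i)) = (\<Sum>i\<in>{0}. u i * (s ^ (n - i) * t ^ i))"
        by (rule sum.mono_neutral_right) (auto simp: ui)
      thus ?thesis using True q by (simp add: power_mult_distrib)
    qed
    \<comment> \<open>Otherwise [1 : 0] would be a second root.\<close>
    have "u 0 \<noteq> 0"
    proof
      assume "u 0 = 0"
      hence "1 * q = 0 * p" using final[of 1 0] by (intro only) (simp, simp only: final, simp)
      thus False using q by simp
    qed
    thus ?thesis using q by (intro that[OF _ final]) auto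
  qed
qed

section \<open>The projective line as normalisation of a rational normal curve\<close>

locale normal_curve =
  fixes n :: nat and A B :: "complex mat"
  assumes n: "n \<ge> 1"
    and A: "A \<in> carrier_mat (n + 1) (n + 1)" and B: "B \<in> carrier_mat (n + 1) (n + 1)"
    and AB: "A * B = 1\<^sub>m (n + 1)" and BA: "B * A = 1\<^sub>m (n + 1)"
begin

definition G :: "complex vec \<Rightarrow> complex vec" where
  "G v = A *\<^sub>v veronese n (v $ 0) (v $ 1)"

text \<open>The choice of representative does not matter: rescaling it by \<open>c\<close> rescales
  \<open>G\<close> by \<open>c ^ n\<close>, see \<open>G_scale\<close>.\<close>

definition g :: "complex vec set \<Rightarrow> complex vec set" where
  "g x = proj_pt (G (SOME v. v \<in> x))"

definition curve :: "complex vec set set" where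
  "curve = {proj_pt (A *\<^sub>v veronese n s t) | s t. (s, t) \<noteq> (0, 0)}"

lemma G_vec2: "G (vec2 s t) = A *\<^sub>v veronese n s t"
  by (simp add: G_def)

lemma G_carrier [simp]: "G v \<in> carrier_vec (n + 1)" "G v \<in> carrier_vec (Suc n)"
  using A by (simp_all add: G_def)

lemma BG: "B *\<^sub>v G (vec2 s t) = veronese n s t"
proof -
  have "B *\<^sub>v (A *\<^sub>v veronese n s t) = (B * A) *\<^sub>v veronese n s t"
    by (rule assoc_mult_mat_vec[symmetric, OF B A]) simp
  thus ?thesis by (simp add: G_vec2 BA)
qed

lemma G_nonzero: "(s, t) \<noteq> (0, 0) \<Longrightarrow> G (vec2 s t) \<noteq> 0\<^sub>v (n + 1)"
proof
  assume st: "(s, t) \<noteq> (0, 0)" and "G (vec2 s t) = 0\<^sub>v (n + 1)"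
  hence "veronese n s t = B *\<^sub>v 0\<^sub>v (n + 1)" using BG[of s t] by simp
  also have "\<dots> = 0\<^sub>v (n + 1)" using B by auto
  finally show False using veronese_nonzero[OF st] by simp
qed

lemma G_scale: "G (vec2 (c * s) (c * t)) = c ^ n \<cdot>\<^sub>v G (vec2 s t)"
  unfolding G_vec2 veronese_scale by (rule mult_mat_vec[OF A]) simp

lemma g_vec2:
  assumes "(s, t) \<noteq> (0, 0)"
  shows "g (proj_pt (vec2 s t)) = proj_pt (G (vec2 s t))"
proof -
  have "(SOME v. v \<in> proj_pt (vec2 s t)) \<in> proj_pt (vec2 s t)"
    by (rule someI[of "\<lambda>v. v \<in> proj_pt (vec2 s t)", OF proj_pt_self])
  then obtain c where c: "c \<noteq> 0" "(SOME v. v \<in> proj_pt (vec2 s t)) = vec2 (c * s) (c * t)"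
    by (auto simp: proj_pt_def smult_vec2)
  have "c ^ n \<noteq> 0" using c(1) by simp
  thus ?thesis by (simp only: g_def c(2) G_scale proj_pt_smult[OF \<open>c ^ n \<noteq> 0\<close>])
qed

lemma G_inj:
  assumes "proj_pt (G (vec2 s t)) = proj_pt (G (vec2 s' t'))"
  shows "s * t' = t * s'"
proof -
  from proj_pt_eqD[OF assms] obtain c where c: "c \<noteq> 0" "G (vec2 s t) = c \<cdot>\<^sub>v G (vec2 s' t')" by blast
  have "veronese n s t = B *\<^sub>v (c \<cdot>\<^sub>v G (vec2 s' t'))" using BG[of s t] c(2) by simp
  also have "\<dots> = c \<cdot>\<^sub>v veronese n s' t'"
    by (subst mult_mat_vec[OF B]) (simp_all add: BG)
  finally show ?thesis using veronese_proportional[OF n _ c(1)] by blast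
qed

lemma inj_g: "inj_on g (proj_space 1)"
proof (rule inj_onI)
  fix x y assume "x \<in> proj_space 1" "y \<in> proj_space 1" and eq: "g x = g y"
  then obtain s t s' t' where st: "(s, t) \<noteq> (0, 0)" "x = proj_pt (vec2 s t)"
    "(s', t') \<noteq> (0, 0)" "y = proj_pt (vec2 s' t')" by (metis proj_space_1E)
  thus "x = y" using eq G_inj[of s t s' t'] by (simp add: g_vec2 proj_pt_vec2_eq_iff)
qed

lemma hom_map_G: "hom_map 1 n n G"
  unfolding hom_map_def
proof (intro conjI ballI allI impI)
  fix i assume i: "i \<le> n"
  have "hom_form 1 n (\<lambda>v. \<Sum>j\<le>n. A $$ (i, j) * (v $ 0 ^ (n - j) * v $ 1 ^ j))"
  proof (intro hom_form_sum hom_form_cmult)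
    fix j assume "j \<in> {..n}"
    hence "(n - j) * 1 + j * 1 = n" by simp
    moreover have "hom_form 1 ((n - j) * 1 + j * 1) (\<lambda>v. v $ 0 ^ (n - j) * v $ 1 ^ j)"
      by (intro hom_form_mult hom_form_power hom_form_coord) auto
    ultimately show "hom_form 1 n (\<lambda>v. v $ 0 ^ (n - j) * v $ 1 ^ j)" by metis
  qed
  moreover have "G v $ i = (\<Sum>j\<le>n. A $$ (i, j) * (v $ 0 ^ (n - j) * v $ 1 ^ j))" for v
    using A i by (simp add: G_def scalar_prod_def veronese_def lessThan_Suc_atMost[symmetric]
        lessThan_atLeast0 del: sum.op_ivl_Suc)
  ultimately show "hom_form 1 n (\<lambda>v. G v $ i)" by presburger
qed simp

lemma g_image: "g ` proj_space 1 = curve"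
proof (intro equalityI subsetI)
  fix y assume "y \<in> g ` proj_space 1"
  then obtain s t where "(s, t) \<noteq> (0, 0)" "y = g (proj_pt (vec2 s t))" by (metis imageE proj_space_1E)
  thus "y \<in> curve" unfolding curve_def by (auto simp: g_vec2 G_vec2)
next
  fix y assume "y \<in> curve"
  then obtain s t where st: "(s, t) \<noteq> (0, 0)" "y = g (proj_pt (vec2 s t))"
    unfolding curve_def by (auto simp: g_vec2 G_vec2)
  thus "y \<in> g ` proj_space 1" using proj_pt_vec2_in by blast
qed

lemma regular_map_g: "regular_map 1 (proj_space 1) n g"
  unfolding regular_map_def
proof (intro conjI ballI)
  show "g ` proj_space 1 \<subseteq> proj_space n"
  proof
    fix y assume "y \<in> g ` proj_space 1"
    then obtain s t where st: "(s, t) \<noteq> (0, 0)" "y = g (proj_pt (vec2 s t))" by (metis imageE proj_space_1E)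
    thus "y \<in> proj_space n" using proj_pt_in_proj_space[OF G_carrier(1) G_nonzero[OF st(1)]] g_vec2 by simp
  qed
  have *: "G v \<noteq> 0\<^sub>v (n + 1) \<and> g x = proj_pt (G v)" if "x \<in> proj_space 1 - {}" "v \<in> x" for x v
  proof -
    obtain s t where st: "(s, t) \<noteq> (0, 0)" "x = proj_pt (vec2 s t)" using \<open>x \<in> proj_space 1 - {}\<close> by (metis Diff_empty proj_space_1E)
    with \<open>v \<in> x\<close> obtain c where c: "c \<noteq> 0" "v = vec2 (c * s) (c * t)" by (auto simp: proj_pt_def smult_vec2)
    have "(c * s, c * t) \<noteq> (0, 0)" using st c by auto
    hence "G v \<noteq> 0\<^sub>v (n + 1)" unfolding c(2) by (rule G_nonzero)
    moreover have "g x = proj_pt (G v)"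
      using c(1) st proj_pt_smult[of "c ^ n" "G (vec2 s t)"] by (simp add: c(2) G_scale g_vec2)
    ultimately show ?thesis by blast
  qed
  fix a assume "a \<in> proj_space 1"
  show "\<exists>d G Z. hom_map 1 n d G \<and> zariski_closed 1 Z \<and> a \<notin> Z \<and>
        (\<forall>x\<in>proj_space 1 - Z. \<forall>v\<in>x. G v \<noteq> 0\<^sub>v (n + 1) \<and> g x = proj_pt (G v))"
    by (rule exI[of _ n], rule exI[of _ G], rule exI[of _ "{}"])
      (intro conjI hom_map_G zariski_closed_empty ballI; (use * in blast)?)
qed

text \<open>The first two Veronese coordinates are \<open>s ^ (n - 1)\<close> times \<open>s\<close>
  and \<open>t\<close>, so \<open>B\<close> followed by the projection to them inverts
  \<open>g\<close> where \<open>s \<noteq> 0\<close>.\<close>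

lemma birational_g: "birational_onto_image 1 (proj_space 1) n g"
proof -
  define H where "H = (\<lambda>w. vec2 ((B *\<^sub>v w) $ 0) ((B *\<^sub>v w) $ 1))"
  have "hom_form n 1 (\<lambda>w. H w $ i)" if "i \<le> 1" for i
  proof -
    have "hom_form n 1 (\<lambda>w. \<Sum>j\<le>n. B $$ (i, j) * w $ j)"
      by (intro hom_form_sum hom_form_cmult hom_form_coord) auto
    moreover have "H w $ i = (\<Sum>j\<le>n. B $$ (i, j) * w $ j)" if w: "w \<in> carrier_vec (n + 1)" for w
    proof -
      have "(B *\<^sub>v w) $ i = (\<Sum>j\<le>n. B $$ (i, j) * w $ j)"
        using \<open>i \<le> 1\<close> n B w by (simp add: scalar_prod_def lessThan_Suc_atMost[symmetric]
            lessThan_atLeast0 del: sum.op_ivl_Suc)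
      thus ?thesis using \<open>i \<le> 1\<close> by (cases "i = 0") (auto simp: H_def le_Suc_eq)
    qed
    ultimately show ?thesis
      by (subst hom_form_cong[of n _ "\<lambda>w. \<Sum>j\<le>n. B $$ (i, j) * w $ j"])
  qed
  hence H: "hom_map n 1 1 H" by (auto simp: hom_map_def H_def)
  define Z where "Z = hypersurface 1 (\<lambda>v. v $ 0)"
  have Z: "proj_pt (vec2 s t) \<in> Z \<longleftrightarrow> s = 0" if "(s, t) \<noteq> (0, 0)" for s t
    unfolding Z_def using hypersurface_mem_iff[OF hom_form_coord[of 0 1] vec2_carrier vec2_nonzero[OF that]] by simp
  have "zariski_closed 1 Z" unfolding Z_def
    by (rule zariski_closed_hypersurface[OF hom_form_coord]) simp
  moreover have "\<not> proj_space 1 \<subseteq> Z" using Z[of 1 0] proj_pt_vec2_in[of 1 0] by auto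
  moreover have "H w \<noteq> 0\<^sub>v (1 + 1) \<and> proj_pt (H w) = x" if x: "x \<in> proj_space 1 - Z" and w: "w \<in> g x" for x w
  proof -
    obtain s t where st: "(s, t) \<noteq> (0, 0)" "x = proj_pt (vec2 s t)" using x by (metis DiffD1 proj_space_1E)
    hence s: "s \<noteq> 0" using x Z[OF st(1)] by auto
    have "w \<in> proj_pt (G (vec2 s t))" using w st by (simp add: g_vec2)
    then obtain c where c: "c \<noteq> 0" "w = c \<cdot>\<^sub>v G (vec2 s t)" by (auto simp: proj_pt_def)
    have Bw: "B *\<^sub>v w = c \<cdot>\<^sub>v veronese n s t"
      unfolding c(2) by (subst mult_mat_vec[OF B]) (simp_all add: BG)
    have "s ^ n = s ^ (n - 1) * s" using n by (metis One_nat_def Suc_pred' less_eq_Suc_le power_Suc2)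
    hence Hw: "H w = (c * s ^ (n - 1)) \<cdot>\<^sub>v vec2 s t"
      using n by (simp add: H_def Bw veronese_def smult_vec2)
    have "c * s ^ (n - 1) \<noteq> 0" using c s by simp
    thus ?thesis unfolding Hw st(2)
      using proj_pt_smult smult_vec_nonzero[OF _ vec2_carrier vec2_nonzero[OF st(1)]] by blast
  qed
  ultimately show ?thesis
    unfolding birational_onto_image_def using H
    by (intro exI[of _ "1::nat"] exI[of _ H] exI[of _ Z] conjI ballI) auto
qed

lemma normalisation_curve: "normalisation 1 (proj_space 1) n g curve"
  unfolding normalisation_def
  using smooth_curve_1 regular_map_g birational_g g_image by blast

lemma linear_form_G:
  assumes h: "h \<in> carrier_vec (n + 1)"
  shows "linear_form h (G (vec2 s t)) = (\<Sum>i\<le>n. (transpose_mat A *\<^sub>v h) $ i * (s ^ (n - i) * t ^ i))"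
proof -
  have "linear_form h (G (vec2 s t)) = (transpose_mat A *\<^sub>v h) \<bullet> veronese n s t"
    unfolding linear_form_def G_vec2
    using transpose_vec_mult_scalar[OF A veronese_carrier(1) h, of s t] h A
    by (metis comm_scalar_prod mult_mat_vec_carrier transpose_carrier_mat veronese_carrier(1))
  also have "\<dots> = (\<Sum>i\<le>n. (transpose_mat A *\<^sub>v h) $ i * veronese n s t $ i)"
    by (simp add: scalar_prod_def lessThan_Suc_atMost[symmetric] lessThan_atLeast0 veronese_def
      del: sum.op_ivl_Suc)
  finally show ?thesis by (simp add: veronese_index)
qed

lemma curve_hyperplane:
  assumes h: "h \<in> carrier_vec (n + 1)" and \<kappa>: "\<kappa> \<noteq> 0" and pq: "(p, q) \<noteq> (0, 0)"
    and F: "\<And>s t. linear_form h (G (vec2 s t)) = \<kappa> * (q * s - p * t) ^ n"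
  shows "x \<in> proj_space 1 \<Longrightarrow> g x \<in> hyperplane n h \<longleftrightarrow> x = proj_pt (vec2 p q)"
    and "curve \<inter> hyperplane n h = {g (proj_pt (vec2 p q))}"
proof -
  show *: "g x \<in> hyperplane n h \<longleftrightarrow> x = proj_pt (vec2 p q)" if x: "x \<in> proj_space 1" for x
  proof -
    obtain s t where st: "(s, t) \<noteq> (0, 0)" "x = proj_pt (vec2 s t)" using x by (rule proj_space_1E)
    have "g x \<in> hyperplane n h \<longleftrightarrow> linear_form h (G (vec2 s t)) = 0"
      using proj_pt_mem_hyperplane_iff[OF h G_carrier(1) G_nonzero[OF st(1)]] st by (simp add: g_vec2)
    also have "\<dots> \<longleftrightarrow> s * q = t * p" using F \<kappa> n by (auto simp: mult_ac)
    also have "\<dots> \<longleftrightarrow> x = proj_pt (vec2 p q)" using proj_pt_vec2_eq_iff[OF st(1) pq] st(2) by simp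
    finally show ?thesis .
  qed
  show "curve \<inter> hyperplane n h = {g (proj_pt (vec2 p q))}"
    using * proj_pt_vec2_in[OF pq] unfolding g_image[symmetric] by auto
qed

text \<open>As \<open>g\<close> is injective, the pulled-back form vanishes only at the parameter of
  the contact point, and \<open>binary_form_single_root\<close> applies.\<close>

lemma single_contact:
  assumes h: "h \<in> carrier_vec (n + 1)" and sing: "is_singleton (curve \<inter> hyperplane n h)"
  obtains p q \<kappa> where "(p, q) \<noteq> (0, 0)" "\<kappa> \<noteq> 0"
    "\<And>s t. linear_form h (G (vec2 s t)) = \<kappa> * (q * s - p * t) ^ n"
proof -
  obtain y where y: "curve \<inter> hyperplane n h = {y}" using sing by (auto simp: is_singleton_def)
  have "y \<in> g ` proj_space 1" using y g_image by blast
  then obtain p q where pq: "(p, q) \<noteq> (0, 0)" "y = g (proj_pt (vec2 p q))" by (metis imageE proj_space_1E)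
  have zero: "linear_form h (G (vec2 s t)) = 0 \<longleftrightarrow> s * q = t * p" if st: "(s, t) \<noteq> (0, 0)" for s t
  proof -
    have "linear_form h (G (vec2 s t)) = 0 \<longleftrightarrow> g (proj_pt (vec2 s t)) \<in> hyperplane n h"
      using proj_pt_mem_hyperplane_iff[OF h G_carrier(1) G_nonzero[OF st]] st by (simp add: g_vec2)
    also have "\<dots> \<longleftrightarrow> g (proj_pt (vec2 s t)) = y"
      using y g_image proj_pt_vec2_in[OF st] by blast
    also have "\<dots> \<longleftrightarrow> proj_pt (vec2 s t) = proj_pt (vec2 p q)"
      unfolding pq(2) using inj_on_eq_iff[OF inj_g proj_pt_vec2_in[OF st] proj_pt_vec2_in[OF pq(1)]] .
    finally show ?thesis using proj_pt_vec2_eq_iff[OF st pq(1)] by simp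
  qed
  define u where "u = (\<lambda>i. (transpose_mat A *\<^sub>v h) $ i)"
  note lf = linear_form_G[OF h, folded u_def]
  have r1: "(\<Sum>i\<le>n. u i * (p ^ (n - i) * q ^ i)) = 0"
    using zero[OF pq(1)] lf by (simp add: mult.commute)
  have r2: "s * q = t * p" if "(s, t) \<noteq> (0, 0)" "(\<Sum>i\<le>n. u i * (s ^ (n - i) * t ^ i)) = 0" for s t
    using zero[OF that(1)] that(2) lf by simp
  show ?thesis
  proof (rule binary_form_single_root[OF n pq(1) r1 r2])
    fix \<kappa> assume "\<kappa> \<noteq> 0" "\<And>s t. (\<Sum>i\<le>n. u i * (s ^ (n - i) * t ^ i)) = \<kappa> * (q * s - p * t) ^ n"
    thus ?thesis using that[OF pq(1), of \<kappa>] lf by simp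
  qed
qed

text \<open>A rational normal curve spans the whole space: the pulled-back form vanishes at [1 : i]
  for \<open>i = 0, ..., n\<close>, so all its coefficients are 0, and invertibility of
  \<open>A\<close> carries this over to \<open>h\<close>.\<close>

lemma linear_form_G_zero:
  assumes h: "h \<in> carrier_vec (n + 1)" and z: "\<And>s t. linear_form h (G (vec2 s t)) = 0"
    and w: "w \<in> carrier_vec (n + 1)"
  shows "linear_form h w = 0"
proof -
  have "(transpose_mat A *\<^sub>v h) $ k = 0" if "k < n + 1" for k
  proof (rule poly_coeffs_zero[where n = "n + 1" and b = of_nat])
    fix i :: nat
    show "(\<Sum>k<n + 1. (transpose_mat A *\<^sub>v h) $ k * complex_of_nat i ^ k) = 0"
      using z[of 1 "of_nat i"] unfolding linear_form_G[OF h] by (simp add: lessThan_Suc_atMost)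
  qed (use that in \<open>auto simp: inj_on_def\<close>)
  hence 0: "transpose_mat A *\<^sub>v h = 0\<^sub>v (n + 1)" using A by (intro eq_vecI) auto
  have "w = (A * B) *\<^sub>v w" using w by (simp add: AB)
  also have "\<dots> = A *\<^sub>v (B *\<^sub>v w)" by (rule assoc_mult_mat_vec[OF A B w])
  finally have "linear_form h w = h \<bullet> (A *\<^sub>v (B *\<^sub>v w))" by (simp add: linear_form_def)
  also have "\<dots> = (transpose_mat A *\<^sub>v h) \<bullet> (B *\<^sub>v w)"
    using transpose_vec_mult_scalar[OF A _ h, of "B *\<^sub>v w"] A B h w
    by (metis comm_scalar_prod mult_mat_vec_carrier transpose_carrier_mat)
  also have "\<dots> = 0" unfolding 0 using B w by (intro scalar_prod_left_zero) simp
  finally show ?thesis .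
qed

end

section \<open>Hyperplanes in general position\<close>

text \<open>A nonzero such vector would represent a common point of \<open>n + 1\<close>
  hyperplanes.\<close>

lemma general_position_kernel:
  assumes gp: "general_position n J h" and h: "\<And>j. j \<in> J \<Longrightarrow> h j \<in> carrier_vec (n + 1)"
    and I: "I \<subseteq> J" "card I = n + 1" and v: "v \<in> carrier_vec (n + 1)"
    and z: "\<And>j. j \<in> I \<Longrightarrow> linear_form (h j) v = 0"
  shows "v = 0\<^sub>v (n + 1)"
proof (rule ccontr)
  assume nz: "v \<noteq> 0\<^sub>v (n + 1)"
  have "proj_pt v \<in> hyperplane n (h j)" if "j \<in> I" for j
    using proj_pt_mem_hyperplane_iff[OF h v nz] z I(1) that by blast
  hence "proj_pt v \<in> (\<Inter>j\<in>I. hyperplane n (h j))" by blast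
  moreover have "(\<Inter>j\<in>I. hyperplane n (h j)) = {}" using gp I unfolding general_position_def by blast
  ultimately show False by simp
qed

text \<open>The dual basis consists of the columns of the inverse of the matrix whose rows are the
  forms.\<close>

lemma general_position_dual:
  assumes gp: "general_position n J h" and h: "\<And>j. j \<in> J \<Longrightarrow> h j \<in> carrier_vec (n + 1)"
    and I: "I \<subseteq> J" "card I = n + 1"
  obtains w where "\<And>i. i \<in> I \<Longrightarrow> w i \<in> carrier_vec (n + 1)"
    "\<And>i j. i \<in> I \<Longrightarrow> j \<in> I \<Longrightarrow> linear_form (h j) (w i) = (if i = j then 1 else 0)"
proof -
  have "finite I" using I(2) by (metis card.infinite Suc_eq_plus1 nat.distinct(1))
  then obtain e where e: "bij_betw e {0..<n + 1} I"
    using ex_bij_betw_nat_finite[of I] I(2) by auto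
  define M where "M = mat (n + 1) (n + 1) (\<lambda>(r, c). h (e r) $ c)"
  have M: "M \<in> carrier_mat (n + 1) (n + 1)" by (simp add: M_def)
  have eI: "e r \<in> I" if "r < n + 1" for r using bij_betwE[OF e] that by simp
  have rowM: "row M r = h (e r)" if "r < n + 1" for r
    using h[of "e r"] eI[OF that] I(1) that by (intro eq_vecI) (auto simp: M_def)
  have "v = 0\<^sub>v (n + 1)" if v: "v \<in> carrier_vec (n + 1)" "M *\<^sub>v v = 0\<^sub>v (n + 1)" for v
  proof (rule general_position_kernel[OF gp h I v(1)])
    fix j assume "j \<in> I"
    then obtain r where r: "r < n + 1" "j = e r" using e by (auto simp: bij_betw_def)
    have "(M *\<^sub>v v) $ r = 0" using v(2) r(1) by simp
    thus "linear_form (h j) v = 0" using M r rowM[OF r(1)] by (simp add: linear_form_def)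
  qed
  then obtain B where B: "B \<in> carrier_mat (n + 1) (n + 1)" "M * B = 1\<^sub>m (n + 1)"
    using trivial_kernel_imp_inverse[OF M] by blast
  define w where "w = (\<lambda>i. col B (the_inv_into {0..<n + 1} e i))"
  show ?thesis
  proof (rule that)
    show "w i \<in> carrier_vec (n + 1)" for i using B(1) by (simp add: w_def col_def)
    fix i j assume "i \<in> I" "j \<in> I"
    then obtain l r where l: "l < n + 1" "i = e l" and r: "r < n + 1" "j = e r"
      using e by (fastforce simp: bij_betw_def)
    have inj: "inj_on e {0..<n + 1}" using e by (simp add: bij_betw_def)
    have "w i = col B l" using the_inv_into_f_f[OF inj, of l] l by (simp add: w_def)
    hence "linear_form (h j) (w i) = (M * B) $$ (r, l)"
      using rowM[OF r(1)] r l B(1) M by (simp add: linear_form_def)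
    also have "\<dots> = (if i = j then 1 else 0)"
      using B(2) l r inj by (auto simp: inj_on_eq_iff)
    finally show "linear_form (h j) (w i) = (if i = j then 1 else 0)" .
  qed
qed

section \<open>Contact points and degrees of a given curve\<close>

context normal_curve
begin

text \<open>Distinctness is the main point: if \<open>a i = a j\<close>, the two forms pull back to
  proportional \<open>n\<close>-th powers, so a combination of them vanishes on the curve and hence
  identically. A dual basis for \<open>n + 1\<close> of the forms, including these two, rules this
  out.\<close>

lemma contact_points:
  assumes h: "\<And>j. j \<le> n + 1 \<Longrightarrow> h j \<in> carrier_vec (n + 1)"
    and gp: "general_position n {..n + 1} h"
    and sing: "\<And>j. j \<le> n + 1 \<Longrightarrow> is_singleton (curve \<inter> hyperplane n (h j))"
  obtains a where "inj_on a {..n + 1}" "a ` {..n + 1} \<subseteq> proj_space 1"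
    "\<And>j x. j \<le> n + 1 \<Longrightarrow> x \<in> proj_space 1 \<Longrightarrow> g x \<in> hyperplane n (h j) \<longleftrightarrow> x = a j"
    "\<And>j. j \<le> n + 1 \<Longrightarrow> contact_order 1 (proj_space 1) n g (linear_form (h j)) (a j) = int n"
proof -
  have "\<forall>j. \<exists>p q \<kappa>. j \<le> n + 1 \<longrightarrow> (p, q) \<noteq> (0, 0) \<and> \<kappa> \<noteq> 0 \<and>
      (\<forall>s t. linear_form (h j) (G (vec2 s t)) = \<kappa> * (q * s - p * t) ^ n)"
  proof
    fix j
    show "\<exists>p q \<kappa>. j \<le> n + 1 \<longrightarrow> (p, q) \<noteq> (0, 0) \<and> \<kappa> \<noteq> 0 \<and>
      (\<forall>s t. linear_form (h j) (G (vec2 s t)) = \<kappa> * (q * s - p * t) ^ n)"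
    proof (cases "j \<le> n + 1")
      case True
      show ?thesis by (rule single_contact[OF h[OF True] sing[OF True]]) blast
    qed blast
  qed
  then obtain p q \<kappa> where pq: "\<And>j. j \<le> n + 1 \<Longrightarrow> (p j, q j) \<noteq> (0, 0)"
    and \<kappa>: "\<And>j. j \<le> n + 1 \<Longrightarrow> \<kappa> j \<noteq> 0"
    and F: "\<And>j s t. j \<le> n + 1 \<Longrightarrow> linear_form (h j) (G (vec2 s t)) = \<kappa> j * (q j * s - p j * t) ^ n"
    by metis
  define a where "a = (\<lambda>j. proj_pt (vec2 (p j) (q j)))"
  show ?thesis
  proof (rule that)
    show "a ` {..n + 1} \<subseteq> proj_space 1" using pq proj_pt_vec2_in by (auto simp: a_def)
    show "g x \<in> hyperplane n (h j) \<longleftrightarrow> x = a j" if "j \<le> n + 1" "x \<in> proj_space 1" for j x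
      unfolding a_def using curve_hyperplane(1)[OF h \<kappa> pq F] that by blast
    show "contact_order 1 (proj_space 1) n g (linear_form (h j)) (a j) = int n" if j: "j \<le> n + 1" for j
      unfolding a_def
      by (rule contact_order_1[OF hom_map_G G_nonzero g_vec2 linear_form_smult[OF h[OF j]] F[OF j] \<kappa>[OF j] pq[OF j]])
    show "inj_on a {..n + 1}"
    proof (rule inj_onI, rule ccontr)
      fix i j assume ij: "i \<in> {..n + 1}" "j \<in> {..n + 1}" "a i = a j" "i \<noteq> j"
      have "proj_pt (vec2 (p i) (q i)) = proj_pt (vec2 (p j) (q j))" using ij(3) by (simp add: a_def)
      from proj_pt_eqD[OF this] obtain c where c: "c \<noteq> 0" "p i = c * p j" "q i = c * q j"
        by (auto simp: smult_vec2)
      have hi: "h i \<in> carrier_vec (n + 1)" and hj: "h j \<in> carrier_vec (n + 1)" using h ij by auto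
      \<comment> \<open>The factor for which the two \<open>n\<close>-th powers cancel.\<close>
      define k where "k = \<kappa> j / (\<kappa> i * c ^ n)"
      define f where "f = h j - k \<cdot>\<^sub>v h i"
      have f: "f \<in> carrier_vec (n + 1)" using hi hj by (simp add: f_def)
      have lf: "linear_form f v = linear_form (h j) v - k * linear_form (h i) v" if "v \<in> carrier_vec (n + 1)" for v
        using hi hj that by (simp add: f_def linear_form_def minus_scalar_prod_distrib[of _ "n + 1"])
      have "linear_form f (G (vec2 s t)) = 0" for s t
      proof -
        have "q i * s - p i * t = c * (q j * s - p j * t)" by (simp add: c algebra_simps)
        thus ?thesis using F[of i] F[of j] ij c(1) \<kappa>[of i]
          by (simp add: lf[OF G_carrier(1)] k_def power_mult_distrib)
      qed
      note zero = linear_form_G_zero[OF f this]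
      \<comment> \<open>The pair is completed to \<open>n + 1\<close> indices by
        \<open>n - 1\<close> further ones.\<close>
      obtain I where I: "I \<subseteq> {..n + 1}" "card I = n + 1" "{i, j} \<subseteq> I"
      proof -
        have "card ({..n + 1} - {i, j}) = n" using ij by (subst card_Diff_subset) auto
        then obtain S where S: "S \<subseteq> {..n + 1} - {i, j}" "card S = n - 1"
          by (metis diff_le_self obtain_subset_with_card_n)
        have "card ({i, j} \<union> S) = n + 1"
          using S ij n finite_subset[OF S(1)] by (subst card_Un_disjoint) auto
        thus ?thesis using S ij by (intro that[of "{i, j} \<union> S"]) auto
      qed
      obtain w where w: "\<And>i. i \<in> I \<Longrightarrow> w i \<in> carrier_vec (n + 1)"
        "\<And>i j. i \<in> I \<Longrightarrow> j \<in> I \<Longrightarrow> linear_form (h j) (w i) = (if i = j then 1 else 0)"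
        by (rule general_position_dual[OF gp _ I(1,2)]) (use h in auto)
      have "linear_form f (w j) = 1"
        using w(1)[of j] w(2)[of j j] w(2)[of j i] I(3) ij(4) by (simp add: lf)
      thus False using zero[of "w j"] w(1)[of j] I(3) by simp
    qed
  qed
qed

text \<open>Otherwise the curve, an injective image of an infinite set, would be a finite union of
  single points.\<close>

lemma curve_not_subset_support:
  assumes "\<And>j. j \<le> n + 1 \<Longrightarrow> is_singleton (curve \<inter> hyperplane n (h j))"
  shows "\<not> curve \<subseteq> orbifold_support n {..n + 1} (\<lambda>j. linear_form (h j))"
proof
  assume sub: "curve \<subseteq> orbifold_support n {..n + 1} (\<lambda>j. linear_form (h j))"
  have "finite (curve \<inter> hyperplane n (h j))" if "j \<le> n + 1" for j
    using assms[OF that] by (auto simp: is_singleton_def)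
  hence "finite (\<Union>j\<in>{..n + 1}. curve \<inter> hyperplane n (h j))"
    by (intro finite_UN_I finite_atMost) simp
  moreover have "curve \<subseteq> (\<Union>j\<in>{..n + 1}. curve \<inter> hyperplane n (h j))"
    using sub by (auto simp: orbifold_support_def hyperplane_def)
  ultimately have "finite (g ` proj_space 1)" unfolding g_image by (rule finite_subset[rotated])
  thus False using finite_imageD[OF _ inj_g] infinite_proj_space_1 by blast
qed

text \<open>Each contact point lies on exactly one hyperplane, so every maximum runs over one
  element: \<open>m j / n\<close> in the virtual case and
  \<open>max 1 (m j / n) = max (m j) n / n\<close> in the other.\<close>

lemma orbifold_degrees:
  assumes h: "\<And>j. j \<le> n + 1 \<Longrightarrow> h j \<in> carrier_vec (n + 1)"
    and gp: "general_position n {..n + 1} h"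
    and sing: "\<And>j. j \<le> n + 1 \<Longrightarrow> is_singleton (curve \<inter> hyperplane n (h j))"
  shows "log_canonical_degree_is 1 (proj_space 1)
      (virtual_orb_mult 1 (proj_space 1) n g {..n + 1} (\<lambda>j. linear_form (h j)) m)
      (real n * (1 - (\<Sum>j\<le>n + 1. 1 / real (m j))))" (is ?virtual)
    and "log_canonical_degree_is 1 (proj_space 1)
      (orb_mult 1 (proj_space 1) n g {..n + 1} (\<lambda>j. linear_form (h j)) m)
      (real n * (1 - (\<Sum>j\<le>n + 1. 1 / real (max (m j) n))))" (is ?honest)
proof -
  obtain a where a: "inj_on a {..n + 1}" "a ` {..n + 1} \<subseteq> proj_space 1"
    and mem: "\<And>j x. j \<le> n + 1 \<Longrightarrow> x \<in> proj_space 1 \<Longrightarrow> g x \<in> hyperplane n (h j) \<longleftrightarrow> x = a j"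
    and co: "\<And>j. j \<le> n + 1 \<Longrightarrow> contact_order 1 (proj_space 1) n g (linear_form (h j)) (a j) = int n"
    by (rule contact_points[OF h gp sing]) auto
  have Ja: "{j \<in> {..n + 1}. g x \<in> hypersurface n (linear_form (h j))} = {j. j \<le> n + 1 \<and> x = a j}"
    if "x \<in> proj_space 1" for x
    using mem[OF _ that] by (auto simp: hyperplane_def)
  have Ja1: "{i. i \<le> n + 1 \<and> a j = a i} = {j}" if "j \<le> n + 1" for j
    using inj_onD[OF a(1), of j] that by auto
  have aP: "a j \<in> proj_space 1" if "j \<le> n + 1" for j using a(2) that by auto
  have Ja0: "{j. j \<le> n + 1 \<and> x = a j} = {}" if "x \<in> proj_space 1 - a ` {..n + 1}" for x
    using that by auto
  have "log_canonical_degree_is 1 (proj_space 1)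
      (virtual_orb_mult 1 (proj_space 1) n g {..n + 1} (\<lambda>j. linear_form (h j)) m)
      (real (n + 1) - 1 - (\<Sum>j\<le>n + 1. 1 / (real (m j) / real n)))"
  proof (rule log_canonical_degree_1[OF a])
    show "virtual_orb_mult 1 (proj_space 1) n g {..n + 1} (\<lambda>j. linear_form (h j)) m (a j) =
        real (m j) / real n" if "j \<le> n + 1" for j
      unfolding virtual_orb_mult_def Let_def Ja[OF aP[OF that]] Ja1[OF that] using co[OF that] by simp
    show "virtual_orb_mult 1 (proj_space 1) n g {..n + 1} (\<lambda>j. linear_form (h j)) m x = 1"
      if "x \<in> proj_space 1 - a ` {..n + 1}" for x
      unfolding virtual_orb_mult_def Let_def using Ja[of x] Ja0[OF that] that by simp
  qed
  thus ?virtual by (simp add: sum_distrib_left right_diff_distrib del: sum.atMost_Suc)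
  have "log_canonical_degree_is 1 (proj_space 1)
      (orb_mult 1 (proj_space 1) n g {..n + 1} (\<lambda>j. linear_form (h j)) m)
      (real (n + 1) - 1 - (\<Sum>j\<le>n + 1. 1 / (real (max (m j) n) / real n)))"
  proof (rule log_canonical_degree_1[OF a])
    show "orb_mult 1 (proj_space 1) n g {..n + 1} (\<lambda>j. linear_form (h j)) m (a j) =
        real (max (m j) n) / real n" if "j \<le> n + 1" for j
    proof -
      have "max 1 (real (m j) / real n) = real (max (m j) n) / real n"
        using n by (auto simp: max_def field_simps)
      thus ?thesis
        unfolding orb_mult_def Let_def Ja[OF aP[OF that]] Ja1[OF that] using co[OF that] by simp
    qed
    show "orb_mult 1 (proj_space 1) n g {..n + 1} (\<lambda>j. linear_form (h j)) m x = 1"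
      if "x \<in> proj_space 1 - a ` {..n + 1}" for x
      unfolding orb_mult_def Let_def using Ja[of x] Ja0[OF that] that by simp
  qed
  thus ?honest by (simp add: sum_distrib_left right_diff_distrib del: sum.atMost_Suc)
qed

end

lemma rational_normal_curveE:
  assumes "n \<ge> 1" "rational_normal_curve n C"
  obtains A B where "normal_curve n A B" "C = normal_curve.curve n A"
proof -
  obtain A where A: "A \<in> carrier_mat (n + 1) (n + 1)" "invertible_mat A"
    and C: "C = {proj_pt (A *\<^sub>v veronese n s t) | s t. (s, t) \<noteq> (0, 0)}"
    using assms(2) unfolding rational_normal_curve_def by blast
  obtain B where B: "A * B = 1\<^sub>m (dim_row A)" "B * A = 1\<^sub>m (dim_row B)"
    using A(2) unfolding invertible_mat_def inverts_mat_def by blast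
  \<comment> \<open>\<open>invertible_mat\<close> leaves the shape of \<open>B\<close> open; it is
    read off the dimensions of the two products.\<close>
  have "dim_row B = n + 1" "dim_col B = n + 1"
    using arg_cong[OF B(1), of dim_col] arg_cong[OF B(2), of dim_col] A(1) by auto
  hence nc: "normal_curve n A B" using assms(1) A(1) B by unfold_locales auto
  show ?thesis by (rule that[OF nc]) (simp add: normal_curve.curve_def[OF nc] C)
qed

section \<open>A curve through the generic point\<close>

text \<open>Instead of rescaling coordinates until the last form is their sum, the proof keeps its
  coefficients \<open>c j\<close> in the basis dual to the other forms. The weights of the power
  sums are then \<open>c j * z j\<close>, where the \<open>z j\<close> are the coordinates of the
  given point.\<close>

lemma generic_normal_curve:
  assumes n: "n \<ge> 1" and h: "\<And>j. j \<le> n + 1 \<Longrightarrow> h j \<in> carrier_vec (n + 1)"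
    and gp: "general_position n {..n + 1} h"
  shows "holds_generically n (\<lambda>x. \<exists>C. rational_normal_curve n C \<and> x \<in> C \<and>
           (\<forall>j\<le>n + 1. is_singleton (C \<inter> hyperplane n (h j))))"
proof -
  have h': "h j \<in> carrier_vec (n + 1)" if "j \<in> {..n + 1}" for j using h that by simp
  have sub: "{..n} \<subseteq> {..n + 1}" "card {..n} = n + 1" by auto
  obtain w where w: "\<And>i. i \<in> {..n} \<Longrightarrow> w i \<in> carrier_vec (n + 1)"
    "\<And>i j. i \<in> {..n} \<Longrightarrow> j \<in> {..n} \<Longrightarrow> linear_form (h j) (w i) = (if i = j then 1 else 0)"
    by (rule general_position_dual[OF gp h' sub]) (assumption, rule that, assumption+)
  define comb where "comb = (\<lambda>y. vec (n + 1) (\<lambda>i. \<Sum>j\<le>n. y j * w j $ i))"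
  have comb_carrier: "comb y \<in> carrier_vec (n + 1)" for y by (simp add: comb_def)
  have comb_form: "linear_form f (comb y) = (\<Sum>j\<le>n. y j * linear_form f (w j))"
    if f: "f \<in> carrier_vec (n + 1)" for f y
  proof -
    have "linear_form f (comb y) = (\<Sum>i\<le>n. \<Sum>j\<le>n. y j * (f $ i * w j $ i))"
      unfolding linear_form_sum[OF f comb_carrier]
      by (intro sum.cong) (auto simp: comb_def sum_distrib_left mult_ac)
    also have "\<dots> = (\<Sum>j\<le>n. y j * (\<Sum>i\<le>n. f $ i * w j $ i))"
      by (subst sum.swap) (simp add: sum_distrib_left)
    also have "\<dots> = (\<Sum>j\<le>n. y j * linear_form f (w j))"
      using linear_form_sum[OF f w(1)] by (intro sum.cong) auto
    finally show ?thesis .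
  qed
  have comb_coord: "linear_form (h l) (comb y) = y l" if "l \<le> n" for l y
  proof -
    have hl: "h l \<in> carrier_vec (n + 1)" using h that by simp
    have "linear_form (h l) (comb y) = (\<Sum>j\<le>n. if j = l then y j else 0)"
      unfolding comb_form[OF hl]
      using w(2) that by (intro sum.cong) auto
    thus ?thesis using that by simp
  qed
  have eqI: "u = v" if "u \<in> carrier_vec (n + 1)" "v \<in> carrier_vec (n + 1)"
    "\<And>l. l \<le> n \<Longrightarrow> linear_form (h l) u = linear_form (h l) v" for u v
  proof -
    have "u - v = 0\<^sub>v (n + 1)"
    proof (rule general_position_kernel[OF gp h' sub])
      fix l assume l: "l \<in> {..n}"
      show "linear_form (h l) (u - v) = 0"
        using that(3)[of l] scalar_prod_minus_distrib[OF h that(1,2), of l] l by (simp add: linear_form_def)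
    qed (use that in auto)
    hence d: "(u - v) $ i = 0" if "i < n + 1" for i using that by simp
    show ?thesis
    proof (rule eq_vecI)
      fix i assume "i < dim_vec v"
      thus "u $ i = v $ i" using d[of i] that(1,2) by simp
    qed (use that in auto)
  qed
  define c where "c = (\<lambda>j. linear_form (h (n + 1)) (w j))"
  \<comment> \<open>Otherwise \<open>w j\<close> would lie on all hyperplanes but the
    \<open>j\<close>-th, which are \<open>n + 1\<close> in number.\<close>
  have c: "c j \<noteq> 0" if j: "j \<le> n" for j
  proof
    assume c0: "c j = 0"
    have "w j = 0\<^sub>v (n + 1)"
    proof (rule general_position_kernel[OF gp h'])
      show "{..n + 1} - {j} \<subseteq> {..n + 1}" "card ({..n + 1} - {j}) = n + 1" using j by auto
      show "w j \<in> carrier_vec (n + 1)" using w(1) j by simp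
      fix l assume "l \<in> {..n + 1} - {j}"
      hence "l = n + 1 \<or> l \<le> n \<and> l \<noteq> j" by auto
      thus "linear_form (h l) (w j) = 0" using c0 w(2)[of j l] j by (auto simp: c_def)
    qed auto
    hence "linear_form (h j) (w j) = 0" using h[of j] j by (simp add: linear_form_def)
    thus False using w(2)[of j j] j by simp
  qed
  \<comment> \<open>A single form that vanishes exactly where some nonempty partial sum of the
    weights does, so the exceptional set is a hypersurface.\<close>
  define F where "F = (\<lambda>v. \<Prod>I\<in>Pow {..n} - {{}}. \<Sum>j\<in>I. c j * linear_form (h j) v)"
  have "hom_form n (\<Sum>I\<in>Pow {..n} - {{}}. 1) F"
    unfolding F_def
  proof (rule hom_form_prod)
    fix I assume "I \<in> Pow {..n} - {{}}"
    thus "hom_form n 1 (\<lambda>v. \<Sum>j\<in>I. c j * linear_form (h j) v)"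
      by (intro hom_form_sum hom_form_cmult hom_form_linear h) auto
  qed simp
  then obtain d where F: "hom_form n d F" by blast
  define Z where "Z = hypersurface n F"
  have F0: "F v \<noteq> 0 \<longleftrightarrow> (\<forall>I. I \<subseteq> {..n} \<longrightarrow> I \<noteq> {} \<longrightarrow> (\<Sum>j\<in>I. c j * linear_form (h j) v) \<noteq> 0)" for v
    unfolding F_def by (subst prod_zero_iff) auto
  have "Z \<noteq> proj_space n"
  proof -
    \<comment> \<open>At this point all weights are 1, so the partial sums are
      cardinalities.\<close>
    define v where "v = comb (\<lambda>j. 1 / c j)"
    have "(\<Sum>j\<in>I. c j * linear_form (h j) v) \<noteq> 0" if I: "I \<subseteq> {..n}" "I \<noteq> {}" for I
    proof -
      have "(\<Sum>j\<in>I. c j * linear_form (h j) v) = (\<Sum>j\<in>I. 1)"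
        using I c by (intro sum.cong) (auto simp: v_def comb_coord)
      thus ?thesis using I finite_subset[OF I(1)] by simp
    qed
    hence Fv: "F v \<noteq> 0" unfolding F0 by blast
    have v: "v \<in> carrier_vec (n + 1)" unfolding v_def by (rule comb_carrier)
    have v0: "v \<noteq> 0\<^sub>v (n + 1)"
    proof
      assume "v = 0\<^sub>v (n + 1)"
      hence "linear_form (h 0) v = 0" using h[of 0] by (simp add: linear_form_def)
      thus False using c[of 0] by (simp add: v_def comb_coord)
    qed
    have "proj_pt v \<notin> Z" unfolding Z_def using hypersurface_mem_iff[OF F v v0] Fv by simp
    thus ?thesis using proj_pt_in_proj_space[OF v v0] by blast
  qed
  moreover have "zariski_closed n Z" unfolding Z_def by (rule zariski_closed_hypersurface[OF F])
  moreover have "\<exists>C. rational_normal_curve n C \<and> x \<in> C \<and>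
           (\<forall>j\<le>n + 1. is_singleton (C \<inter> hyperplane n (h j)))" if x: "x \<in> proj_space n - Z" for x
  proof -
    obtain v where v: "v \<in> carrier_vec (n + 1)" "v \<noteq> 0\<^sub>v (n + 1)" "x = proj_pt v"
      using x by (auto elim: proj_spaceE)
    define z where "z = (\<lambda>j. linear_form (h j) v)"
    have "F v \<noteq> 0" using x hypersurface_mem_iff[OF F v(1,2)] v(3) by (simp add: Z_def)
    hence sums: "(\<Sum>j\<in>I. c j * z j) \<noteq> 0" if "I \<subseteq> {..n}" "I \<noteq> {}" for I
      using that unfolding F0 z_def by blast
    have z0: "z j \<noteq> 0" if "j \<le> n" for j using sums[of "{j}"] that by auto
    obtain b where b: "inj_on b {..n}" "\<And>k. k \<in> {1..n} \<Longrightarrow> (\<Sum>j\<le>n. (c j * z j) * b j ^ k) = 0"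
      by (rule exists_weighted_power_sum_zeros[of n "\<lambda>j. c j * z j"]) (use sums in auto)
    \<comment> \<open>In the dual basis, column \<open>i\<close> holds the coefficients of s^(n-i)
      t^i in the binary forms \<open>z j * (s - b j * t) ^ n\<close>.\<close>
    define A where "A = mat (n + 1) (n + 1)
      (\<lambda>(r, i). \<Sum>j\<le>n. z j * (of_nat (n choose i) * (- b j) ^ i) * w j $ r)"
    have A: "A \<in> carrier_mat (n + 1) (n + 1)" by (simp add: A_def)
    have Au: "A *\<^sub>v u = comb (\<lambda>j. z j * (\<Sum>i\<le>n. of_nat (n choose i) * (- b j) ^ i * u $ i))"
      if u: "u \<in> carrier_vec (n + 1)" for u
    proof (rule eq_vecI)
      fix r assume "r < dim_vec (comb (\<lambda>j. z j * (\<Sum>i\<le>n. of_nat (n choose i) * (- b j) ^ i * u $ i)))"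
      hence r: "r < n + 1" by (simp add: comb_def)
      have "(A *\<^sub>v u) $ r = (\<Sum>i\<le>n. (\<Sum>j\<le>n. z j * (of_nat (n choose i) * (- b j) ^ i) * w j $ r) * u $ i)"
        using r u by (simp add: A_def scalar_prod_def lessThan_Suc_atMost[symmetric] lessThan_atLeast0
            del: sum.op_ivl_Suc)
      also have "\<dots> = (\<Sum>j\<le>n. \<Sum>i\<le>n. z j * (of_nat (n choose i) * (- b j) ^ i) * w j $ r * u $ i)"
        unfolding sum_distrib_right by (rule sum.swap)
      also have "\<dots> = (\<Sum>j\<le>n. z j * (\<Sum>i\<le>n. of_nat (n choose i) * (- b j) ^ i * u $ i) * w j $ r)"
        by (simp add: sum_distrib_left sum_distrib_right mult_ac)
      finally show "(A *\<^sub>v u) $ r = comb (\<lambda>j. z j * (\<Sum>i\<le>n. of_nat (n choose i) * (- b j) ^ i * u $ i)) $ r"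
        using r by (simp add: comb_def)
    qed (simp add: A_def comb_def)
    have "u = 0\<^sub>v (n + 1)" if u: "u \<in> carrier_vec (n + 1)" "A *\<^sub>v u = 0\<^sub>v (n + 1)" for u
    proof -
      \<comment> \<open>These are the coefficients of a polynomial of degree at most
        \<open>n\<close> that vanishes at the \<open>n + 1\<close> distinct points
        \<open>- b j\<close>.\<close>
      have "of_nat (n choose i) * u $ i = 0" if "i < n + 1" for i
      proof (rule poly_coeffs_zero[where n = "n + 1" and b = "\<lambda>j. - b j"])
        show "inj_on (\<lambda>j. - b j) {..<n + 1}" using b(1) by (auto simp: inj_on_def less_Suc_eq_le)
        fix l assume "l < n + 1"
        hence l: "l \<le> n" by simp
        have "linear_form (h l) (A *\<^sub>v u) = 0" unfolding u(2) using h[of l] l by (simp add: linear_form_def)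
        hence "(\<Sum>i\<le>n. of_nat (n choose i) * (- b l) ^ i * u $ i) = 0"
          unfolding Au[OF u(1)] comb_coord[OF l] using z0[OF l] by simp
        thus "(\<Sum>k<n + 1. of_nat (n choose k) * u $ k * (- b l) ^ k) = 0"
          by (simp add: lessThan_Suc_atMost mult_ac)
      qed fact
      thus ?thesis using u(1) by (intro eq_vecI) (auto simp: less_Suc_eq_le)
    qed
    then obtain B where B: "B \<in> carrier_mat (n + 1) (n + 1)" "A * B = 1\<^sub>m (n + 1)" "B * A = 1\<^sub>m (n + 1)"
      using trivial_kernel_imp_inverse[OF A] by blast
    interpret normal_curve n A B using n A B by unfold_locales auto
    have Av: "G (vec2 s t) = comb (\<lambda>j. z j * (s - b j * t) ^ n)" for s t
    proof -
      have "(\<Sum>i\<le>n. of_nat (n choose i) * (- b j) ^ i * veronese n s t $ i) = (s - b j * t) ^ n" for j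
      proof -
        have "(s - b j * t) ^ n = (- (b j * t) + s) ^ n" by simp
        also have "\<dots> = (\<Sum>i\<le>n. of_nat (n choose i) * (- (b j * t)) ^ i * s ^ (n - i))" by (rule binomial_ring)
        also have "\<dots> = (\<Sum>i\<le>n. of_nat (n choose i) * (- b j) ^ i * veronese n s t $ i)"
        proof (intro sum.cong refl)
          fix i assume i: "i \<in> {..n}"
          have "(- (b j * t)) ^ i = (- b j) ^ i * t ^ i" by (simp flip: power_mult_distrib)
          thus "of_nat (n choose i) * (- (b j * t)) ^ i * s ^ (n - i) =
              of_nat (n choose i) * (- b j) ^ i * veronese n s t $ i"
            using i by (simp add: veronese_index)
        qed
        finally show ?thesis by simp
      qed
      thus ?thesis unfolding G_vec2 by (subst Au) simp_all
    qed
    \<comment> \<open>In the shape \<open>q * s - p * t\<close> with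
      \<open>(p, q) = (b j, 1)\<close>, as \<open>curve_hyperplane\<close> expects; the contact
      point is [b_j : 1].\<close>
    have contact: "linear_form (h j) (G (vec2 s t)) = z j * (1 * s - b j * t) ^ n" if "j \<le> n" for j s t
      unfolding Av comb_coord[OF that] by simp
    define Y where "Y = (\<Sum>j\<le>n. c j * z j)"
    have Y: "Y \<noteq> 0" using sums[of "{..n}"] by (simp add: Y_def)
    \<comment> \<open>The power sum equations kill all terms with \<open>i \<ge> 1\<close> of the
      binomial expansion, so the last hyperplane is met at [0 : 1].\<close>
    have contact': "linear_form (h (n + 1)) (G (vec2 s t)) = Y * (1 * s - 0 * t) ^ n" for s t
    proof -
      have "linear_form (h (n + 1)) (G (vec2 s t)) = (\<Sum>j\<le>n. c j * z j * (- (b j * t) + s) ^ n)"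
        unfolding Av comb_form[OF h[OF order_refl]] by (auto simp: c_def mult_ac intro!: sum.cong)
      also have "\<dots> = (\<Sum>j\<le>n. \<Sum>i\<le>n. of_nat (n choose i) * (- t) ^ i * s ^ (n - i) * (c j * z j * b j ^ i))"
      proof (intro sum.cong refl)
        fix j
        have "(- (b j * t)) ^ i = (- t) ^ i * b j ^ i" for i by (simp flip: power_mult_distrib add: mult.commute)
        thus "c j * z j * (- (b j * t) + s) ^ n =
            (\<Sum>i\<le>n. of_nat (n choose i) * (- t) ^ i * s ^ (n - i) * (c j * z j * b j ^ i))"
          unfolding binomial_ring by (simp add: sum_distrib_left mult_ac)
      qed
      also have "\<dots> = (\<Sum>i\<le>n. of_nat (n choose i) * (- t) ^ i * s ^ (n - i) * (\<Sum>j\<le>n. c j * z j * b j ^ i))"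
        by (subst sum.swap) (simp add: sum_distrib_left)
      also have "\<dots> = (\<Sum>i\<in>{0}. of_nat (n choose i) * (- t) ^ i * s ^ (n - i) * (\<Sum>j\<le>n. c j * z j * b j ^ i))"
        by (rule sum.mono_neutral_right) (use b(2) in auto)
      also have "\<dots> = Y * (1 * s - 0 * t) ^ n" by (simp add: Y_def)
      finally show ?thesis .
    qed
    have "is_singleton (curve \<inter> hyperplane n (h j))" if j: "j \<le> n + 1" for j
    proof (cases "j = n + 1")
      case True
      show ?thesis unfolding True
        by (subst curve_hyperplane(2)[OF h Y _ contact']) (auto simp: is_singleton_def)
    next
      case False
      hence j': "j \<le> n" using j by simp
      show ?thesis
        by (subst curve_hyperplane(2)[OF h[OF j] z0[OF j'] _ contact[OF j']]) (auto simp: is_singleton_def)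
    qed
    moreover have "rational_normal_curve n curve"
      unfolding rational_normal_curve_def curve_def using A B AB BA
      by (intro bexI[of _ A] conjI refl) (auto simp: invertible_mat_def inverts_mat_def square_mat.simps intro!: exI[of _ B])
    moreover have "x \<in> curve"
    proof -
      \<comment> \<open>At [1 : 0] every factor \<open>s - b j * t\<close> is 1, which leaves the
        coordinates \<open>z\<close> of the given point.\<close>
      have "G (vec2 1 0) = v"
        unfolding Av by (rule eqI[OF comb_carrier v(1)]) (simp add: comb_coord z_def)
      moreover have "proj_pt (vec2 1 0) \<in> proj_space 1" by (rule proj_pt_vec2_in) simp
      ultimately show ?thesis unfolding g_image[symmetric] v(3) using g_vec2[of 1 0] by (metis imageI prod.inject zero_neq_one)
    qed
    ultimately show ?thesis by blast
  qed
  ultimately show ?thesis unfolding holds_generically_def by blast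
qed

theorem corollary7p16:
  fixes n :: nat and h :: "nat \<Rightarrow> complex vec" and m :: "nat \<Rightarrow> nat"
  assumes "n \<ge> 2"
    and "\<And>j. j \<le> n + 1 \<Longrightarrow> h j \<in> carrier_vec (n + 1) \<and> h j \<noteq> 0\<^sub>v (n + 1)"
    and "general_position n {..n + 1} h"
    and "2 \<le> m 0"
    and "\<And>j. j \<le> n \<Longrightarrow> m j \<le> m (j + 1)"
  shows "holds_generically n (\<lambda>x. \<exists>C. rational_normal_curve n C \<and> x \<in> C \<and>
           (\<forall>j\<le>n + 1. is_singleton (C \<inter> hyperplane n (h j))))
    \<and> (\<forall>C. rational_normal_curve n C \<and>
           (\<forall>j\<le>n + 1. is_singleton (C \<inter> hyperplane n (h j))) \<longrightarrow>
         (fano n m \<longrightarrow>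
            virtually_orb_rational n {..n + 1} (\<lambda>j. linear_form (h j)) m C)
       \<and> (trivial_canonical_bundle n m \<longrightarrow>
            virtually_orb_elliptic n {..n + 1} (\<lambda>j. linear_form (h j)) m C)
       \<and> (fano n m \<and>
            (n = 2 \<or> m 0 \<ge> n \<or> (\<Sum>j\<le>n + 1. 1 / real (max (m j) n)) > 1) \<longrightarrow>
            orb_rational n {..n + 1} (\<lambda>j. linear_form (h j)) m C)
       \<and> (trivial_canonical_bundle n m \<and>
            (n = 2 \<or> m 0 \<ge> n \<or> (\<Sum>j\<le>n + 1. 1 / real (max (m j) n)) = 1) \<longrightarrow>
            orb_elliptic n {..n + 1} (\<lambda>j. linear_form (h j)) m C))"
proof (intro conjI[OF generic_normal_curve] allI impI)
  show n1: "1 \<le> n" using assms(1) by simp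
  show h: "h j \<in> carrier_vec (n + 1)" if "j \<le> n + 1" for j using assms(2) that by blast
  show "general_position n {..n + 1} h" by fact
  fix C assume C: "rational_normal_curve n C \<and> (\<forall>j\<le>n + 1. is_singleton (C \<inter> hyperplane n (h j)))"
  then obtain A B where nc: "normal_curve n A B" and CA: "C = normal_curve.curve n A"
    using rational_normal_curveE[OF n1] by blast
  interpret normal_curve n A B by (rule nc)
  have sing: "is_singleton (curve \<inter> hyperplane n (h j))" if "j \<le> n + 1" for j using C CA that by blast
  have support: "\<not> curve \<subseteq> orbifold_support n {..n + 1} (\<lambda>j. linear_form (h j))"
    by (rule curve_not_subset_support[OF sing])
  define \<sigma> where "\<sigma> = (\<Sum>j\<le>n + 1. 1 / real (m j))"
  define \<sigma>' where "\<sigma>' = (\<Sum>j\<le>n + 1. 1 / real (max (m j) n))"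
  have virtual: "log_canonical_degree_is 1 (proj_space 1)
      (virtual_orb_mult 1 (proj_space 1) n g {..n + 1} (\<lambda>j. linear_form (h j)) m) (real n * (1 - \<sigma>))"
    unfolding \<sigma>_def by (rule orbifold_degrees(1)[OF h assms(3) sing])
  have honest: "log_canonical_degree_is 1 (proj_space 1)
      (orb_mult 1 (proj_space 1) n g {..n + 1} (\<lambda>j. linear_form (h j)) m) (real n * (1 - \<sigma>'))"
    unfolding \<sigma>'_def by (rule orbifold_degrees(2)[OF h assms(3) sing])
  \<comment> \<open>There are \<open>n + 2\<close> summands, one more than the bound
    \<open>n + 1\<close> in both conditions.\<close>
  have "(\<Sum>j\<le>n + 1. 1 - 1 / real (m j)) = real n + 2 - \<sigma>"
    unfolding \<sigma>_def sum_subtractf by simp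
  hence fano: "fano n m \<longleftrightarrow> \<sigma> > 1" and trivial: "trivial_canonical_bundle n m \<longleftrightarrow> \<sigma> = 1"
    unfolding fano_def trivial_canonical_bundle_def by auto
  have mono: "m 0 \<le> m j" if "j \<le> n + 1" for j
    using that
  proof (induction j)
    case (Suc j)
    thus ?case using assms(5)[of j] by simp
  qed simp
  \<comment> \<open>For \<open>n = 2\<close> the bound \<open>m 0 \<ge> n\<close> holds as well, and
    by monotonicity every \<open>max (m j) n\<close> equals \<open>m j\<close>.\<close>
  have same: "\<sigma>' = \<sigma>" if "n = 2 \<or> m 0 \<ge> n"
  proof -
    have "max (m j) n = m j" if "j \<le> n + 1" for j
      using mono[OF that] assms(4) \<open>n = 2 \<or> m 0 \<ge> n\<close> by auto
    thus ?thesis unfolding \<sigma>_def \<sigma>'_def by (intro sum.cong) auto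
  qed
  have neg: "real n * (1 - x) < 0" if "x > 1" for x using that assms(1) by (simp add: mult_pos_neg)
  show "(fano n m \<longrightarrow> virtually_orb_rational n {..n + 1} (\<lambda>j. linear_form (h j)) m C)
       \<and> (trivial_canonical_bundle n m \<longrightarrow> virtually_orb_elliptic n {..n + 1} (\<lambda>j. linear_form (h j)) m C)
       \<and> (fano n m \<and> (n = 2 \<or> m 0 \<ge> n \<or> (\<Sum>j\<le>n + 1. 1 / real (max (m j) n)) > 1) \<longrightarrow>
            orb_rational n {..n + 1} (\<lambda>j. linear_form (h j)) m C)
       \<and> (trivial_canonical_bundle n m \<and>
            (n = 2 \<or> m 0 \<ge> n \<or> (\<Sum>j\<le>n + 1. 1 / real (max (m j) n)) = 1) \<longrightarrow>
            orb_elliptic n {..n + 1} (\<lambda>j. linear_form (h j)) m C)"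
  proof (intro conjI impI)
    assume "fano n m"
    hence "\<sigma> > 1" using fano by simp
    thus "virtually_orb_rational n {..n + 1} (\<lambda>j. linear_form (h j)) m C"
      unfolding virtually_orb_rational_def CA using support normalisation_curve virtual neg by blast
  next
    assume "trivial_canonical_bundle n m"
    hence "real n * (1 - \<sigma>) = 0" using trivial by simp
    thus "virtually_orb_elliptic n {..n + 1} (\<lambda>j. linear_form (h j)) m C"
      unfolding virtually_orb_elliptic_def CA using support normalisation_curve virtual by metis
  next
    assume "fano n m \<and> (n = 2 \<or> m 0 \<ge> n \<or> (\<Sum>j\<le>n + 1. 1 / real (max (m j) n)) > 1)"
    hence "\<sigma>' > 1" using fano same unfolding \<sigma>'_def[symmetric] by auto
    thus "orb_rational n {..n + 1} (\<lambda>j. linear_form (h j)) m C"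
      unfolding orb_rational_def CA using support normalisation_curve honest neg by blast
  next
    assume "trivial_canonical_bundle n m \<and> (n = 2 \<or> m 0 \<ge> n \<or> (\<Sum>j\<le>n + 1. 1 / real (max (m j) n)) = 1)"
    hence "real n * (1 - \<sigma>') = 0" using trivial same unfolding \<sigma>'_def[symmetric] by auto
    thus "orb_elliptic n {..n + 1} (\<lambda>j. linear_form (h j)) m C"
      unfolding orb_elliptic_def CA using support normalisation_curve honest by metis
  qed
qed

end
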